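(* Let $0<s\le r<\infty$ and let $T_i\in L(X_i,Y_i)$ for $i=1,2,\dots,m$, where $X_i,Y_i$ are Banach spaces. If each operator $T_i$ can be factored through an $S_{r,s}$-operator, then the tensor product $$T:=T_1\otimes T_2\otimes\dots\otimes T_m: X_1\widehat\otimes X_2\widehat\otimes\dots\widehat\otimes X_m\to Y_1\widetilde\otimes Y_2\widetilde\otimes\dots\widetilde\otimes Y_m$$ can also be factored through an $S_{r,s}$-operator.
   Context: All Banach spaces are complex, and (standing assumption) all operators under consideration are not identically zero. $\widehat\otimes$ denotes the completed projective tensor product and $\widetilde\otimes$ the completed injective tensor product of Banach spaces. The operator $T_1\otimes\dots\otimes T_m$ is the continuous linear extension of $x_1\otimes\dots\otimes x_m\mapsto T_1x_1\otimes\dots\otimes T_mx_m$. For a Hilbert space $H$ and $0<r,s<\infty$, the Lorentz–Schatten class $S_{r,s}(H)$ consists of compact operators on $H$ whose singular numbers $(s_n)$ satisfy $\sum_n n^{s/r-1}s_n^s<\infty$. An operator $S\in L(Z,W)$ can be factored through an $S_{r,s}$-operator if there are a Hilbert space $H$, $U\in S_{r,s}(H)$ and bounded $A: Z\to H$, $B: H\to W$ with $S=BUA$. *)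

theory Defs
  imports "HOL-Analysis.Analysis" "HOL-Algebra.Module"
begin

section \<open>Complex Banach and Hilbert spaces with explicit carriers\<close>

text \<open>
  The spaces form families indexed by numbers, and tensor products and completions are built
  from them, so a space is a record with a carrier set: a module in the sense of HOL-Algebra,
  equipped with a norm. The fields \<open>mult\<close> and \<open>one\<close>, which every module record inherits, carry no
  meaning for such a space, except for the space \<open>complex_line\<close>, which is also the scalar ring.
\<close>

record 'a normed = "(complex, 'a) module" +
  nrm :: "'a \<Rightarrow> real"

record 'a inner_normed = "'a normed" +
  cip :: "'a \<Rightarrow> 'a \<Rightarrow> complex"

definition complex_line :: "complex normed" where
  "complex_line = \<lparr>carrier = UNIV, mult = (*), one = 1, zero = 0, add = (+), smult = (*), nrm = cmod\<rparr>"

text \<open>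
  The locale \<open>Metric_space\<close> requires symmetry and nonnegativity on the whole type, hence the
  default value outside the carrier.
\<close>

definition ndist :: "('a, 'e) normed_scheme \<Rightarrow> 'a \<Rightarrow> 'a \<Rightarrow> real" where
  "ndist X x y = (if x \<in> carrier X \<and> y \<in> carrier X then nrm X (x \<ominus>\<^bsub>X\<^esub> y) else 0)"

abbreviation ntopology :: "('a, 'e) normed_scheme \<Rightarrow> 'a topology" where
  "ntopology X \<equiv> Metric_space.mtopology (carrier X) (ndist X)"

abbreviation ncauchy :: "('a, 'e) normed_scheme \<Rightarrow> (nat \<Rightarrow> 'a) \<Rightarrow> bool" where
  "ncauchy X \<equiv> Metric_space.MCauchy (carrier X) (ndist X)"

locale complex_normed_space = module complex_line X
  for X :: "('a, 'e) normed_scheme" (structure) +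
  assumes nrm_nonneg: "x \<in> carrier X \<Longrightarrow> 0 \<le> nrm X x"
    and nrm_eq_0_iff: "x \<in> carrier X \<Longrightarrow> nrm X x = 0 \<longleftrightarrow> x = \<zero>\<^bsub>X\<^esub>"
    and nrm_triangle:
      "\<lbrakk>x \<in> carrier X; y \<in> carrier X\<rbrakk> \<Longrightarrow> nrm X (x \<oplus>\<^bsub>X\<^esub> y) \<le> nrm X x + nrm X y"
    and nrm_smult: "x \<in> carrier X \<Longrightarrow> nrm X (c \<odot>\<^bsub>X\<^esub> x) = cmod c * nrm X x"

locale complex_banach_space = complex_normed_space +
  assumes complete: "Metric_space.mcomplete (carrier X) (ndist X)"

locale complex_hilbert_space = complex_banach_space H
  for H :: "('a, 'e) inner_normed_scheme" (structure) +
  assumes cip_add_left: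
      "\<lbrakk>x \<in> carrier H; y \<in> carrier H; z \<in> carrier H\<rbrakk>
        \<Longrightarrow> cip H (x \<oplus>\<^bsub>H\<^esub> y) z = cip H x z + cip H y z"
    and cip_smult_left:
      "\<lbrakk>x \<in> carrier H; y \<in> carrier H\<rbrakk> \<Longrightarrow> cip H (c \<odot>\<^bsub>H\<^esub> x) y = c * cip H x y"
    and cip_commute:
      "\<lbrakk>x \<in> carrier H; y \<in> carrier H\<rbrakk> \<Longrightarrow> cip H y x = cnj (cip H x y)"
    and cip_self: "x \<in> carrier H \<Longrightarrow> cip H x x = complex_of_real ((nrm H x)\<^sup>2)"


section \<open>Operators\<close>

definition clinear_map ::
    "('a, 'e) normed_scheme \<Rightarrow> ('b, 'f) normed_scheme \<Rightarrow> ('a \<Rightarrow> 'b) \<Rightarrow> bool" where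
  "clinear_map X Y T \<longleftrightarrow>
     T \<in> carrier X \<rightarrow> carrier Y \<and>
     (\<forall>x\<in>carrier X. \<forall>y\<in>carrier X. T (x \<oplus>\<^bsub>X\<^esub> y) = T x \<oplus>\<^bsub>Y\<^esub> T y) \<and>
     (\<forall>c. \<forall>x\<in>carrier X. T (c \<odot>\<^bsub>X\<^esub> x) = c \<odot>\<^bsub>Y\<^esub> T x)"

definition bounded_op ::
    "('a, 'e) normed_scheme \<Rightarrow> ('b, 'f) normed_scheme \<Rightarrow> ('a \<Rightarrow> 'b) \<Rightarrow> bool" where
  "bounded_op X Y T \<longleftrightarrow>
     clinear_map X Y T \<and> (\<exists>K. \<forall>x\<in>carrier X. nrm Y (T x) \<le> K * nrm X x)"

definition compact_op ::
    "('a, 'e) normed_scheme \<Rightarrow> ('b, 'f) normed_scheme \<Rightarrow> ('a \<Rightarrow> 'b) \<Rightarrow> bool" where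
  "compact_op X Y T \<longleftrightarrow>
     clinear_map X Y T \<and>
     compactin (ntopology Y) (ntopology Y closure_of (T ` {x \<in> carrier X. nrm X x \<le> 1}))"


section \<open>Lorentz--Schatten classes\<close>

definition hadjoint :: "('a, 'e) inner_normed_scheme \<Rightarrow> ('a \<Rightarrow> 'a) \<Rightarrow> 'a \<Rightarrow> 'a" where
  "hadjoint H U y = (THE z. z \<in> carrier H \<and> (\<forall>x\<in>carrier H. cip H (U x) y = cip H x z))"

definition is_basis_of ::
    "('a, 'e) normed_scheme \<Rightarrow> 'a set \<Rightarrow> nat \<Rightarrow> (nat \<Rightarrow> 'a) \<Rightarrow> bool" where
  "is_basis_of X V k b \<longleftrightarrow>
     b \<in> {..<k} \<rightarrow> V \<and>
     (\<forall>x\<in>V. \<exists>!c. c \<in> {..<k} \<rightarrow>\<^sub>E UNIV \<and> x = (\<Oplus>\<^bsub>X\<^esub>j\<in>{..<k}. c j \<odot>\<^bsub>X\<^esub> b j))"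

text \<open>
  The singular numbers of a compact operator \<open>U\<close> are the square roots of the eigenvalues of
  \<open>U\<^sup>* U\<close> (that is, the eigenvalues of its modulus), in decreasing order and repeated according to
  multiplicity; the sequence is continued by zeros if there are only finitely many nonzero ones.
  The predicate below determines this sequence: each \<open>\<mu> > 0\<close> occurs in it exactly as often as the
  dimension of the eigenspace of \<open>U\<^sup>* U\<close> for \<open>\<mu>\<^sup>2\<close> says. The numbering starts at 0.
\<close>

definition singular_numbers ::
    "('a, 'e) inner_normed_scheme \<Rightarrow> ('a \<Rightarrow> 'a) \<Rightarrow> (nat \<Rightarrow> real) \<Rightarrow> bool" where
  "singular_numbers H U \<sigma> \<longleftrightarrow>
     decseq \<sigma> \<and> (\<forall>n. 0 \<le> \<sigma> n) \<and>
     (\<forall>\<mu>>0. finite {n. \<sigma> n = \<mu>} \<and>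
        (\<exists>b. is_basis_of H
               {x \<in> carrier H. hadjoint H U (U x) = complex_of_real (\<mu>\<^sup>2) \<odot>\<^bsub>H\<^esub> x}
               (card {n. \<sigma> n = \<mu>}) b))"

definition lorentz_schatten ::
    "real \<Rightarrow> real \<Rightarrow> ('a, 'e) inner_normed_scheme \<Rightarrow> ('a \<Rightarrow> 'a) set" where
  "lorentz_schatten r s H =
     {U. compact_op H H U \<and>
         (\<exists>\<sigma>. singular_numbers H U \<sigma> \<and>
              summable (\<lambda>n. real (Suc n) powr (s / r - 1) * \<sigma> n powr s))}"

text \<open>
  The argument of type \<open>'h itself\<close> names the type in which the carrier of the Hilbert space lives;
  it is needed because HOL cannot quantify over types inside a formula. As a hypothesis the predicate
  covers all Hilbert spaces if \<open>'h\<close> is left arbitrary; as a conclusion it is to be used with a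
  concrete type that is large enough to carry a copy of \<open>\<ell>\<^sup>2\<close>.
\<close>

definition factors_lorentz_schatten ::
    "'h itself \<Rightarrow> real \<Rightarrow> real \<Rightarrow> ('a, 'e) normed_scheme \<Rightarrow> ('b, 'f) normed_scheme
      \<Rightarrow> ('a \<Rightarrow> 'b) \<Rightarrow> bool" where
  "factors_lorentz_schatten _ r s Z W S \<longleftrightarrow>
     bounded_op Z W S \<and>
     (\<exists>(H :: 'h inner_normed) U A B.
        complex_hilbert_space H \<and> U \<in> lorentz_schatten r s H \<and>
        bounded_op Z H A \<and> bounded_op H W B \<and>
        (\<forall>z\<in>carrier Z. S z = B (U (A z))))"


section \<open>Algebraic tensor products\<close>

text \<open>
  The algebraic tensor product of \<open>X 1, \<dots>, X m\<close> is realised, as in Ryan's book on tensor products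
  of Banach spaces, in the algebraic dual of the space of all (not necessarily bounded) multilinear
  forms: the elementary tensor of \<open>x\<close> is evaluation of forms at \<open>x\<close>, and the tensor product consists
  of the finite sums of elementary tensors.
\<close>

abbreviation tuples :: "nat \<Rightarrow> (nat \<Rightarrow> 'a normed) \<Rightarrow> (nat \<Rightarrow> 'a) set" where
  "tuples m X \<equiv> \<Pi>\<^sub>E i\<in>{1..m}. carrier (X i)"

definition multilinear_forms ::
    "nat \<Rightarrow> (nat \<Rightarrow> 'a normed) \<Rightarrow> ((nat \<Rightarrow> 'a) \<Rightarrow> complex) set" where
  "multilinear_forms m X =
     {F \<in> extensional (tuples m X).
        \<forall>x\<in>tuples m X. \<forall>i\<in>{1..m}. clinear_map (X i) complex_line (\<lambda>a. F (x(i := a)))}"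

type_synonym 'a tensor = "((nat \<Rightarrow> 'a) \<Rightarrow> complex) \<Rightarrow> complex"

definition tensor_sum ::
    "nat \<Rightarrow> (nat \<Rightarrow> 'a normed) \<Rightarrow> nat \<Rightarrow> (nat \<Rightarrow> nat \<Rightarrow> 'a) \<Rightarrow> 'a tensor" where
  "tensor_sum m X n xs = (\<lambda>F\<in>multilinear_forms m X. \<Sum>k<n. F (xs k))"

definition elementary_tensor :: "nat \<Rightarrow> (nat \<Rightarrow> 'a normed) \<Rightarrow> (nat \<Rightarrow> 'a) \<Rightarrow> 'a tensor" where
  "elementary_tensor m X x = (\<lambda>F\<in>multilinear_forms m X. F x)"

text \<open>\<open>N\<close> is the norm with which the algebraic tensor product is equipped.\<close>

definition tensor_product ::
    "nat \<Rightarrow> (nat \<Rightarrow> 'a normed) \<Rightarrow> ('a tensor \<Rightarrow> real) \<Rightarrow> 'a tensor normed" where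
  "tensor_product m X N =
     \<lparr>carrier = {tensor_sum m X n xs | n xs. xs \<in> {..<n} \<rightarrow> tuples m X},
      mult = undefined, one = undefined,
      zero = (\<lambda>F\<in>multilinear_forms m X. 0),
      add = (\<lambda>u v. \<lambda>F\<in>multilinear_forms m X. u F + v F),
      smult = (\<lambda>c u. \<lambda>F\<in>multilinear_forms m X. c * u F),
      nrm = N\<rparr>"

definition projective_norm :: "nat \<Rightarrow> (nat \<Rightarrow> 'a normed) \<Rightarrow> 'a tensor \<Rightarrow> real" where
  "projective_norm m X u =
     Inf {\<Sum>k<n. \<Prod>i=1..m. nrm (X i) (xs k i) | n xs.
            xs \<in> {..<n} \<rightarrow> tuples m X \<and> u = tensor_sum m X n xs}"

definition dual_ball :: "'a normed \<Rightarrow> ('a \<Rightarrow> complex) set" where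
  "dual_ball X =
     {\<phi>. clinear_map X complex_line \<phi> \<and> (\<forall>x\<in>carrier X. cmod (\<phi> x) \<le> nrm X x)}"

text \<open>
  If \<open>u\<close> is the sum of the elementary tensors of \<open>xs k\<close>, then the value of \<open>u\<close> at the product form
  below is the sum of the products of the numbers \<open>\<phi> i (xs k i)\<close>.
\<close>

definition injective_norm :: "nat \<Rightarrow> (nat \<Rightarrow> 'a normed) \<Rightarrow> 'a tensor \<Rightarrow> real" where
  "injective_norm m X u =
     Sup {cmod (u (\<lambda>x\<in>tuples m X. \<Prod>i=1..m. \<phi> i (x i))) | \<phi>. \<forall>i\<in>{1..m}. \<phi> i \<in> dual_ball (X i)}"


section \<open>Completions\<close>

definition cauchy_rel :: "'a normed \<Rightarrow> ((nat \<Rightarrow> 'a) \<times> (nat \<Rightarrow> 'a)) set" where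
  "cauchy_rel X =
     {(p, q). ncauchy X p \<and> ncauchy X q \<and> (\<lambda>n. ndist X (p n) (q n)) \<longlonglongrightarrow> 0}"

definition completion :: "'a normed \<Rightarrow> (nat \<Rightarrow> 'a) set normed" where
  "completion X =
     \<lparr>carrier = {p. ncauchy X p} // cauchy_rel X,
      mult = undefined, one = undefined,
      zero = cauchy_rel X `` {\<lambda>n. \<zero>\<^bsub>X\<^esub>},
      add = (\<lambda>P Q. \<Union>p\<in>P. \<Union>q\<in>Q. cauchy_rel X `` {\<lambda>n. p n \<oplus>\<^bsub>X\<^esub> q n}),
      smult = (\<lambda>c P. \<Union>p\<in>P. cauchy_rel X `` {\<lambda>n. c \<odot>\<^bsub>X\<^esub> p n}),
      nrm = (\<lambda>P. lim (\<lambda>n. nrm X ((SOME p. p \<in> P) n)))\<rparr>"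

definition completion_embed :: "'a normed \<Rightarrow> 'a \<Rightarrow> (nat \<Rightarrow> 'a) set" where
  "completion_embed X x = cauchy_rel X `` {\<lambda>n. x}"


section \<open>Completed tensor products and tensor products of operators\<close>

type_synonym 'a ctensor = "(nat \<Rightarrow> 'a tensor) set"

definition projective_tensor :: "nat \<Rightarrow> (nat \<Rightarrow> 'a normed) \<Rightarrow> 'a ctensor normed" where
  "projective_tensor m X = completion (tensor_product m X (projective_norm m X))"

definition injective_tensor :: "nat \<Rightarrow> (nat \<Rightarrow> 'a normed) \<Rightarrow> 'a ctensor normed" where
  "injective_tensor m X = completion (tensor_product m X (injective_norm m X))"

definition projective_elem :: "nat \<Rightarrow> (nat \<Rightarrow> 'a normed) \<Rightarrow> (nat \<Rightarrow> 'a) \<Rightarrow> 'a ctensor" where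
  "projective_elem m X x =
     completion_embed (tensor_product m X (projective_norm m X)) (elementary_tensor m X x)"

definition injective_elem :: "nat \<Rightarrow> (nat \<Rightarrow> 'a normed) \<Rightarrow> (nat \<Rightarrow> 'a) \<Rightarrow> 'a ctensor" where
  "injective_elem m X x =
     completion_embed (tensor_product m X (injective_norm m X)) (elementary_tensor m X x)"

definition tensor_operator ::
    "nat \<Rightarrow> (nat \<Rightarrow> 'a normed) \<Rightarrow> (nat \<Rightarrow> 'b normed) \<Rightarrow> (nat \<Rightarrow> 'a \<Rightarrow> 'b)
      \<Rightarrow> 'a ctensor \<Rightarrow> 'b ctensor" where
  "tensor_operator m X Y T =
     (THE S. S \<in> extensional (carrier (projective_tensor m X)) \<and>
             bounded_op (projective_tensor m X) (injective_tensor m Y) S \<and>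
             (\<forall>x\<in>tuples m X.
                S (projective_elem m X x) = injective_elem m Y (\<lambda>i\<in>{1..m}. T i (x i))))"

end

(*
  A factorization of T_i through an S_{r,s}-operator yields, by the Schmidt decomposition, an
  expansion T_i x = sum_k sigma_{i,k} a_{i,k}(x) y_{i,k} in which sigma_i lies in the Lorentz space
  l_{r,s}, the functionals a_{i,k} map X_i boundedly into l^2, and the vectors y_{i,k} map l^2
  boundedly into Y_i. Expanding the product, T is a sum over multi-indices j with coefficients
  prod_i sigma_{i,j_i}. Cauchy-Schwarz in each coordinate shows that the functionals a_j map the
  projective tensor product into l^2 and that the vectors y_j map l^2 into the injective one, so T
  factors through the diagonal operator with the decreasing rearrangement c of these coefficients.
  The rank of j in the rearrangement is at least prod_i j_i, because all indices of the box below j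
  carry larger coefficients. As n^(s/r-1) is nonincreasing for s <= r, the Lorentz sum of c is at
  most the product of the Lorentz sums of the sigma_i.
*)

theory Submission
  imports Defs
begin

section \<open>Rearranging products of sequences\<close>

text \<open>Vectors of \<open>Y i\<close> are only ever seen through functionals of norm at most 1:
  the expansion of \<open>T i\<close> is a scalar series for each such functional. This weak form
  suffices because the injective norm is a supremum over products of such functionals, and every
  estimate is uniform in them. Two obstacles shape the rest. Singular numbers are given by
  eigenvalue multiplicities of the adjoint times \<open>U\<close>, which says nothing yet about the
  size of \<open>U\<close> on the complement of the eigenvectors found so far; a maximising sequence
  together with compactness supplies that bound. And \<open>tensor_operator\<close> is a definite
  description, so uniqueness of the bounded extension must be proved, for which the completions have
  to be genuine normed spaces. Definiteness of the tensor norms is the hard point: tensors are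
  tested on all multilinear forms, the injective norm only on bounded functionals, and Hahn-Banach
  functionals close the gap one coordinate at a time. Only indices with positive coefficient are
  ranked: a zero coefficient may have infinitely many predecessors.\<close>

lemma rank_enumeration:
  fixes lt :: "'k \<Rightarrow> 'k \<Rightarrow> bool"
  assumes irrefl: "\<And>k. \<not> lt k k"
    and trans: "\<And>i j k. lt i j \<Longrightarrow> lt j k \<Longrightarrow> lt i k"
    and total: "\<And>j k. j \<in> K \<Longrightarrow> k \<in> K \<Longrightarrow> j \<noteq> k \<Longrightarrow> lt j k \<or> lt k j"
    and fin: "\<And>k. k \<in> K \<Longrightarrow> finite {j \<in> K. lt j k}"
  obtains rank :: "'k \<Rightarrow> nat" where
    "inj_on rank K"
    "\<And>k. k \<in> K \<Longrightarrow> rank k = card {j \<in> K. lt j k}"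
    "\<And>j k. j \<in> K \<Longrightarrow> k \<in> K \<Longrightarrow> rank j < rank k \<longleftrightarrow> lt j k"
    "\<And>k. k \<in> K \<Longrightarrow> {..<rank k} \<subseteq> rank ` K"
proof -
  define rank where "rank k = card {j \<in> K. lt j k}" for k
  have mono: "rank j < rank k" if "j \<in> K" "k \<in> K" "lt j k" for j k
    unfolding rank_def using that fin irrefl trans by (intro psubset_card_mono) blast+
  have iff: "rank j < rank k \<longleftrightarrow> lt j k" if "j \<in> K" "k \<in> K" for j k
    using mono that total by (metis less_asym less_irrefl)
  have inj: "inj_on rank K"
    using mono total by (metis inj_onI less_irrefl)
  have "{..<rank k} \<subseteq> rank ` K" if k: "k \<in> K" for k
  proof -
    \<comment> \<open>An injective image of the predecessors of k inside a set of the same finite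
      size fills it, so no rank is skipped.\<close>
    have "rank ` {j \<in> K. lt j k} = {..<rank k}"
    proof (rule card_subset_eq)
      show "rank ` {j \<in> K. lt j k} \<subseteq> {..<rank k}"
        using mono k by auto
      have "inj_on rank {j \<in> K. lt j k}"
        using inj by (rule inj_on_subset) auto
      then show "card (rank ` {j \<in> K. lt j k}) = card {..<rank k}"
        using card_image rank_def[of k] by simp
    qed auto
    then show ?thesis by blast
  qed
  then show thesis
    using that[of rank] inj iff by (simp add: rank_def)
qed

text \<open>A finite set of index tuples lies in a box, and over a box the sum of products factors
  into a product of partial sums.\<close>

lemma sum_prod_PiE_le:
  fixes g :: "'i \<Rightarrow> nat \<Rightarrow> real"
  assumes I: "finite I" and F: "finite F" "F \<subseteq> (\<Pi>\<^sub>E i\<in>I. UNIV)"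
    and nonneg: "\<And>i k. i \<in> I \<Longrightarrow> 0 \<le> g i k"
    and le: "\<And>i N. i \<in> I \<Longrightarrow> (\<Sum>k<N. g i k) \<le> G i"
  shows "(\<Sum>j\<in>F. \<Prod>i\<in>I. g i (j i)) \<le> (\<Prod>i\<in>I. G i)"
proof -
  \<comment> \<open>N exceeds every entry of every tuple in F; inserting 0 covers the case that
    there are no entries.\<close>
  define N where "N = Suc (Max (insert 0 (\<Union>j\<in>F. j ` I)))"
  have "j i < N" if "j \<in> F" "i \<in> I" for i j
    unfolding N_def using that I F(1) by (intro le_imp_less_Suc Max_ge) auto
  then have sub: "F \<subseteq> (\<Pi>\<^sub>E i\<in>I. {..<N})"
    using F(2) by (auto simp: PiE_iff subset_iff)
  have "(\<Sum>j\<in>F. \<Prod>i\<in>I. g i (j i)) \<le> (\<Sum>j\<in>(\<Pi>\<^sub>E i\<in>I. {..<N}). \<Prod>i\<in>I. g i (j i))"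
  proof (rule sum_mono2)
    show "finite (\<Pi>\<^sub>E i\<in>I. {..<N})"
      using I by (intro finite_PiE) auto
  qed (use sub nonneg in \<open>auto intro!: prod_nonneg\<close>)
  also have "\<dots> = (\<Prod>i\<in>I. \<Sum>k<N. g i k)"
    using I by (subst prod_sum_PiE) auto
  also have "\<dots> \<le> (\<Prod>i\<in>I. G i)"
    using le nonneg by (intro prod_mono conjI sum_nonneg) auto
  finally show ?thesis .
qed

text \<open>A positive limit of the decreasing sequence would make the weights alone summable, but
  their exponent \<open>s / r - 1\<close> is greater than -1.\<close>

lemma lorentz_summable_imp_tendsto_zero:
  fixes \<sigma> :: "nat \<Rightarrow> real"
  assumes s: "0 < s" and r: "0 < r" and dec: "decseq \<sigma>" and nonneg: "\<And>n. 0 \<le> \<sigma> n"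
    and summ: "summable (\<lambda>n. real (Suc n) powr (s / r - 1) * \<sigma> n powr s)"
  shows "\<sigma> \<longlonglongrightarrow> 0"
proof -
  obtain L where L: "\<sigma> \<longlonglongrightarrow> L" and le: "\<And>n. L \<le> \<sigma> n"
    using decseq_convergent[OF dec, of 0] nonneg by auto
  have "0 \<le> L"
    using LIMSEQ_le_const[OF L] nonneg by blast
  moreover have False if "0 < L"
  proof -
    have "summable (\<lambda>n. real (Suc n) powr (s / r - 1) * L powr s)"
    proof (rule summable_comparison_test'[OF summ])
      show "norm (real (Suc n) powr (s / r - 1) * L powr s)
          \<le> real (Suc n) powr (s / r - 1) * \<sigma> n powr s" for n
        using le that s by (auto simp: abs_mult intro!: mult_left_mono powr_mono2)
    qed
    then have "summable (\<lambda>n. real (Suc n) powr (s / r - 1) * L powr s * inverse (L powr s))"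
      by (rule summable_mult2)
    then have "summable (\<lambda>n. real (Suc n) powr (s / r - 1))"
      using that by (simp add: mult.assoc)
    then have "summable (\<lambda>n. real n powr (s / r - 1))"
      using summable_Suc_iff[of "\<lambda>n. real n powr (s / r - 1)"] by simp
    then have "s / r - 1 < -1"
      by (simp add: summable_real_powr_iff)
    then show False
      using s r by (simp add: divide_less_0_iff)
  qed
  ultimately have "L = 0" by fastforce
  then show ?thesis using L by simp
qed

text \<open>Ties are broken first by the sum of the indices, so that a box precedes its top corner.\<close>

lemma product_rearrangement:
  fixes \<sigma> :: "'i \<Rightarrow> nat \<Rightarrow> real"
  assumes I: "finite I"
    and dec: "\<And>i. i \<in> I \<Longrightarrow> decseq (\<sigma> i)" and nonneg: "\<And>i n. i \<in> I \<Longrightarrow> 0 \<le> \<sigma> i n"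
    and null: "\<And>i. i \<in> I \<Longrightarrow> \<sigma> i \<longlonglongrightarrow> 0"
  obtains c :: "nat \<Rightarrow> real" and \<pi> :: "nat \<Rightarrow> 'i \<Rightarrow> nat" where
    "decseq c" "\<And>n. 0 \<le> c n" "c \<longlonglongrightarrow> 0"
    "bij_betw \<pi> {n. 0 < c n} {j \<in> (\<Pi>\<^sub>E i\<in>I. UNIV). 0 < (\<Prod>i\<in>I. \<sigma> i (j i))}"
    "\<And>n. 0 < c n \<Longrightarrow> c n = (\<Prod>i\<in>I. \<sigma> i (\<pi> n i))"
    "\<And>n. 0 < c n \<Longrightarrow> (\<Prod>i\<in>I. Suc (\<pi> n i)) \<le> Suc n"
proof -
  define D :: "('i \<Rightarrow> nat) set" where "D = (\<Pi>\<^sub>E i\<in>I. UNIV)"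
  define d where "d j = (\<Prod>i\<in>I. \<sigma> i (j i))" for j
  define K where "K = {j \<in> D. 0 < d j}"
  \<comment> \<open>Larger coefficients come first. The coding \<open>to_nat_on\<close> settles what
    the index sum leaves tied and makes the order total.\<close>
  define lt where "lt j j' \<longleftrightarrow> d j > d j' \<or> d j = d j' \<and>
      (sum j I < sum j' I \<or> sum j I = sum j' I \<and> to_nat_on D j < to_nat_on D j')" for j j'
  have "countable D"
    unfolding D_def using I by (intro countable_PiE) auto
  then have inj_code: "inj_on (to_nat_on D) D"
    by (rule inj_on_to_nat_on)
  \<comment> \<open>If the product is at least e, each factor is at least e / B, since the remaining
    factors contribute at most B; the maximum with 1 lets B dominate every subproduct. A null
    sequence has only finitely many such entries.\<close>
  have fin: "finite {j \<in> D. e \<le> d j}" if e: "0 < e" for e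
  proof -
    define B where "B = (\<Prod>i\<in>I. max 1 (\<sigma> i 0))"
    have "1 \<le> B"
      unfolding B_def by (intro prod_ge_1) auto
    have "{j \<in> D. e \<le> d j} \<subseteq> (\<Pi>\<^sub>E i\<in>I. {k. e / B \<le> \<sigma> i k})"
    proof
      fix j assume j: "j \<in> {j \<in> D. e \<le> d j}"
      have "e \<le> \<sigma> i (j i) * B" if i: "i \<in> I" for i
      proof -
        have "e \<le> d j" using j by simp
        also have "d j = \<sigma> i (j i) * (\<Prod>i\<in>I - {i}. \<sigma> i (j i))"
          unfolding d_def using I i by (rule prod.remove)
        also have "\<dots> \<le> \<sigma> i (j i) * (\<Prod>i\<in>I - {i}. max 1 (\<sigma> i 0))"
          using i nonneg dec
          by (intro mult_left_mono prod_mono) (auto simp: decseq_def le_max_iff_disj)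
        also have "1 * (\<Prod>i\<in>I - {i}. max 1 (\<sigma> i 0)) \<le> B"
          unfolding B_def prod.remove[OF I i] by (intro mult_right_mono prod_nonneg) auto
        then have "\<sigma> i (j i) * (\<Prod>i\<in>I - {i}. max 1 (\<sigma> i 0)) \<le> \<sigma> i (j i) * B"
          using i nonneg by (intro mult_left_mono) auto
        finally show ?thesis .
      qed
      then show "j \<in> (\<Pi>\<^sub>E i\<in>I. {k. e / B \<le> \<sigma> i k})"
        using j \<open>1 \<le> B\<close> by (auto simp: D_def PiE_iff pos_divide_le_eq)
    qed
    moreover have "finite {k. e / B \<le> \<sigma> i k}" if "i \<in> I" for i
    proof -
      have "0 < e / B" using e \<open>1 \<le> B\<close> by simp
      then have "eventually (\<lambda>k. \<sigma> i k < e / B) sequentially"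
        using null[OF that] by (rule order_tendstoD(2)[rotated])
      then show ?thesis
        by (simp add: eventually_cofinite[symmetric] cofinite_eq_sequentially[symmetric] not_less[symmetric])
    qed
    ultimately show ?thesis
      using I finite_PiE finite_subset by meson
  qed
  obtain rank :: "('i \<Rightarrow> nat) \<Rightarrow> nat" where rank: "inj_on rank K"
    "\<And>k. k \<in> K \<Longrightarrow> rank k = card {j \<in> K. lt j k}"
    "\<And>j k. j \<in> K \<Longrightarrow> k \<in> K \<Longrightarrow> rank j < rank k \<longleftrightarrow> lt j k"
    "\<And>k. k \<in> K \<Longrightarrow> {..<rank k} \<subseteq> rank ` K"
  proof (rule rank_enumeration[of lt K])
    show "\<not> lt k k" for k by (simp add: lt_def)
    show "lt i k" if "lt i j" "lt j k" for i j k
      using that unfolding lt_def by linarith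
    show "lt j k \<or> lt k j" if "j \<in> K" "k \<in> K" "j \<noteq> k" for j k
    proof -
      have "to_nat_on D j \<noteq> to_nat_on D k"
        using inj_code that by (auto simp: K_def dest: inj_onD)
      then show ?thesis unfolding lt_def by linarith
    qed
    show "finite {j \<in> K. lt j k}" if "k \<in> K" for k
      using that by (intro finite_subset[OF _ fin[of "d k"]]) (auto simp: K_def lt_def)
  qed (rule that; assumption)
  define \<pi> where "\<pi> = inv_into K rank"
  \<comment> \<open>When K is finite the ranks stop, and c is continued by zeros. Positivity of c
    then marks exactly the range of \<open>rank\<close>.\<close>
  define c where "c n = (if n \<in> rank ` K then d (\<pi> n) else 0)" for n
  have \<pi>: "\<pi> n \<in> K" "rank (\<pi> n) = n" if "n \<in> rank ` K" for n
    using that by (auto simp: \<pi>_def inv_into_into f_inv_into_f)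
  have pos: "0 < c n \<longleftrightarrow> n \<in> rank ` K" for n
    using \<pi> by (auto simp: c_def K_def)
  have nonneg_c: "0 \<le> c n" for n
    using pos[of n] by (cases "n \<in> rank ` K") (auto simp: c_def)
  \<comment> \<open>The range of \<open>rank\<close> is an initial segment, so a position
    \<open>Suc n\<close> in it has its predecessor in it too, and the order of ranks excludes an
    increase.\<close>
  have "c (Suc n) \<le> c n" for n
  proof (cases "Suc n \<in> rank ` K")
    case True
    then have "n \<in> rank ` K"
      using rank(4)[OF \<pi>(1)[OF True]] \<pi>(2)[OF True] by auto
    then have "\<not> lt (\<pi> (Suc n)) (\<pi> n)"
      using rank(3)[OF \<pi>(1)[OF True] \<pi>(1), of n] \<pi>(2) True by auto
    then show ?thesis
      using True \<open>n \<in> rank ` K\<close> by (auto simp: c_def lt_def not_less)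
  qed (use nonneg_c in \<open>auto simp: c_def\<close>)
  then have "decseq c" by (simp add: decseq_Suc_iff)
  have "c \<longlonglongrightarrow> 0"
  proof (rule order_tendstoI)
    fix e :: real assume "0 < e"
    have "{n. \<not> c n < e} \<subseteq> rank ` {j \<in> D. e \<le> d j}"
    proof
      fix n assume n: "n \<in> {n. \<not> c n < e}"
      then have "n \<in> rank ` K" using pos[of n] \<open>0 < e\<close> by auto
      then show "n \<in> rank ` {j \<in> D. e \<le> d j}"
        using \<pi>[of n] n by (intro image_eqI[of _ _ "\<pi> n"]) (auto simp: c_def K_def)
    qed
    then have "finite {n. \<not> c n < e}"
      using finite_imageI[OF fin[OF \<open>0 < e\<close>]] by (rule finite_subset)
    then show "eventually (\<lambda>n. c n < e) sequentially"
      using eventually_cofinite[of "\<lambda>n. c n < e"] by (simp add: cofinite_eq_sequentially)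
  qed (use nonneg_c less_le_trans in \<open>auto intro!: always_eventually\<close>)
  moreover have "bij_betw \<pi> {n. 0 < c n} K"
    unfolding \<pi>_def pos
    using bij_betw_inv_into[OF inj_on_imp_bij_betw[OF rank(1)]] by (simp add: image_def)
  moreover have "(\<Prod>i\<in>I. Suc (\<pi> n i)) \<le> Suc n" if "0 < c n" for n
  proof -
    let ?j = "\<pi> n"
    have j: "?j \<in> K" "rank ?j = n" using that pos \<pi> by auto
    \<comment> \<open>A tuple in the box has a coefficient at least as large and, unless it is the
      corner, a smaller index sum; so it precedes the corner even when the coefficients tie.\<close>
    have sub: "(\<Pi>\<^sub>E i\<in>I. {..?j i}) \<subseteq> insert ?j {j \<in> K. lt j ?j}"
    proof
      fix k assume k: "k \<in> (\<Pi>\<^sub>E i\<in>I. {..?j i})"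
      then have kD: "k \<in> D" by (auto simp: D_def PiE_iff)
      have le: "k i \<le> ?j i" if "i \<in> I" for i using k that by (auto simp: PiE_iff)
      have "d ?j \<le> d k"
        unfolding d_def using le dec nonneg by (intro prod_mono) (auto simp: decseq_def)
      moreover have "0 < d ?j" using j by (auto simp: K_def)
      ultimately have kK: "k \<in> K" using kD by (auto simp: K_def)
      have "sum k I < sum ?j I" if ne: "k \<noteq> ?j"
      proof -
        have "k = ?j" if "\<And>i. i \<in> I \<Longrightarrow> k i = ?j i"
          using kD j that unfolding K_def D_def by (intro PiE_ext[of k I "\<lambda>_. UNIV" ?j]) auto
        then obtain i where "i \<in> I" "k i \<noteq> ?j i"
          using ne by blast
        then show ?thesis
          using I le by (intro sum_strict_mono_ex1) (auto simp: order_less_le)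
      qed
      then show "k \<in> insert ?j {j \<in> K. lt j ?j}"
        using kK \<open>d ?j \<le> d k\<close> by (auto simp: lt_def)
    qed
    have fin': "finite {j \<in> K. lt j ?j}"
      using j by (intro finite_subset[OF _ fin[of "d ?j"]]) (auto simp: K_def lt_def)
    have "(\<Prod>i\<in>I. Suc (?j i)) = card (\<Pi>\<^sub>E i\<in>I. {..?j i})"
      using I by (simp add: card_PiE)
    also have "\<dots> \<le> card (insert ?j {j \<in> K. lt j ?j})"
      using fin' sub by (intro card_mono) auto
    \<comment> \<open>\<open>rank\<close> counts strict predecessors and starts at 0; the corner
      itself accounts for the successor.\<close>
    also have "\<dots> = Suc n"
      using fin' rank(2)[OF j(1)] j(2) by (simp add: lt_def)
    finally show ?thesis .
  qed
  ultimately show thesis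
    using that[of c \<pi>] \<open>decseq c\<close> nonneg_c pos by (simp add: K_def D_def d_def c_def)
qed

text \<open>The rank bound splits the weight into one factor per coordinate, in the right direction
  because the exponent is nonpositive. Injectivity of \<open>\<pi>\<close> makes each partial sum a
  sum over distinct tuples, so it stays below the product of the single sums.\<close>

lemma summable_product_rearrangement:
  fixes \<sigma> :: "'i \<Rightarrow> nat \<Rightarrow> real"
  assumes I: "finite I" and s: "0 < s" and \<alpha>: "\<alpha> \<le> 0"
    and nonneg: "\<And>i n. i \<in> I \<Longrightarrow> 0 \<le> \<sigma> i n"
    and summ: "\<And>i. i \<in> I \<Longrightarrow> summable (\<lambda>n. real (Suc n) powr \<alpha> * \<sigma> i n powr s)"
    and c: "\<And>n. 0 \<le> c n"
    and inj: "inj_on \<pi> {n. 0 < c n}" and \<pi>: "\<And>n. 0 < c n \<Longrightarrow> \<pi> n \<in> (\<Pi>\<^sub>E i\<in>I. UNIV)"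
    and c_eq: "\<And>n. 0 < c n \<Longrightarrow> c n = (\<Prod>i\<in>I. \<sigma> i (\<pi> n i))"
    and le: "\<And>n. 0 < c n \<Longrightarrow> (\<Prod>i\<in>I. Suc (\<pi> n i)) \<le> Suc n"
  shows "summable (\<lambda>n. real (Suc n) powr \<alpha> * c n powr s)"
proof (rule summableI_nonneg_bounded)
  let ?g = "\<lambda>i k. real (Suc k) powr \<alpha> * \<sigma> i k powr s"
  fix N
  let ?P = "{n. n < N \<and> 0 < c n}"
  \<comment> \<open>Where c vanishes, \<open>\<pi> n\<close> carries no information; these terms
    drop out because \<open>0 powr s\<close> is 0.\<close>
  have "(\<Sum>n<N. real (Suc n) powr \<alpha> * c n powr s) = (\<Sum>n\<in>?P. real (Suc n) powr \<alpha> * c n powr s)"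
    using c s by (intro sum.mono_neutral_right) (auto simp: order_less_le)
  also have "\<dots> \<le> (\<Sum>n\<in>?P. \<Prod>i\<in>I. ?g i (\<pi> n i))"
  proof (rule sum_mono)
    fix n assume n: "n \<in> ?P"
    have "real (\<Prod>i\<in>I. Suc (\<pi> n i)) \<le> real (Suc n)"
      using le n of_nat_le_iff by blast
    moreover have "0 < real (\<Prod>i\<in>I. Suc (\<pi> n i))"
      by (simp add: prod_pos)
    ultimately have "real (Suc n) powr \<alpha> \<le> real (\<Prod>i\<in>I. Suc (\<pi> n i)) powr \<alpha>"
      using \<alpha> by (intro powr_mono2') auto
    moreover have "(\<Prod>i\<in>I. \<sigma> i (\<pi> n i)) powr s = (\<Prod>i\<in>I. \<sigma> i (\<pi> n i) powr s)"
      by (rule prod_powr_distrib)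
    then have "c n powr s = (\<Prod>i\<in>I. \<sigma> i (\<pi> n i) powr s)"
      using c_eq[of n] n by simp
    then have "real (\<Prod>i\<in>I. Suc (\<pi> n i)) powr \<alpha> * c n powr s = (\<Prod>i\<in>I. ?g i (\<pi> n i))"
      by (simp add: prod_powr_distrib prod.distrib)
    ultimately show "real (Suc n) powr \<alpha> * c n powr s \<le> (\<Prod>i\<in>I. ?g i (\<pi> n i))"
      by (metis mult_right_mono powr_ge_zero)
  qed
  also have "\<dots> = (\<Sum>j\<in>\<pi> ` ?P. \<Prod>i\<in>I. ?g i (j i))"
    using inj by (subst sum.reindex) (auto intro: inj_on_subset)
  also have "\<dots> \<le> (\<Prod>i\<in>I. \<Sum>k. ?g i k)"
    using I \<pi> summ by (intro sum_prod_PiE_le sum_le_suminf) auto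
  finally show "(\<Sum>n<N. real (Suc n) powr \<alpha> * c n powr s) \<le> (\<Prod>i\<in>I. \<Sum>k. ?g i k)" .
qed simp

text \<open>The products are absolutely summable over all tuples, since finite partial sums are
  dominated by the product of the absolute sums. Hence the multiple series may be evaluated
  coordinatewise and also summed along \<open>\<pi>\<close>, the tuples outside K contributing
  zero.\<close>

lemma sums_product_rearrangement:
  fixes g :: "'i \<Rightarrow> nat \<Rightarrow> complex"
  assumes I: "finite I" and summ: "\<And>i. i \<in> I \<Longrightarrow> summable (\<lambda>k. cmod (g i k))"
    and bij: "bij_betw \<pi> A K" and K: "K \<subseteq> (\<Pi>\<^sub>E i\<in>I. UNIV)"
    and zero: "\<And>j. j \<in> (\<Pi>\<^sub>E i\<in>I. UNIV) - K \<Longrightarrow> (\<Prod>i\<in>I. g i (j i)) = 0"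
  shows "(\<lambda>n. if n \<in> A then \<Prod>i\<in>I. g i (\<pi> n i) else 0) sums (\<Prod>i\<in>I. \<Sum>k. g i k)"
proof -
  let ?D = "\<Pi>\<^sub>E i\<in>I. UNIV"
  let ?f = "\<lambda>j. \<Prod>i\<in>I. g i (j i)"
  have abs: "(\<lambda>k. norm (g i k)) summable_on UNIV" if "i \<in> I" for i
    using summ[OF that] by (simp add: summable_on_UNIV_nonneg_real_iff)
  have "(\<lambda>j. norm (?f j)) summable_on ?D"
  proof (rule nonneg_bdd_above_summable_on)
    have "sum (\<lambda>j. norm (?f j)) F \<le> (\<Prod>i\<in>I. \<Sum>k. cmod (g i k))" if "F \<subseteq> ?D" "finite F" for F
      using sum_prod_PiE_le[OF I that(2,1), of "\<lambda>i k. cmod (g i k)" "\<lambda>i. \<Sum>k. cmod (g i k)"]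
        sum_le_suminf[OF summ] by (simp add: prod_norm)
    then show "bdd_above (sum (\<lambda>j. norm (?f j)) ` {F. F \<subseteq> ?D \<and> finite F})"
      by (intro bdd_aboveI2) auto
  qed simp
  then have "?f summable_on ?D"
    by (rule abs_summable_summable)
  then have "(?f has_sum infsum ?f ?D) ?D"
    by simp
  also have "infsum ?f ?D = (\<Prod>i\<in>I. infsum (g i) UNIV)"
    using I abs by (intro infsum_prod_PiE_abs) auto
  also have "\<dots> = (\<Prod>i\<in>I. \<Sum>k. g i k)"
  proof (rule prod.cong)
    fix i assume "i \<in> I"
    then have "(g i has_sum infsum (g i) UNIV) UNIV"
      using abs abs_summable_summable by (intro has_sum_infsum) blast
    then show "infsum (g i) UNIV = (\<Sum>k. g i k)"
      using has_sum_imp_sums sums_unique by blast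
  qed simp
  finally have "(?f has_sum (\<Prod>i\<in>I. \<Sum>k. g i k)) K"
    using K zero by (subst has_sum_cong_neutral[where T = ?D and g = ?f]) auto
  then have "((\<lambda>n. ?f (\<pi> n)) has_sum (\<Prod>i\<in>I. \<Sum>k. g i k)) A"
    using has_sum_reindex_bij_betw[OF bij, of ?f] by simp
  then have "((\<lambda>n. if n \<in> A then ?f (\<pi> n) else 0) has_sum (\<Prod>i\<in>I. \<Sum>k. g i k)) UNIV"
    by (subst has_sum_cong_neutral[where T = A and g = "\<lambda>n. ?f (\<pi> n)"]) auto
  then show ?thesis
    by (rule has_sum_imp_sums)
qed

section \<open>Normed spaces and completions\<close>

lemma tendsto_zero_majorant:
  fixes f g :: "nat \<Rightarrow> real"
  assumes "g \<longlonglongrightarrow> 0" "\<And>n. 0 \<le> f n" "\<And>n. f n \<le> g n"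
  shows "f \<longlonglongrightarrow> 0"
  by (rule tendsto_sandwich[OF _ _ tendsto_const assms(1)]) (use assms(2,3) in auto)

lemma complex_line_simps [simp]:
  "carrier complex_line = UNIV" "mult complex_line = (*)" "one complex_line = 1"
  "zero complex_line = 0" "add complex_line = (+)" "smult complex_line = (*)"
  "nrm complex_line = cmod"
  by (simp_all add: complex_line_def)

lemma cring_complex_line: "cring complex_line"
proof (rule cringI)
  have "\<exists>y. y + x = 0" for x :: complex
    using add.left_inverse by blast
  then show "abelian_group complex_line"
    by (intro abelian_groupI) (auto simp: algebra_simps)
  show "comm_monoid complex_line"
    by (intro comm_monoidI) (auto simp: algebra_simps)
qed (auto simp: algebra_simps)

section \<open>Vector arithmetic and the metric of a normed space\<close>

context complex_normed_space
begin

lemma smult_add_left: "x \<in> carrier X \<Longrightarrow> (a + b) \<odot> x = a \<odot> x \<oplus> b \<odot> x"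
  using smult_l_distr[of a b x] by simp

lemma smult_assoc: "x \<in> carrier X \<Longrightarrow> (a * b) \<odot> x = a \<odot> (b \<odot> x)"
  using smult_assoc1[of a b x] by simp

lemma smult_one_left [simp]: "x \<in> carrier X \<Longrightarrow> 1 \<odot> x = x"
  using smult_one[of x] by simp

lemma smult_in_carrier [simp, intro]: "x \<in> carrier X \<Longrightarrow> c \<odot> x \<in> carrier X"
  using smult_closed[of c x] by simp

lemma smult_zero_left [simp]: "x \<in> carrier X \<Longrightarrow> 0 \<odot> x = \<zero>"
  using smult_l_null[of x] by simp

lemma smult_zero_right [simp]: "c \<odot> \<zero> = \<zero>"
  using smult_r_null[of c] by simp

lemma smult_add_right:
  "x \<in> carrier X \<Longrightarrow> y \<in> carrier X \<Longrightarrow> c \<odot> (x \<oplus> y) = c \<odot> x \<oplus> c \<odot> y"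
  using smult_r_distr[of c x y] by simp

lemma uminus_eq_smult: "x \<in> carrier X \<Longrightarrow> \<ominus> x = (-1) \<odot> x"
proof (rule M.minus_equality)
  assume x: "x \<in> carrier X"
  then show "(-1) \<odot> x \<oplus> x = \<zero>"
    using smult_add_left[of x "-1" 1] by simp
qed auto

lemma nrm_zero [simp]: "nrm X \<zero> = 0"
  by (simp add: nrm_eq_0_iff)

lemma nrm_uminus [simp]: "x \<in> carrier X \<Longrightarrow> nrm X (\<ominus> x) = nrm X x"
  by (simp add: uminus_eq_smult nrm_smult)

lemma uminus_minus: "x \<in> carrier X \<Longrightarrow> y \<in> carrier X \<Longrightarrow> \<ominus> (x \<ominus> y) = y \<ominus> x"
  by (simp add: M.minus_eq M.minus_add M.a_comm)

lemma nrm_minus_commute: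
  "x \<in> carrier X \<Longrightarrow> y \<in> carrier X \<Longrightarrow> nrm X (x \<ominus> y) = nrm X (y \<ominus> x)"
  using nrm_uminus[of "x \<ominus> y"] by (simp add: uminus_minus)

lemma minus_add_minus:
  assumes "x \<in> carrier X" "y \<in> carrier X" "z \<in> carrier X"
  shows "(x \<ominus> y) \<oplus> (y \<ominus> z) = x \<ominus> z"
  using assms by (simp add: M.minus_eq M.a_assoc M.r_neg1)

lemma add_minus_add:
  assumes "a \<in> carrier X" "b \<in> carrier X" "c \<in> carrier X" "d \<in> carrier X"
  shows "(a \<oplus> b) \<ominus> (c \<oplus> d) = (a \<ominus> c) \<oplus> (b \<ominus> d)"
  using assms by (simp add: M.minus_eq M.minus_add M.a_ac)

lemma smult_minus_right:
  assumes "x \<in> carrier X" "y \<in> carrier X"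
  shows "c \<odot> (x \<ominus> y) = c \<odot> x \<ominus> c \<odot> y"
  using assms smult_assoc[of y c "-1"] smult_assoc[of y "-1" c]
  by (simp add: M.minus_eq smult_add_right uminus_eq_smult)

lemma minus_add_cancel: "x \<in> carrier X \<Longrightarrow> y \<in> carrier X \<Longrightarrow> (x \<ominus> y) \<oplus> y = x"
  by (simp add: M.minus_eq M.a_assoc M.l_neg)

lemma minus_eq_zero_iff: "x \<in> carrier X \<Longrightarrow> y \<in> carrier X \<Longrightarrow> x \<ominus> y = \<zero> \<longleftrightarrow> x = y"
  by (metis M.l_zero M.minus_eq M.r_neg minus_add_cancel)

lemma minus_self [simp]: "x \<in> carrier X \<Longrightarrow> x \<ominus> x = \<zero>"
  by (simp add: minus_eq_zero_iff)

lemma minus_zero [simp]: "x \<in> carrier X \<Longrightarrow> x \<ominus> \<zero> = x"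
  using minus_add_cancel[of x \<zero>] by simp

lemma nrm_triangle_minus:
  assumes "x \<in> carrier X" "y \<in> carrier X" "z \<in> carrier X"
  shows "nrm X (x \<ominus> z) \<le> nrm X (x \<ominus> y) + nrm X (y \<ominus> z)"
  using nrm_triangle[of "x \<ominus> y" "y \<ominus> z"] assms by (simp add: minus_add_minus)

lemma nrm_diff_le:
  assumes "x \<in> carrier X" "y \<in> carrier X"
  shows "\<bar>nrm X x - nrm X y\<bar> \<le> nrm X (x \<ominus> y)"
  using nrm_triangle[of "x \<ominus> y" y] nrm_triangle[of "y \<ominus> x" x] assms
  by (simp add: minus_add_cancel nrm_minus_commute[of y x] abs_le_iff)

lemma metric_space: "Metric_space (carrier X) (ndist X)"
proof
  show "0 \<le> ndist X x y" for x y
    by (simp add: ndist_def nrm_nonneg)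
  show "ndist X x y = ndist X y x" for x y
    by (simp add: ndist_def nrm_minus_commute)
  show "ndist X x y = 0 \<longleftrightarrow> x = y" if "x \<in> carrier X" "y \<in> carrier X" for x y
    using that by (simp add: ndist_def nrm_eq_0_iff minus_eq_zero_iff)
  show "ndist X x z \<le> ndist X x y + ndist X y z"
    if "x \<in> carrier X" "y \<in> carrier X" "z \<in> carrier X" for x y z
    using that by (simp add: ndist_def nrm_triangle_minus)
qed

lemma ncauchy_iff:
  "ncauchy X p \<longleftrightarrow> (\<forall>n. p n \<in> carrier X) \<and>
     (\<forall>e>0. \<exists>N. \<forall>n\<ge>N. \<forall>n'\<ge>N. nrm X (p n \<ominus> p n') < e)"
  unfolding Metric_space.MCauchy_def[OF metric_space] ndist_def by (auto simp: image_subset_iff)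

lemma limitin_ntopology:
  "limitin (ntopology X) p x sequentially \<longleftrightarrow>
     x \<in> carrier X \<and> (\<forall>e>0. \<exists>N. \<forall>n\<ge>N. p n \<in> carrier X \<and> nrm X (p n \<ominus> x) < e)"
proof -
  have "(\<forall>n\<ge>N. p n \<in> carrier X \<and> ndist X (p n) x < e) \<longleftrightarrow>
      (\<forall>n\<ge>N. p n \<in> carrier X \<and> nrm X (p n \<ominus> x) < e)" if "x \<in> carrier X" for N e
    using that by (auto simp: ndist_def)
  then show ?thesis
    unfolding Metric_space.limit_metric_sequentially[OF metric_space] by auto
qed

lemma complete_iff:
  "Metric_space.mcomplete (carrier X) (ndist X) \<longleftrightarrow>
     (\<forall>p. ncauchy X p \<longrightarrow> (\<exists>x\<in>carrier X. (\<lambda>n. nrm X (p n \<ominus> x)) \<longlonglongrightarrow> 0))"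
proof -
  have "limitin (ntopology X) p x sequentially \<longleftrightarrow>
      x \<in> carrier X \<and> (\<lambda>n. nrm X (p n \<ominus> x)) \<longlonglongrightarrow> 0" if "ncauchy X p" for p x
    using that
    by (auto simp: limitin_ntopology ncauchy_iff LIMSEQ_def nrm_nonneg)
  then show ?thesis
    unfolding Metric_space.mcomplete_def[OF metric_space] by blast
qed

end

section \<open>Linear and bounded maps\<close>

lemma clinear_mapD:
  assumes "clinear_map X Y T"
  shows "x \<in> carrier X \<Longrightarrow> T x \<in> carrier Y"
    and "x \<in> carrier X \<Longrightarrow> y \<in> carrier X \<Longrightarrow> T (x \<oplus>\<^bsub>X\<^esub> y) = T x \<oplus>\<^bsub>Y\<^esub> T y"
    and "x \<in> carrier X \<Longrightarrow> T (c \<odot>\<^bsub>X\<^esub> x) = c \<odot>\<^bsub>Y\<^esub> T x"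
  using assms by (auto simp: clinear_map_def)

lemma clinear_mapI:
  assumes "\<And>x. x \<in> carrier X \<Longrightarrow> T x \<in> carrier Y"
    and "\<And>x y. x \<in> carrier X \<Longrightarrow> y \<in> carrier X \<Longrightarrow> T (x \<oplus>\<^bsub>X\<^esub> y) = T x \<oplus>\<^bsub>Y\<^esub> T y"
    and "\<And>c x. x \<in> carrier X \<Longrightarrow> T (c \<odot>\<^bsub>X\<^esub> x) = c \<odot>\<^bsub>Y\<^esub> T x"
  shows "clinear_map X Y T"
  using assms by (auto simp: clinear_map_def)

lemma clinear_map_compose:
  "clinear_map X Y T \<Longrightarrow> clinear_map Y Z S \<Longrightarrow> clinear_map X Z (\<lambda>x. S (T x))"
  by (auto simp: clinear_map_def Pi_iff)

lemma clinear_map_minus: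
  assumes X: "complex_normed_space X" and Y: "complex_normed_space Y" and T: "clinear_map X Y T"
    and x: "x \<in> carrier X" and y: "y \<in> carrier X"
  shows "T (x \<ominus>\<^bsub>X\<^esub> y) = T x \<ominus>\<^bsub>Y\<^esub> T y"
proof -
  interpret X: complex_normed_space X by fact
  interpret Y: complex_normed_space Y by fact
  show ?thesis
    using T x y by (simp add: X.M.minus_eq Y.M.minus_eq clinear_mapD X.uminus_eq_smult Y.uminus_eq_smult)
qed

lemma clinear_map_zero:
  assumes X: "complex_normed_space X" and Y: "complex_normed_space Y" and T: "clinear_map X Y T"
  shows "T \<zero>\<^bsub>X\<^esub> = \<zero>\<^bsub>Y\<^esub>"
proof -
  interpret X: complex_normed_space X by fact
  interpret Y: complex_normed_space Y by fact
  show ?thesis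
    using clinear_mapD(3)[OF T X.M.zero_closed, of 0] clinear_mapD(1)[OF T X.M.zero_closed] by simp
qed

lemma bounded_opE:
  assumes "complex_normed_space X" "bounded_op X Y T"
  obtains K where "0 \<le> K" "clinear_map X Y T" "\<And>x. x \<in> carrier X \<Longrightarrow> nrm Y (T x) \<le> K * nrm X x"
proof -
  interpret complex_normed_space X by fact
  obtain K where K: "\<forall>x\<in>carrier X. nrm Y (T x) \<le> K * nrm X x" and T: "clinear_map X Y T"
    using assms by (auto simp: bounded_op_def)
  \<comment> \<open>The constant in \<open>bounded_op\<close> may be negative when the space is
    trivial; its absolute value serves as well and can be multiplied through inequalities.\<close>
  have "nrm Y (T x) \<le> \<bar>K\<bar> * nrm X x" if "x \<in> carrier X" for x
    using K that by (meson abs_ge_self mult_right_mono nrm_nonneg order_trans)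
  then show thesis
    using that[of "\<bar>K\<bar>"] T by simp
qed

section \<open>Completion by classes of Cauchy sequences\<close>

locale plain_normed_space = complex_normed_space X for X :: "'a normed" (structure)
begin

abbreviation cls :: "(nat \<Rightarrow> 'a) \<Rightarrow> (nat \<Rightarrow> 'a) set" where
  "cls p \<equiv> cauchy_rel X `` {p}"

lemma ncauchy_carrier: "ncauchy X p \<Longrightarrow> p n \<in> carrier X"
  by (simp add: ncauchy_iff)

lemma cauchy_rel_iff:
  "(p, q) \<in> cauchy_rel X \<longleftrightarrow>
     ncauchy X p \<and> ncauchy X q \<and> (\<lambda>n. nrm X (p n \<ominus> q n)) \<longlonglongrightarrow> 0"
  by (auto simp: cauchy_rel_def ndist_def ncauchy_carrier)

lemma equiv_cauchy_rel: "equiv {p. ncauchy X p} (cauchy_rel X)"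
proof (rule equivI)
  show "cauchy_rel X \<subseteq> {p. ncauchy X p} \<times> {p. ncauchy X p}"
    by (auto simp: cauchy_rel_iff)
  show "refl_on {p. ncauchy X p} (cauchy_rel X)"
    by (auto simp: refl_on_def cauchy_rel_iff ncauchy_carrier)
  show "sym (cauchy_rel X)"
    by (auto simp: sym_def cauchy_rel_iff ncauchy_carrier nrm_minus_commute)
  show "trans (cauchy_rel X)"
  proof (rule transI)
    fix p q r assume pq: "(p, q) \<in> cauchy_rel X" and qr: "(q, r) \<in> cauchy_rel X"
    have "(\<lambda>n. nrm X (p n \<ominus> q n) + nrm X (q n \<ominus> r n)) \<longlonglongrightarrow> 0"
      using pq qr by (intro tendsto_add_zero) (auto simp: cauchy_rel_iff)
    moreover have "nrm X (p n \<ominus> r n) \<le> nrm X (p n \<ominus> q n) + nrm X (q n \<ominus> r n)" for n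
      using pq qr by (intro nrm_triangle_minus) (auto simp: cauchy_rel_iff ncauchy_carrier)
    moreover have "0 \<le> nrm X (p n \<ominus> r n)" for n
      using pq qr by (simp add: cauchy_rel_iff ncauchy_carrier nrm_nonneg)
    moreover note tendsto_zero_majorant[of "\<lambda>n. nrm X (p n \<ominus> q n) + nrm X (q n \<ominus> r n)"
        "\<lambda>n. nrm X (p n \<ominus> r n)"]
    ultimately have "(\<lambda>n. nrm X (p n \<ominus> r n)) \<longlonglongrightarrow> 0"
      by simp
    then show "(p, r) \<in> cauchy_rel X"
      using pq qr by (simp add: cauchy_rel_iff)
  qed
qed

lemma cls_eq_iff:
  assumes "ncauchy X p" "ncauchy X q"
  shows "cls p = cls q \<longleftrightarrow> (\<lambda>n. nrm X (p n \<ominus> q n)) \<longlonglongrightarrow> 0"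
  using eq_equiv_class_iff[OF equiv_cauchy_rel] assms by (simp add: cauchy_rel_iff)

lemma ncauchy_const [simp]: "x \<in> carrier X \<Longrightarrow> ncauchy X (\<lambda>_. x)"
  by (simp add: ncauchy_iff)

lemma ncauchy_add:
  assumes "ncauchy X p" "ncauchy X q"
  shows "ncauchy X (\<lambda>n. p n \<oplus> q n)"
  unfolding ncauchy_iff
proof (intro conjI allI impI)
  note [simp] = assms[THEN ncauchy_carrier]
  show "p n \<oplus> q n \<in> carrier X" for n by simp
  fix e :: real assume "0 < e"
  then obtain N M where N: "\<And>n n'. n \<ge> N \<Longrightarrow> n' \<ge> N \<Longrightarrow> nrm X (p n \<ominus> p n') < e/2"
    and M: "\<And>n n'. n \<ge> M \<Longrightarrow> n' \<ge> M \<Longrightarrow> nrm X (q n \<ominus> q n') < e/2"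
    using assms unfolding ncauchy_iff by (meson half_gt_zero)
  have "nrm X (p n \<oplus> q n \<ominus> (p n' \<oplus> q n')) < e" if "n \<ge> max M N" "n' \<ge> max M N" for n n'
    using N[of n n'] M[of n n'] that nrm_triangle[of "p n \<ominus> p n'" "q n \<ominus> q n'"]
    by (simp add: add_minus_add)
  then show "\<exists>N. \<forall>n\<ge>N. \<forall>n'\<ge>N. nrm X (p n \<oplus> q n \<ominus> (p n' \<oplus> q n')) < e"
    by blast
qed

lemma ncauchy_smult:
  assumes "ncauchy X p"
  shows "ncauchy X (\<lambda>n. c \<odot> p n)"
  unfolding ncauchy_iff
proof (intro conjI allI impI)
  note [simp] = assms[THEN ncauchy_carrier]
  show "c \<odot> p n \<in> carrier X" for n by simp
  fix e :: real assume "0 < e"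
  then have "0 < e / (cmod c + 1)"
    by (intro divide_pos_pos) (auto simp: add_nonneg_pos)
  then obtain N where N: "\<And>n n'. n \<ge> N \<Longrightarrow> n' \<ge> N \<Longrightarrow> nrm X (p n \<ominus> p n') < e / (cmod c + 1)"
    using assms unfolding ncauchy_iff by meson
  have "nrm X (c \<odot> p n \<ominus> c \<odot> p n') < e" if "n \<ge> N" "n' \<ge> N" for n n'
  proof -
    have "nrm X (c \<odot> p n \<ominus> c \<odot> p n') = cmod c * nrm X (p n \<ominus> p n')"
      by (simp flip: smult_minus_right add: nrm_smult)
    also have "\<dots> \<le> (cmod c + 1) * nrm X (p n \<ominus> p n')"
      by (intro mult_right_mono) (auto simp: nrm_nonneg)
    also have "\<dots> < e"
      using N[OF that] by (simp add: pos_less_divide_eq add_nonneg_pos mult.commute)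
    finally show ?thesis .
  qed
  then show "\<exists>N. \<forall>n\<ge>N. \<forall>n'\<ge>N. nrm X (c \<odot> p n \<ominus> c \<odot> p n') < e"
    by blast
qed

lemma carrier_completion: "carrier (completion X) = cls ` {p. ncauchy X p}"
  by (auto simp: completion_def quotient_def)

text \<open>The operation on classes is a union over all representatives. Congruence modulo
  \<open>cauchy_rel\<close> collapses this union to a single class.\<close>

lemma add_completion:
  assumes "ncauchy X p" "ncauchy X q"
  shows "cls p \<oplus>\<^bsub>completion X\<^esub> cls q = cls (\<lambda>n. p n \<oplus> q n)"
proof -
  have "congruent2 (cauchy_rel X) (cauchy_rel X) (\<lambda>p q. cls (\<lambda>n. p n \<oplus> q n))"
  proof (rule congruent2I')
    fix p p' q q' assume *: "(p, p') \<in> cauchy_rel X" "(q, q') \<in> cauchy_rel X"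
    then have C: "ncauchy X p" "ncauchy X p'" "ncauchy X q" "ncauchy X q'"
      and L: "(\<lambda>n. nrm X (p n \<ominus> p' n)) \<longlonglongrightarrow> 0" "(\<lambda>n. nrm X (q n \<ominus> q' n)) \<longlonglongrightarrow> 0"
      by (auto simp: cauchy_rel_iff)
    note [simp] = C[THEN ncauchy_carrier]
    have "(\<lambda>n. nrm X (p n \<oplus> q n \<ominus> (p' n \<oplus> q' n))) \<longlonglongrightarrow> 0"
    proof (rule tendsto_zero_majorant)
      show "(\<lambda>n. nrm X (p n \<ominus> p' n) + nrm X (q n \<ominus> q' n)) \<longlonglongrightarrow> 0"
        using tendsto_add[OF L] by simp
    qed (auto simp: add_minus_add nrm_nonneg intro!: nrm_triangle)
    then show "cls (\<lambda>n. p n \<oplus> q n) = cls (\<lambda>n. p' n \<oplus> q' n)"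
      using C by (simp add: cls_eq_iff ncauchy_add)
  qed
  then show ?thesis
    using UN_equiv_class2[OF equiv_cauchy_rel equiv_cauchy_rel] assms by (simp add: completion_def)
qed

lemma smult_completion:
  assumes "ncauchy X p"
  shows "c \<odot>\<^bsub>completion X\<^esub> cls p = cls (\<lambda>n. c \<odot> p n)"
proof -
  have "congruent (cauchy_rel X) (\<lambda>p. cls (\<lambda>n. c \<odot> p n))"
  proof (rule congruentI)
    fix p p' assume *: "(p, p') \<in> cauchy_rel X"
    then have C: "ncauchy X p" "ncauchy X p'" and L: "(\<lambda>n. nrm X (p n \<ominus> p' n)) \<longlonglongrightarrow> 0"
      by (auto simp: cauchy_rel_iff)
    note [simp] = C[THEN ncauchy_carrier]
    have "(\<lambda>n. nrm X (c \<odot> p n \<ominus> c \<odot> p' n)) \<longlonglongrightarrow> 0"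
      using tendsto_mult_right_zero[OF L, of "cmod c"]
      by (simp flip: smult_minus_right add: nrm_smult)
    then show "cls (\<lambda>n. c \<odot> p n) = cls (\<lambda>n. c \<odot> p' n)"
      using C by (simp add: cls_eq_iff ncauchy_smult)
  qed
  then show ?thesis
    using UN_equiv_class[OF equiv_cauchy_rel] assms by (simp add: completion_def)
qed

lemma zero_completion: "\<zero>\<^bsub>completion X\<^esub> = cls (\<lambda>_. \<zero>)"
  by (simp add: completion_def)

text \<open>The norm of a class is a limit along a representative picked by Hilbert choice. Norms of
  equivalent sequences differ by a null sequence, so every representative gives the same
  limit.\<close>

lemma nrm_completion:
  assumes "ncauchy X p"
  shows "(\<lambda>n. nrm X (p n)) \<longlonglongrightarrow> nrm (completion X) (cls p)"
proof -
  define q where "q = (SOME q. q \<in> cls p)"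
  have "p \<in> cls p"
    using assms equiv_class_self[OF equiv_cauchy_rel] by blast
  then have "q \<in> cls p"
    unfolding q_def by (rule someI[of "\<lambda>q. q \<in> cls p"])
  then have q: "ncauchy X q" and pq: "(\<lambda>n. nrm X (p n \<ominus> q n)) \<longlonglongrightarrow> 0"
    by (auto simp: cauchy_rel_iff)
  note [simp] = assms[THEN ncauchy_carrier] q[THEN ncauchy_carrier]
  have "Cauchy (\<lambda>n. nrm X (q n))"
    unfolding Cauchy_iff
  proof (intro allI impI)
    fix e :: real assume "0 < e"
    then obtain N where N: "\<And>n n'. n \<ge> N \<Longrightarrow> n' \<ge> N \<Longrightarrow> nrm X (q n \<ominus> q n') < e"
      using q unfolding ncauchy_iff by meson
    have "norm (nrm X (q n) - nrm X (q n')) < e" if "n \<ge> N" "n' \<ge> N" for n n'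
      using N[OF that] nrm_diff_le[of "q n" "q n'"] by simp
    then show "\<exists>N. \<forall>n\<ge>N. \<forall>n'\<ge>N. norm (nrm X (q n) - nrm X (q n')) < e" by blast
  qed
  then have L: "(\<lambda>n. nrm X (q n)) \<longlonglongrightarrow> lim (\<lambda>n. nrm X (q n))"
    using Cauchy_convergent convergent_LIMSEQ_iff by blast
  have "(\<lambda>n. nrm X (p n) - nrm X (q n)) \<longlonglongrightarrow> 0"
    using pq by (rule Lim_null_comparison[rotated]) (simp add: nrm_diff_le)
  from tendsto_add[OF this L] show ?thesis
    by (simp add: completion_def q_def)
qed

lemma completion_cases:
  assumes "P \<in> carrier (completion X)"
  obtains p where "ncauchy X p" "P = cls p"
  using assms by (auto simp: carrier_completion)

lemma cls_in_completion [simp]: "ncauchy X p \<Longrightarrow> cls p \<in> carrier (completion X)"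
  by (simp add: carrier_completion)

lemma completion_normed_space: "complex_normed_space (completion X)"
proof -
  let ?C = "completion X"
  have grp: "abelian_group ?C"
  proof (rule abelian_groupI)
    fix P Q R assume "P \<in> carrier ?C" "Q \<in> carrier ?C" "R \<in> carrier ?C"
    then obtain p q r where "P = cls p" "Q = cls q" "R = cls r"
      and C: "ncauchy X p" "ncauchy X q" "ncauchy X r"
      by (metis completion_cases)
    then show "P \<oplus>\<^bsub>?C\<^esub> Q \<oplus>\<^bsub>?C\<^esub> R = P \<oplus>\<^bsub>?C\<^esub> (Q \<oplus>\<^bsub>?C\<^esub> R)"
      by (simp add: add_completion ncauchy_add ncauchy_carrier M.a_assoc)
  next
    fix P Q assume "P \<in> carrier ?C" "Q \<in> carrier ?C"
    then obtain p q where *: "P = cls p" "Q = cls q" and C: "ncauchy X p" "ncauchy X q"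
      by (metis completion_cases)
    then show "P \<oplus>\<^bsub>?C\<^esub> Q \<in> carrier ?C"
      by (simp add: add_completion ncauchy_add)
    show "P \<oplus>\<^bsub>?C\<^esub> Q = Q \<oplus>\<^bsub>?C\<^esub> P"
      using * C by (simp add: add_completion ncauchy_carrier M.a_comm)
  next
    show "\<zero>\<^bsub>?C\<^esub> \<in> carrier ?C" by (simp add: zero_completion)
  next
    fix P assume "P \<in> carrier ?C"
    then obtain p where *: "P = cls p" and C: "ncauchy X p"
      by (metis completion_cases)
    show "\<zero>\<^bsub>?C\<^esub> \<oplus>\<^bsub>?C\<^esub> P = P"
      using * C by (simp add: add_completion zero_completion ncauchy_carrier)
    have "cls (\<lambda>n. (-1) \<odot> p n) \<oplus>\<^bsub>?C\<^esub> P = \<zero>\<^bsub>?C\<^esub>"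
      using * C ncauchy_smult[OF C, of "-1"]
      by (simp add: add_completion zero_completion ncauchy_carrier M.l_neg flip: uminus_eq_smult)
    then show "\<exists>Q\<in>carrier ?C. Q \<oplus>\<^bsub>?C\<^esub> P = \<zero>\<^bsub>?C\<^esub>"
      using ncauchy_smult[OF C] cls_in_completion by blast
  qed
  have mod: "module complex_line ?C"
  proof (rule moduleI[OF cring_complex_line grp])
    fix a b P assume "P \<in> carrier ?C"
    then obtain p where *: "P = cls p" and C: "ncauchy X p"
      by (metis completion_cases)
    show "a \<odot>\<^bsub>?C\<^esub> P \<in> carrier ?C"
      using * C by (simp add: smult_completion ncauchy_smult)
    show "(a \<oplus>\<^bsub>complex_line\<^esub> b) \<odot>\<^bsub>?C\<^esub> P = a \<odot>\<^bsub>?C\<^esub> P \<oplus>\<^bsub>?C\<^esub> b \<odot>\<^bsub>?C\<^esub> P"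
      using * C
      by (simp add: smult_completion add_completion ncauchy_smult ncauchy_carrier smult_add_left)
    show "(a \<otimes>\<^bsub>complex_line\<^esub> b) \<odot>\<^bsub>?C\<^esub> P = a \<odot>\<^bsub>?C\<^esub> (b \<odot>\<^bsub>?C\<^esub> P)"
      using * C by (simp add: smult_completion ncauchy_smult ncauchy_carrier smult_assoc)
    show "\<one>\<^bsub>complex_line\<^esub> \<odot>\<^bsub>?C\<^esub> P = P"
      using * C by (simp add: smult_completion ncauchy_carrier)
  next
    fix a P Q assume "P \<in> carrier ?C" "Q \<in> carrier ?C"
    then obtain p q where *: "P = cls p" "Q = cls q" and C: "ncauchy X p" "ncauchy X q"
      by (metis completion_cases)
    then show "a \<odot>\<^bsub>?C\<^esub> (P \<oplus>\<^bsub>?C\<^esub> Q) = a \<odot>\<^bsub>?C\<^esub> P \<oplus>\<^bsub>?C\<^esub> a \<odot>\<^bsub>?C\<^esub> Q"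
      by (simp add: smult_completion add_completion ncauchy_smult ncauchy_add ncauchy_carrier
          smult_add_right)
  qed
  show ?thesis
  proof (rule complex_normed_space.intro[OF mod], unfold_locales)
    fix P assume "P \<in> carrier ?C"
    then obtain p where *: "P = cls p" and C: "ncauchy X p"
      by (metis completion_cases)
    note L = nrm_completion[OF C]
    show "0 \<le> nrm ?C P"
      using L * by (intro LIMSEQ_le_const[OF L[folded *]]) (auto simp: nrm_nonneg C ncauchy_carrier)
    have "nrm ?C P = 0 \<longleftrightarrow> (\<lambda>n. nrm X (p n)) \<longlonglongrightarrow> 0"
      using L * LIMSEQ_unique by auto
    also have "\<dots> \<longleftrightarrow> P = \<zero>\<^bsub>?C\<^esub>"
      using * C by (simp add: zero_completion cls_eq_iff ncauchy_carrier minus_zero)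
    finally show "nrm ?C P = 0 \<longleftrightarrow> P = \<zero>\<^bsub>?C\<^esub>" .
    show "nrm ?C (c \<odot>\<^bsub>?C\<^esub> P) = cmod c * nrm ?C P" for c
      using LIMSEQ_unique[OF nrm_completion[OF ncauchy_smult[OF C, of c]]] C
        tendsto_mult_left[OF L, of "cmod c"]
      by (simp add: * smult_completion nrm_smult ncauchy_carrier)
  next
    fix P Q assume "P \<in> carrier ?C" "Q \<in> carrier ?C"
    then obtain p q where *: "P = cls p" "Q = cls q" and C: "ncauchy X p" "ncauchy X q"
      by (metis completion_cases)
    show "nrm ?C (P \<oplus>\<^bsub>?C\<^esub> Q) \<le> nrm ?C P + nrm ?C Q"
      using LIMSEQ_le[OF nrm_completion[OF ncauchy_add[OF C]]
          tendsto_add[OF nrm_completion[OF C(1)] nrm_completion[OF C(2)]]] C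
      by (simp add: * add_completion nrm_triangle ncauchy_carrier)
  qed
qed

lemma completion_embed_eq: "completion_embed X x = cls (\<lambda>_. x)"
  by (simp add: completion_embed_def)

lemma minus_completion:
  assumes p: "ncauchy X p" and q: "ncauchy X q"
  shows "cls p \<ominus>\<^bsub>completion X\<^esub> cls q = cls (\<lambda>n. p n \<ominus> q n)"
proof -
  interpret C: complex_normed_space "completion X" by (rule completion_normed_space)
  show ?thesis
    using assms
    by (simp add: C.M.minus_eq M.minus_eq C.uminus_eq_smult uminus_eq_smult smult_completion
        add_completion ncauchy_smult ncauchy_carrier)
qed

text \<open>The class of p minus the constant class of \<open>p n\<close> is represented by the
  sequence of \<open>p k \<ominus> p n\<close>, whose norms are eventually small. This is the
  density behind the uniqueness of extensions.\<close>

lemma completion_dense: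
  assumes p: "ncauchy X p"
  shows "(\<lambda>n. nrm (completion X) (cls p \<ominus>\<^bsub>completion X\<^esub> completion_embed X (p n))) \<longlonglongrightarrow> 0"
proof (rule LIMSEQ_I)
  interpret C: complex_normed_space "completion X" by (rule completion_normed_space)
  note [simp] = p[THEN ncauchy_carrier]
  fix e :: real assume "0 < e"
  then obtain N where N: "\<And>n n'. n \<ge> N \<Longrightarrow> n' \<ge> N \<Longrightarrow> nrm X (p n \<ominus> p n') < e/2"
    using p unfolding ncauchy_iff by (meson half_gt_zero)
  have "norm (nrm (completion X) (cls p \<ominus>\<^bsub>completion X\<^esub> completion_embed X (p n)) - 0) < e"
    if "n \<ge> N" for n
  proof -
    have C: "ncauchy X (\<lambda>k. p k \<ominus> p n)"
      using ncauchy_add[OF p ncauchy_const[of "\<ominus> p n"]] by (simp add: M.minus_eq)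
    have "nrm (completion X) (cls (\<lambda>k. p k \<ominus> p n)) \<le> e/2"
      using N that by (intro LIMSEQ_le_const2[OF nrm_completion[OF C]]) (meson less_imp_le)
    then show ?thesis
      using \<open>0 < e\<close> p C by (simp add: completion_embed_eq minus_completion C.nrm_nonneg)
  qed
  then show "\<exists>N. \<forall>n\<ge>N. norm (nrm (completion X) (cls p \<ominus>\<^bsub>completion X\<^esub> completion_embed X (p n)) - 0) < e"
    by blast
qed

text \<open>Both operators move the class of p and its approximants \<open>p n\<close> by at most a
  multiple of their distance, and they agree on the approximants. This makes the definite
  description of the tensor operator meaningful.\<close>

lemma bounded_op_completion_unique:
  assumes W: "complex_normed_space W"
    and S: "bounded_op (completion X) W S" and S': "bounded_op (completion X) W S'"
    and eq: "\<And>x. x \<in> carrier X \<Longrightarrow> S (completion_embed X x) = S' (completion_embed X x)"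
    and P: "P \<in> carrier (completion X)"
  shows "S P = S' P"
proof -
  let ?C = "completion X"
  interpret C: complex_normed_space ?C by (rule completion_normed_space)
  interpret W: complex_normed_space W by fact
  obtain K where K: "0 \<le> K" "clinear_map ?C W S" "\<And>x. x \<in> carrier ?C \<Longrightarrow> nrm W (S x) \<le> K * nrm ?C x"
    using bounded_opE[OF C.complex_normed_space_axioms S] by blast
  obtain K' where K': "0 \<le> K'" "clinear_map ?C W S'" "\<And>x. x \<in> carrier ?C \<Longrightarrow> nrm W (S' x) \<le> K' * nrm ?C x"
    using bounded_opE[OF C.complex_normed_space_axioms S'] by blast
  obtain p where p: "ncauchy X p" and P_eq: "P = cls p"
    using P by (metis completion_cases)
  note [simp] = p[THEN ncauchy_carrier]
  have emb [simp]: "completion_embed X (p n) \<in> carrier ?C" for n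
    by (simp add: completion_embed_eq)
  let ?d = "\<lambda>n. nrm ?C (P \<ominus>\<^bsub>?C\<^esub> completion_embed X (p n))"
  have "nrm W (S P \<ominus>\<^bsub>W\<^esub> S' P) \<le> (K + K') * ?d n" for n
  proof -
    let ?x = "completion_embed X (p n)"
    have [simp]: "S P \<in> carrier W" "S' P \<in> carrier W" "S ?x \<in> carrier W" "S' ?x \<in> carrier W"
      by (rule clinear_mapD(1)[OF K(2)] clinear_mapD(1)[OF K'(2)], rule P emb)+
    have "nrm W (S P \<ominus>\<^bsub>W\<^esub> S' P) \<le> nrm W (S P \<ominus>\<^bsub>W\<^esub> S ?x) + nrm W (S ?x \<ominus>\<^bsub>W\<^esub> S' P)"
      by (rule W.nrm_triangle_minus) auto
    also have "nrm W (S ?x \<ominus>\<^bsub>W\<^esub> S' P) = nrm W (S' P \<ominus>\<^bsub>W\<^esub> S' ?x)"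
      by (simp add: eq W.nrm_minus_commute)
    also have "S P \<ominus>\<^bsub>W\<^esub> S ?x = S (P \<ominus>\<^bsub>?C\<^esub> ?x)"
      using clinear_map_minus[OF C.complex_normed_space_axioms W K(2) P emb] by simp
    also have "S' P \<ominus>\<^bsub>W\<^esub> S' ?x = S' (P \<ominus>\<^bsub>?C\<^esub> ?x)"
      using clinear_map_minus[OF C.complex_normed_space_axioms W K'(2) P emb] by simp
    also have "nrm W (S (P \<ominus>\<^bsub>?C\<^esub> ?x)) + nrm W (S' (P \<ominus>\<^bsub>?C\<^esub> ?x)) \<le> K * ?d n + K' * ?d n"
      using P by (intro add_mono K(3) K'(3)) auto
    finally show ?thesis by (simp add: algebra_simps)
  qed
  moreover have "(\<lambda>n. (K + K') * ?d n) \<longlonglongrightarrow> 0"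
    using tendsto_mult_right_zero[OF completion_dense[OF p]] P_eq by simp
  ultimately have "nrm W (S P \<ominus>\<^bsub>W\<^esub> S' P) \<le> 0"
    using LIMSEQ_le_const by blast
  then have "S P \<ominus>\<^bsub>W\<^esub> S' P = \<zero>\<^bsub>W\<^esub>"
    using W.nrm_nonneg[of "S P \<ominus>\<^bsub>W\<^esub> S' P"] clinear_mapD(1)[OF K(2) P] clinear_mapD(1)[OF K'(2) P]
    by (simp add: W.nrm_eq_0_iff[symmetric] W.M.minus_closed)
  then show ?thesis
    using P K(2) K'(2) by (simp add: W.minus_eq_zero_iff clinear_mapD(1))
qed

end

section \<open>Separation of points by functionals\<close>

context complex_normed_space
begin

definition sublinear :: "('a \<Rightarrow> real) \<Rightarrow> bool" where
  "sublinear q \<longleftrightarrow>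
     (\<forall>x\<in>carrier X. \<forall>y\<in>carrier X. q (x \<oplus> y) \<le> q x + q y) \<and>
     (\<forall>t\<ge>0. \<forall>x\<in>carrier X. q (complex_of_real t \<odot> x) = t * q x)"

lemma sublinear_add: "sublinear q \<Longrightarrow> x \<in> carrier X \<Longrightarrow> y \<in> carrier X \<Longrightarrow> q (x \<oplus> y) \<le> q x + q y"
  by (simp add: sublinear_def)

lemma sublinear_scale:
  "sublinear q \<Longrightarrow> x \<in> carrier X \<Longrightarrow> 0 \<le> t \<Longrightarrow> q (complex_of_real t \<odot> x) = t * q x"
  by (simp add: sublinear_def)

lemma sublinear_zero: "sublinear q \<Longrightarrow> q \<zero> = 0"
  using sublinear_scale[of q \<zero> 0] by simp

lemma sublinear_uminus: "sublinear q \<Longrightarrow> x \<in> carrier X \<Longrightarrow> - q (\<ominus> x) \<le> q x"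
  using sublinear_add[of q x "\<ominus> x"] by (simp add: sublinear_zero M.r_neg)

text \<open>One inequality for every positive factor is enough: applied with the factor 1 / t it
  gives the reverse inequality for t.\<close>

lemma sublinearI:
  assumes add: "\<And>x y. x \<in> carrier X \<Longrightarrow> y \<in> carrier X \<Longrightarrow> q (x \<oplus> y) \<le> q x + q y"
    and scale: "\<And>t x. 0 < t \<Longrightarrow> x \<in> carrier X \<Longrightarrow> q (complex_of_real t \<odot> x) \<le> t * q x"
    and zero: "q \<zero> = 0"
  shows "sublinear q"
  unfolding sublinear_def
proof (intro conjI ballI allI impI add)
  fix t :: real and x assume t: "0 \<le> t" and x: "x \<in> carrier X"
  show "q (complex_of_real t \<odot> x) = t * q x"
  proof (cases "t = 0")
    case True
    then show ?thesis using x zero by simp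
  next
    case False
    then have "0 < t" using t by simp
    have "q x = q (complex_of_real (1 / t) \<odot> (complex_of_real t \<odot> x))"
      using \<open>0 < t\<close> x by (simp flip: smult_assoc of_real_mult)
    also have "\<dots> \<le> (1 / t) * q (complex_of_real t \<odot> x)"
      using \<open>0 < t\<close> x by (intro scale) auto
    finally show ?thesis
      using scale[OF \<open>0 < t\<close> x] \<open>0 < t\<close> by (simp add: field_simps)
  qed
qed

text \<open>
  Minimal sublinear functionals are linear: such a \<open>q\<close> coincides with \<open>shift q y\<close> for every \<open>y\<close>,
  and \<open>shift q y (\<ominus> y) \<le> - q y\<close>.
\<close>

definition shift :: "('a \<Rightarrow> real) \<Rightarrow> 'a \<Rightarrow> 'a \<Rightarrow> real" where
  "shift q y x = (INF t\<in>{0..}. q (x \<oplus> complex_of_real t \<odot> y) - t * q y)"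

text \<open>Subadditivity bounds the expression below by \<open>- q (\<ominus> x)\<close>, uniformly
  in t, so the infimum is a real lower bound.\<close>

lemma shift_le:
  assumes q: "sublinear q" and y: "y \<in> carrier X" and x: "x \<in> carrier X" and t: "0 \<le> t"
  shows "shift q y x \<le> q (x \<oplus> complex_of_real t \<odot> y) - t * q y"
  unfolding shift_def
proof (rule cINF_lower)
  show "bdd_below ((\<lambda>t. q (x \<oplus> complex_of_real t \<odot> y) - t * q y) ` {0..})"
  proof (rule bdd_belowI2)
    fix t :: real assume "t \<in> {0..}"
    then have "t * q y = q ((x \<oplus> complex_of_real t \<odot> y) \<oplus> \<ominus> x)"
      using sublinear_scale[OF q y, of t] x y by (simp add: M.a_ac M.r_neg2 M.r_neg1)
    also have "\<dots> \<le> q (x \<oplus> complex_of_real t \<odot> y) + q (\<ominus> x)"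
      using x y by (intro sublinear_add q) auto
    finally show "- q (\<ominus> x) \<le> q (x \<oplus> complex_of_real t \<odot> y) - t * q y" by simp
  qed
qed (use t in auto)

lemma shift_greatest:
  assumes "\<And>t. 0 \<le> t \<Longrightarrow> b \<le> q (x \<oplus> complex_of_real t \<odot> y) - t * q y"
  shows "b \<le> shift q y x"
  unfolding shift_def using assms by (intro cINF_greatest) auto

text \<open>For a sum of vectors the parameters t and t' are added; for a multiple by s the
  parameter is rescaled to s * t.\<close>

lemma shift_sublinear:
  assumes q: "sublinear q" and y: "y \<in> carrier X"
  shows "sublinear (shift q y)"
proof (rule sublinearI)
  fix x x' assume x: "x \<in> carrier X" "x' \<in> carrier X"
  have "shift q y (x \<oplus> x') - (q (x' \<oplus> complex_of_real t' \<odot> y) - t' * q y)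
      \<le> q (x \<oplus> complex_of_real t \<odot> y) - t * q y" if "0 \<le> t" "0 \<le> t'" for t t'
  proof -
    have "shift q y (x \<oplus> x') \<le> q ((x \<oplus> x') \<oplus> complex_of_real (t + t') \<odot> y) - (t + t') * q y"
      using that x y by (intro shift_le q) auto
    also have "(x \<oplus> x') \<oplus> complex_of_real (t + t') \<odot> y
        = (x \<oplus> complex_of_real t \<odot> y) \<oplus> (x' \<oplus> complex_of_real t' \<odot> y)"
      using x y by (simp add: smult_add_left M.a_ac)
    also have "q \<dots> \<le> q (x \<oplus> complex_of_real t \<odot> y) + q (x' \<oplus> complex_of_real t' \<odot> y)"
      using x y by (intro sublinear_add q) auto
    finally show ?thesis by (simp add: algebra_simps)
  qed
  then have "shift q y (x \<oplus> x') - (q (x' \<oplus> complex_of_real t' \<odot> y) - t' * q y) \<le> shift q y x"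
    if "0 \<le> t'" for t'
    using that by (intro shift_greatest)
  then have "shift q y (x \<oplus> x') - shift q y x \<le> shift q y x'"
    by (intro shift_greatest) (simp add: algebra_simps)
  then show "shift q y (x \<oplus> x') \<le> shift q y x + shift q y x'" by simp
next
  fix s :: real and x assume s: "0 < s" and x: "x \<in> carrier X"
  have "shift q y (complex_of_real s \<odot> x) / s \<le> q (x \<oplus> complex_of_real t \<odot> y) - t * q y"
    if t: "0 \<le> t" for t
  proof -
    have "shift q y (complex_of_real s \<odot> x)
        \<le> q (complex_of_real s \<odot> x \<oplus> complex_of_real (s * t) \<odot> y) - s * t * q y"
      using s t x y by (intro shift_le q) auto
    also have "complex_of_real s \<odot> x \<oplus> complex_of_real (s * t) \<odot> y
        = complex_of_real s \<odot> (x \<oplus> complex_of_real t \<odot> y)"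
      using x y by (simp add: smult_add_right smult_assoc)
    also have "q \<dots> = s * q (x \<oplus> complex_of_real t \<odot> y)"
      using s x y by (intro sublinear_scale q) auto
    finally show ?thesis
      using s by (simp add: field_simps)
  qed
  then have "shift q y (complex_of_real s \<odot> x) / s \<le> shift q y x"
    by (rule shift_greatest)
  then show "shift q y (complex_of_real s \<odot> x) \<le> s * shift q y x"
    using s by (simp add: field_simps)
next
  have "shift q y \<zero> \<le> 0"
    using shift_le[OF q y M.zero_closed, of 0] y by (simp add: sublinear_zero q)
  moreover have "0 \<le> shift q y \<zero>"
    using y by (intro shift_greatest) (simp add: sublinear_scale q)
  ultimately show "shift q y \<zero> = 0" by simp
qed

lemma shift_le_self:
  assumes "sublinear q" "y \<in> carrier X" "x \<in> carrier X"
  shows "shift q y x \<le> q x"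
  using shift_le[OF assms, of 0] assms by simp

lemma shift_uminus:
  assumes "sublinear q" "y \<in> carrier X"
  shows "shift q y (\<ominus> y) \<le> - q y"
  using shift_le[OF assms, of "\<ominus> y" 1] assms by (simp add: sublinear_zero M.l_neg)

text \<open>Zorn's lemma, with pointwise infima as bounds of chains.\<close>

lemma minimal_sublinear:
  assumes p: "sublinear p"
  obtains q where "sublinear q" "\<And>x. x \<in> carrier X \<Longrightarrow> q x \<le> p x"
    "\<And>q' x. sublinear q' \<Longrightarrow> (\<And>x. x \<in> carrier X \<Longrightarrow> q' x \<le> q x) \<Longrightarrow> x \<in> carrier X \<Longrightarrow> q' x = q x"
proof -
  \<comment> \<open>Extensionality turns agreement on the carrier into equality, so that
    \<open>below\<close> is antisymmetric. As \<open>below\<close> reverses the pointwise order,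
    maximal for it means minimal.\<close>
  define Q where "Q = {q. sublinear q \<and> (\<forall>x\<in>carrier X. q x \<le> p x) \<and> q \<in> extensional (carrier X)}"
  define below where "below q q' \<longleftrightarrow> (\<forall>x\<in>carrier X. q' x \<le> q x)" for q q' :: "'a \<Rightarrow> real"
  have restrict: "sublinear (restrict q (carrier X))" if "sublinear q" for q
    using that by (auto simp: sublinear_def)
  have "\<exists>q\<in>Q. \<forall>q'\<in>Q. below q q' \<longrightarrow> q' = q"
  proof (rule predicate_Zorn)
    show "partial_order_on Q (relation_of below Q)"
    proof (rule partial_order_on_relation_ofI)
      show "a = b" if "a \<in> Q" "b \<in> Q" "below a b" "below b a" for a b
        using that by (intro extensionalityI[of a "carrier X"]) (auto simp: Q_def below_def intro: order_antisym)
    qed (auto simp: below_def intro: order_trans)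
  next
    fix C assume C: "C \<in> Chains (relation_of below Q)"
    then have CQ: "C \<subseteq> Q" by (auto simp: Chains_def relation_of_def)
    have chain: "below q q' \<or> below q' q" if "q \<in> C" "q' \<in> C" for q q'
      using C that by (auto simp: Chains_def relation_of_def)
    show "\<exists>u\<in>Q. \<forall>q\<in>C. below q u"
    proof (cases "C = {}")
      case True
      have "restrict p (carrier X) \<in> Q"
        using p restrict by (simp add: Q_def)
      then show ?thesis using True by blast
    next
      case False
      \<comment> \<open>Members of the chain are sublinear and dominated by p, which gives the
        common lower bound \<open>- p (\<ominus> x)\<close>; hence the infimum is finite.\<close>
      define u where "u x = (INF q\<in>C. q x)" for x
      have lower: "u x \<le> q x" if "q \<in> C" "x \<in> carrier X" for q x
        unfolding u_def
      proof (rule cINF_lower[OF bdd_belowI2 that(1)])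
        fix q assume "q \<in> C"
        then have "- q (\<ominus> x) \<le> q x" "q (\<ominus> x) \<le> p (\<ominus> x)"
          using CQ that by (auto simp: Q_def intro: sublinear_uminus)
        then show "- p (\<ominus> x) \<le> q x" by simp
      qed
      have greatest: "b \<le> u x" if "\<And>q. q \<in> C \<Longrightarrow> b \<le> q x" for b x
        unfolding u_def using False that by (rule cINF_greatest)
      have "sublinear u"
      proof (rule sublinearI)
        fix x y assume x: "x \<in> carrier X" and y: "y \<in> carrier X"
        \<comment> \<open>The two members are comparable, and the smaller one witnesses the estimate
          at x and at y simultaneously.\<close>
        have "u (x \<oplus> y) - q' y \<le> q x" if q: "q \<in> C" "q' \<in> C" for q q'
        proof -
          have "u (x \<oplus> y) \<le> q x + q' y"
            if "q'' \<in> C" "q'' x \<le> q x" "q'' y \<le> q' y" for q''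
            using lower[OF that(1), of "x \<oplus> y"] sublinear_add[of q'' x y] that CQ x y
            by (auto simp: Q_def)
          then have "u (x \<oplus> y) \<le> q x + q' y"
            using chain[OF q] q x y unfolding below_def by (meson order_refl)
          then show ?thesis by simp
        qed
        then have "u (x \<oplus> y) - q' y \<le> u x" if "q' \<in> C" for q'
          using that by (intro greatest)
        then have "u (x \<oplus> y) - u x \<le> u y"
          by (intro greatest) (simp add: algebra_simps)
        then show "u (x \<oplus> y) \<le> u x + u y" by simp
      next
        fix t :: real and x assume t: "0 < t" and x: "x \<in> carrier X"
        have "u (complex_of_real t \<odot> x) / t \<le> q x" if "q \<in> C" for q
        proof -
          have "u (complex_of_real t \<odot> x) \<le> t * q x"
            using lower[OF that, of "complex_of_real t \<odot> x"] sublinear_scale[of q x t] that CQ x t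
            by (auto simp: Q_def)
          then show ?thesis using t by (simp add: field_simps)
        qed
        then have "u (complex_of_real t \<odot> x) / t \<le> u x" by (rule greatest)
        then show "u (complex_of_real t \<odot> x) \<le> t * u x" using t by (simp add: field_simps)
      next
        have "q \<zero> = 0" if "q \<in> C" for q
          using that CQ by (auto simp: Q_def sublinear_zero)
        then have "(\<lambda>q. q \<zero>) ` C = (\<lambda>q. 0) ` C" by (rule image_cong[OF refl])
        then have "(\<lambda>q. q \<zero>) ` C = {0}" using False by (simp add: image_constant_conv)
        then show "u \<zero> = 0" by (simp add: u_def)
      qed
      moreover have "u x \<le> p x" if "x \<in> carrier X" for x
      proof -
        obtain q where "q \<in> C" using False by blast
        then show ?thesis using lower[of q x] CQ that by (force simp: Q_def)
      qed
      ultimately have "restrict u (carrier X) \<in> Q"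
        using restrict by (simp add: Q_def)
      moreover have "\<forall>q\<in>C. below q (restrict u (carrier X))"
        using lower by (simp add: below_def)
      ultimately show ?thesis by blast
    qed
  qed
  then obtain q where q: "q \<in> Q" and min: "\<And>q'. q' \<in> Q \<Longrightarrow> below q q' \<Longrightarrow> q' = q" by blast
  show thesis
  proof (rule that[of q])
    show "sublinear q" "\<And>x. x \<in> carrier X \<Longrightarrow> q x \<le> p x" using q by (auto simp: Q_def)
    fix q' x assume q': "sublinear q'" "\<And>x. x \<in> carrier X \<Longrightarrow> q' x \<le> q x" and x: "x \<in> carrier X"
    have "q' z \<le> p z" if "z \<in> carrier X" for z
      using q'(2)[OF that] q that by (auto simp: Q_def intro: order_trans)
    then have "restrict q' (carrier X) = q"
      using q' restrict by (intro min) (auto simp: Q_def below_def)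
    then show "q' x = q x" using x by auto
  qed
qed

text \<open>A sublinear functional minimal below \<open>shift (nrm X) v\<close> equals each of its
  own shifts; hence it is odd, therefore additive and real linear. Starting from the shift, instead
  of the norm itself, forces its value at v to be at least the norm of v.\<close>

lemma separating_functional:
  assumes v: "v \<in> carrier X" "v \<noteq> \<zero>"
  obtains \<phi> where "clinear_map X complex_line \<phi>"
    "\<And>x. x \<in> carrier X \<Longrightarrow> cmod (\<phi> x) \<le> nrm X x" "\<phi> v \<noteq> 0"
proof -
  have "sublinear (nrm X)"
    by (rule sublinearI) (auto simp: nrm_triangle nrm_smult)
  then obtain q where q: "sublinear q" and le: "\<And>x. x \<in> carrier X \<Longrightarrow> q x \<le> shift (nrm X) v x"
    and min: "\<And>q' x. sublinear q' \<Longrightarrow> (\<And>x. x \<in> carrier X \<Longrightarrow> q' x \<le> q x) \<Longrightarrow> x \<in> carrier X \<Longrightarrow> q' x = q x"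
    using minimal_sublinear[OF shift_sublinear[OF _ v(1)]] by blast
  have le_nrm: "q x \<le> nrm X x" if "x \<in> carrier X" for x
    using le[OF that] shift_le_self[OF \<open>sublinear (nrm X)\<close> v(1) that] by simp
  have uminus: "q (\<ominus> y) = - q y" if y: "y \<in> carrier X" for y
  proof -
    have "shift q y (\<ominus> y) = q (\<ominus> y)"
      using y shift_sublinear[OF q y] shift_le_self[OF q y] by (intro min) auto
    then show ?thesis
      using shift_uminus[OF q y] sublinear_uminus[OF q y] by simp
  qed
  have add: "q (x \<oplus> y) = q x + q y" if "x \<in> carrier X" "y \<in> carrier X" for x y
  proof -
    have "q x = q ((x \<oplus> y) \<oplus> \<ominus> y)"
      using that by (simp add: M.a_assoc M.r_neg)
    also have "\<dots> \<le> q (x \<oplus> y) - q y"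
      using sublinear_add[OF q, of "x \<oplus> y" "\<ominus> y"] that by (simp add: uminus)
    finally show ?thesis
      using sublinear_add[OF q that] by simp
  qed
  have scale: "q (complex_of_real t \<odot> x) = t * q x" if x: "x \<in> carrier X" for t x
  proof (cases "0 \<le> t")
    case True
    then show ?thesis using sublinear_scale[OF q x] by simp
  next
    case False
    then have "q (\<ominus> (complex_of_real (- t) \<odot> x)) = t * q x"
      using x sublinear_scale[OF q x, of "- t"] by (simp add: uminus)
    moreover have "\<ominus> (complex_of_real (- t) \<odot> x) = complex_of_real t \<odot> x"
      using x by (simp add: uminus_eq_smult flip: smult_assoc)
    ultimately show ?thesis by simp
  qed
  have abs_le: "\<bar>q x\<bar> \<le> nrm X x" if "x \<in> carrier X" for x
    using le_nrm[OF that] le_nrm[of "\<ominus> x"] that by (simp add: uminus abs_le_iff)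
  \<comment> \<open>This is the usual complexification of a real functional. Halving it keeps the
    bound by the norm, because the real and the imaginary part are each bounded by the norm
    separately.\<close>
  define \<phi> where "\<phi> x = (complex_of_real (q x) - \<i> * complex_of_real (q (\<i> \<odot> x))) / 2" for x
  have smult: "q (c \<odot> x) = Re c * q x + Im c * q (\<i> \<odot> x)" if x: "x \<in> carrier X" for c x
  proof -
    have "c \<odot> x = complex_of_real (Re c) \<odot> x \<oplus> complex_of_real (Im c) \<odot> (\<i> \<odot> x)"
      using x complex_eq[of c] by (simp flip: smult_assoc smult_add_left add: mult.commute)
    then show ?thesis using x by (simp add: add scale)
  qed
  show thesis
  proof (rule that[of \<phi>])
    show "clinear_map X complex_line \<phi>"
    proof (rule clinear_mapI)
      fix x y assume "x \<in> carrier X" "y \<in> carrier X"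
      then show "\<phi> (x \<oplus> y) = \<phi> x \<oplus>\<^bsub>complex_line\<^esub> \<phi> y"
        by (simp add: \<phi>_def add smult_add_right complex_eq_iff add_divide_distrib)
    next
      fix c x assume x: "x \<in> carrier X"
      have "q (\<i> \<odot> (c \<odot> x)) = Re c * q (\<i> \<odot> x) - Im c * q x"
        using smult[OF x, of "\<i> * c"] x by (simp add: smult_assoc)
      then show "\<phi> (c \<odot> x) = c \<odot>\<^bsub>complex_line\<^esub> \<phi> x"
        using smult[OF x, of c] by (simp add: \<phi>_def complex_eq_iff algebra_simps)
    qed simp
    fix x assume x: "x \<in> carrier X"
    have "cmod (\<phi> x) = cmod (complex_of_real (q x) - \<i> * complex_of_real (q (\<i> \<odot> x))) / 2"
      by (simp add: \<phi>_def norm_divide)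
    also have "\<dots> \<le> (\<bar>q x\<bar> + \<bar>q (\<i> \<odot> x)\<bar>) / 2"
      using norm_triangle_ineq4[of "complex_of_real (q x)" "\<i> * complex_of_real (q (\<i> \<odot> x))"]
      by (simp add: norm_mult)
    also have "\<dots> \<le> nrm X x"
      using abs_le[OF x] abs_le[of "\<i> \<odot> x"] x by (simp add: nrm_smult)
    finally show "cmod (\<phi> x) \<le> nrm X x" .
  next
    have "q (\<ominus> v) \<le> - nrm X v"
      using le[of "\<ominus> v"] shift_uminus[OF \<open>sublinear (nrm X)\<close> v(1)] v by simp
    then have "0 < q v"
      using v nrm_nonneg[OF v(1)] nrm_eq_0_iff[OF v(1)] by (simp add: uminus)
    then show "\<phi> v \<noteq> 0"
      by (simp add: \<phi>_def complex_eq_iff)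
  qed
qed

end

section \<open>Hilbert spaces and singular vectors\<close>

text \<open>A linear combination is described by its values under all linear functionals, which
  replaces finite sums in the carrier by sums of complex numbers. The subspace S keeps the result
  inside an eigenspace when that matters.\<close>

lemma linear_combination_exists:
  fixes k :: nat
  assumes X: "complex_normed_space X" and S: "S \<subseteq> carrier X" "\<zero>\<^bsub>X\<^esub> \<in> S"
    "\<And>x y. x \<in> S \<Longrightarrow> y \<in> S \<Longrightarrow> x \<oplus>\<^bsub>X\<^esub> y \<in> S" "\<And>c x. x \<in> S \<Longrightarrow> c \<odot>\<^bsub>X\<^esub> x \<in> S"
    and g: "\<And>j. j < k \<Longrightarrow> g j \<in> S"
  shows "\<exists>w\<in>S. \<forall>h. clinear_map X complex_line h \<longrightarrow> h w = (\<Sum>j<k. c j * h (g j))"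
  using g
proof (induction k)
  case 0
  interpret X: complex_normed_space X by fact
  have "h \<zero>\<^bsub>X\<^esub> = 0" if h: "clinear_map X complex_line h" for h
    using clinear_mapD(3)[OF h X.M.zero_closed, of 0] by simp
  then show ?case using S by auto
next
  case (Suc k)
  then obtain w where w: "w \<in> S"
    "\<And>h. clinear_map X complex_line h \<Longrightarrow> h w = (\<Sum>j<k. c j * h (g j))"
    by (metis less_SucI)
  have g: "g k \<in> S" using Suc by simp
  have "h (w \<oplus>\<^bsub>X\<^esub> c k \<odot>\<^bsub>X\<^esub> g k) = (\<Sum>j<Suc k. c j * h (g j))"
    if h: "clinear_map X complex_line h" for h
    using clinear_mapD(2)[OF h, of w "c k \<odot>\<^bsub>X\<^esub> g k"] clinear_mapD(3)[OF h, of "g k" "c k"] w h g S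
    by (simp add: subset_iff)
  moreover have "w \<oplus>\<^bsub>X\<^esub> c k \<odot>\<^bsub>X\<^esub> g k \<in> S"
    using w g S by blast
  ultimately show ?case by blast
qed

section \<open>Inner products, adjoints and compact operators\<close>

context complex_hilbert_space
begin

lemma cip_add_right:
  assumes "x \<in> carrier H" "y \<in> carrier H" "z \<in> carrier H"
  shows "cip H z (x \<oplus> y) = cip H z x + cip H z y"
  using assms cip_add_left[of x y z] cip_commute[of _ z] by (metis M.a_closed complex_cnj_add)

lemma cip_smult_right:
  assumes "x \<in> carrier H" "y \<in> carrier H"
  shows "cip H y (c \<odot> x) = cnj c * cip H y x"
  using assms cip_smult_left[of x y c] cip_commute[of _ y] by (metis complex_cnj_mult smult_in_carrier)

lemma clinear_map_cip: "y \<in> carrier H \<Longrightarrow> clinear_map H complex_line (\<lambda>x. cip H x y)"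
  by (rule clinear_mapI) (simp_all add: cip_add_left cip_smult_left)

lemma cip_minus_left:
  assumes "x \<in> carrier H" "y \<in> carrier H" "z \<in> carrier H"
  shows "cip H (x \<ominus> y) z = cip H x z - cip H y z"
  using assms by (simp add: M.minus_eq uminus_eq_smult cip_add_left cip_smult_left)

lemma cip_minus_right:
  assumes "x \<in> carrier H" "y \<in> carrier H" "z \<in> carrier H"
  shows "cip H z (x \<ominus> y) = cip H z x - cip H z y"
  using assms by (simp add: M.minus_eq uminus_eq_smult cip_add_right cip_smult_right)

lemma cip_zero_left [simp]: "z \<in> carrier H \<Longrightarrow> cip H \<zero> z = 0"
  using cip_smult_left[of \<zero> z 0] by simp

lemma cip_zero_right [simp]: "z \<in> carrier H \<Longrightarrow> cip H z \<zero> = 0"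
  using cip_smult_right[of \<zero> z 0] by simp

lemma cip_eq_0_commute: "x \<in> carrier H \<Longrightarrow> y \<in> carrier H \<Longrightarrow> cip H x y = 0 \<Longrightarrow> cip H y x = 0"
  by (simp add: cip_commute[of x y])

lemma nrm_square: "x \<in> carrier H \<Longrightarrow> (nrm H x)\<^sup>2 = Re (cip H x x)"
  by (simp add: cip_self)

lemma nrm_add_square:
  assumes "x \<in> carrier H" "y \<in> carrier H"
  shows "(nrm H (x \<oplus> y))\<^sup>2 = (nrm H x)\<^sup>2 + (nrm H y)\<^sup>2 + 2 * Re (cip H x y)"
  using assms cip_commute[of x y] by (simp add: nrm_square cip_add_left cip_add_right)

lemma nrm_minus_square:
  assumes "x \<in> carrier H" "y \<in> carrier H"
  shows "(nrm H (x \<ominus> y))\<^sup>2 = (nrm H x)\<^sup>2 + (nrm H y)\<^sup>2 - 2 * Re (cip H x y)"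
  using assms cip_commute[of x y] by (simp add: nrm_square cip_minus_left cip_minus_right)

lemma cauchy_schwarz:
  assumes x: "x \<in> carrier H" and y: "y \<in> carrier H"
  shows "cmod (cip H x y) \<le> nrm H x * nrm H y"
proof (cases "y = \<zero>")
  case True
  then show ?thesis using x by simp
next
  case False
  define b where "b = (nrm H y)\<^sup>2"
  have b: "0 < b"
    using False y nrm_eq_0_iff[OF y] by (simp add: b_def)
  \<comment> \<open>The coefficient of the orthogonal projection of x onto the line through
    y.\<close>
  define c where "c = cip H x y / complex_of_real b"
  have "(nrm H (x \<ominus> c \<odot> y))\<^sup>2 = (nrm H x)\<^sup>2 + (nrm H (c \<odot> y))\<^sup>2 - 2 * Re (cip H x (c \<odot> y))"
    using x y by (simp add: nrm_minus_square)
  also have "(nrm H (c \<odot> y))\<^sup>2 = (cmod (cip H x y))\<^sup>2 / b"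
  proof -
    have "(nrm H (c \<odot> y))\<^sup>2 = (cmod (cip H x y) / b)\<^sup>2 * b"
      using y b by (simp add: nrm_smult power_mult_distrib power_divide c_def norm_divide b_def[symmetric])
    then show ?thesis using b by (simp add: power2_eq_square)
  qed
  also have "cip H x (c \<odot> y) = complex_of_real ((cmod (cip H x y))\<^sup>2 / b)"
    using x y by (simp add: cip_smult_right c_def complex_norm_square[symmetric] mult.commute)
  finally have "(cmod (cip H x y))\<^sup>2 / b \<le> (nrm H x)\<^sup>2"
    by (simp add: le_diff_eq) (metis diff_ge_0_iff_ge zero_le_power2)
  then have "(cmod (cip H x y))\<^sup>2 \<le> (nrm H x * nrm H y)\<^sup>2"
    using b by (simp add: pos_divide_le_eq power_mult_distrib b_def)
  then show ?thesis
    by (rule power2_le_imp_le) (simp add: nrm_nonneg x y)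
qed

lemma cip_eqI:
  assumes z: "z \<in> carrier H" "z' \<in> carrier H"
    and eq: "\<And>x. x \<in> carrier H \<Longrightarrow> cip H x z = cip H x z'"
  shows "z = z'"
proof -
  have "cip H (z \<ominus> z') (z \<ominus> z') = 0"
    using z eq[of "z \<ominus> z'"] by (simp add: cip_minus_right)
  then show ?thesis
    using z by (simp add: cip_self nrm_eq_0_iff minus_eq_zero_iff)
qed

lemma hadjoint_eqI:
  assumes "z \<in> carrier H" "\<And>x. x \<in> carrier H \<Longrightarrow> cip H (U x) y = cip H x z"
  shows "hadjoint H U y = z"
  unfolding hadjoint_def using assms by (intro the_equality) (auto intro: cip_eqI)

text \<open>
  The representing vector minimises \<open>\<lambda>x. \<parallel>x\<parallel>\<^sup>2 - 2 Re (f x)\<close>; by the parallelogram law every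
  minimising sequence is Cauchy.
\<close>

lemma riesz_representation:
  assumes f: "clinear_map H complex_line f" and K: "\<And>x. x \<in> carrier H \<Longrightarrow> cmod (f x) \<le> K * nrm H x"
  obtains z where "z \<in> carrier H" "\<And>x. x \<in> carrier H \<Longrightarrow> f x = cip H x z"
proof -
  define J where "J x = (nrm H x)\<^sup>2 - 2 * Re (f x)" for x
  define j where "j = (INF x\<in>carrier H. J x)"
  have Re_f: "\<bar>Re (f x)\<bar> \<le> K * nrm H x" if "x \<in> carrier H" for x
    using K[OF that] abs_Re_le_cmod[of "f x"] by simp
  have bdd: "bdd_below (J ` carrier H)"
  proof (rule bdd_belowI2)
    fix x assume x: "x \<in> carrier H"
    \<comment> \<open>Completing the square shows that J cannot fall below minus the square of
      K.\<close>
    have "0 \<le> (nrm H x - K)\<^sup>2" by simp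
    then show "- K\<^sup>2 \<le> J x"
      using Re_f[OF x] by (simp add: J_def power2_diff algebra_simps abs_le_iff)
  qed
  have j_le: "j \<le> J x" if "x \<in> carrier H" for x
    unfolding j_def using bdd that by (rule cINF_lower)
  have "\<exists>x\<in>carrier H. J x < j + 1 / real (Suc n)" for n
  proof -
    have "Inf (J ` carrier H) < j + 1 / real (Suc n)" by (simp add: j_def)
    then show ?thesis
      using cInf_less_iff[of "J ` carrier H"] bdd M.zero_closed by blast
  qed
  then obtain p where p: "\<And>n. p n \<in> carrier H" "\<And>n. J (p n) < j + 1 / real (Suc n)" by metis
  \<comment> \<open>J is at least j at the midpoint of a and b. Inserted into the parallelogram law,
    this bounds their distance by the excesses of J a and J b over j.\<close>
  have par: "(nrm H (a \<ominus> b))\<^sup>2 \<le> 2 * (J a + J b - 2 * j)" if a: "a \<in> carrier H" and b: "b \<in> carrier H" for a b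
  proof -
    have fadd: "f (a \<oplus> b) = f a + f b"
      using f a b by (simp add: clinear_mapD)
    have "J ((1/2) \<odot> (a \<oplus> b)) = (nrm H (a \<oplus> b))\<^sup>2 / 4 - Re (f a + f b)"
    proof -
      have "f ((1/2) \<odot> (a \<oplus> b)) = (f a + f b) / 2"
        using clinear_mapD(3)[OF f, of "a \<oplus> b" "1/2"] a b fadd by simp
      then have "Re (f ((1/2) \<odot> (a \<oplus> b))) = (Re (f a) + Re (f b)) / 2"
        by (metis Re_divide_numeral plus_complex.sel(1))
      then show ?thesis using a b by (simp add: J_def nrm_smult power_divide)
    qed
    then have "4 * j \<le> (nrm H (a \<oplus> b))\<^sup>2 - 4 * Re (f a) - 4 * Re (f b)"
      using j_le[of "(1/2) \<odot> (a \<oplus> b)"] a b by simp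
    moreover have "Q \<le> 2 * (A - 2 * r + (B - 2 * t) - 2 * j)"
      if "4 * j \<le> P - 4 * r - 4 * t" "P = A + B + 2 * R" "Q = A + B - 2 * R" for A B P Q R r t :: real
      using that by argo
    ultimately show ?thesis
      using nrm_add_square[OF a b] nrm_minus_square[OF a b] unfolding J_def by blast
  qed
  have "ncauchy H p"
    unfolding ncauchy_iff
  proof (intro conjI allI impI p)
    fix e :: real assume "0 < e"
    then obtain N where N: "1 / real (Suc N) < e\<^sup>2 / 4"
      using nat_approx_posE[of "e\<^sup>2 / 4"] by (metis divide_pos_pos zero_less_numeral zero_less_power)
    have "nrm H (p n \<ominus> p n') < e" if n: "N \<le> n" "N \<le> n'" for n n'
    proof -
      have "1 / real (Suc n) \<le> 1 / real (Suc N)" "1 / real (Suc n') \<le> 1 / real (Suc N)"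
        using n by (auto simp: frac_le)
      then have "(nrm H (p n \<ominus> p n'))\<^sup>2 < e\<^sup>2"
        using par[OF p(1) p(1), of n n'] p(2)[of n] p(2)[of n'] N by argo
      then show ?thesis
        using \<open>0 < e\<close> by (intro power_less_imp_less_base[of _ 2 e]) auto
    qed
    then show "\<exists>N. \<forall>n\<ge>N. \<forall>n'\<ge>N. nrm H (p n \<ominus> p n') < e" by blast
  qed
  then obtain z where z: "z \<in> carrier H" and lim: "(\<lambda>n. nrm H (p n \<ominus> z)) \<longlonglongrightarrow> 0"
    using complete complete_iff by blast
  have "(\<lambda>n. nrm H (p n)) \<longlonglongrightarrow> nrm H z"
    using Lim_null_comparison[OF _ lim, of "\<lambda>n. nrm H (p n) - nrm H z"] nrm_diff_le[OF p(1) z]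
    by (simp add: Lim_null[symmetric])
  moreover have "(\<lambda>n. f (p n)) \<longlonglongrightarrow> f z"
  proof -
    have "f (p n) - f z = f (p n \<ominus> z)" for n
      using clinear_mapD(2)[OF f, of "p n \<ominus> z" z] p(1) z by (simp add: minus_add_cancel)
    then have "norm (f (p n) - f z) \<le> K * nrm H (p n \<ominus> z)" for n
      using K[of "p n \<ominus> z"] p(1) z by simp
    then show ?thesis
      using Lim_null_comparison[OF _ tendsto_mult_right_zero[OF lim, of K], of "\<lambda>n. f (p n) - f z"]
      by (simp add: Lim_null[symmetric])
  qed
  ultimately have "(\<lambda>n. J (p n)) \<longlonglongrightarrow> J z"
    unfolding J_def by (intro tendsto_intros)
  moreover have "(\<lambda>n. j + 1 / real (Suc n)) \<longlonglongrightarrow> j + 0"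
    by (intro tendsto_intros LIMSEQ_Suc[OF lim_1_over_n])
  ultimately have Jz: "J z \<le> j"
    using LIMSEQ_le p(2) by (metis (no_types, lifting) add.right_neutral less_imp_le)
  have Re_eq: "Re (cip H x z) = Re (f x)" if x: "x \<in> carrier H" for x
  proof -
    \<comment> \<open>J z is minimal, so the increment of J along real multiples of x is a
      nonnegative quadratic in t without constant term; its linear coefficient 2 b must
      vanish.\<close>
    define b where "b = Re (cip H z x) - Re (f x)"
    have quad: "0 \<le> t\<^sup>2 * (nrm H x)\<^sup>2 + 2 * t * b" for t
    proof -
      have "J (z \<oplus> complex_of_real t \<odot> x) = J z + t\<^sup>2 * (nrm H x)\<^sup>2 + 2 * t * b"
        using x z f
        by (simp add: J_def b_def nrm_add_square nrm_smult clinear_mapD cip_smult_right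
            power_mult_distrib algebra_simps)
      then show ?thesis
        using j_le[of "z \<oplus> complex_of_real t \<odot> x"] Jz x z by simp
    qed
    have "b = 0"
    proof (rule ccontr)
      assume "b \<noteq> 0"
      \<comment> \<open>The quadratic coefficient plus 1, so that the trial point - b / a is
        meaningful even for x = 0 and still makes the increment negative.\<close>
      define a where "a = (nrm H x)\<^sup>2 + 1"
      have a: "1 \<le> a" by (simp add: a_def)
      have "(- b / a)\<^sup>2 * (nrm H x)\<^sup>2 + 2 * (- b / a) * b \<le> (- b / a)\<^sup>2 * a + 2 * (- b / a) * b"
        by (simp add: a_def mult_left_mono)
      also have "\<dots> = - (b\<^sup>2 / a)"
        using a by (simp add: power2_eq_square)
      also have "\<dots> < 0" using a \<open>b \<noteq> 0\<close> by simp
      finally show False using quad[of "- b / a"] by simp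
    qed
    then show ?thesis
      using cip_commute[OF x z] by (simp add: b_def)
  qed
  show thesis
  proof (rule that[OF z])
    fix x assume x: "x \<in> carrier H"
    \<comment> \<open>Passing from x to its multiple by the imaginary unit turns equality of real
      parts into equality of imaginary parts.\<close>
    have "Re (cip H (\<i> \<odot> x) z) = Re (f (\<i> \<odot> x))"
      using x by (intro Re_eq) auto
    then show "f x = cip H x z"
      using x z f Re_eq[OF x] by (simp add: cip_smult_left clinear_mapD complex_eq_iff)
  qed
qed

text \<open>The adjoint vector z exists by Riesz representation. Testing the defining identity at z
  itself bounds the square of its norm by K times the norms of z and y.\<close>

lemma hadjoint_bounded:
  assumes U: "clinear_map H H U" and K: "\<And>x. x \<in> carrier H \<Longrightarrow> nrm H (U x) \<le> K * nrm H x"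
    and y: "y \<in> carrier H"
  shows "hadjoint H U y \<in> carrier H"
    and "\<And>x. x \<in> carrier H \<Longrightarrow> cip H (U x) y = cip H x (hadjoint H U y)"
    and "nrm H (hadjoint H U y) \<le> K * nrm H y"
proof -
  have "clinear_map H complex_line (\<lambda>x. cip H (U x) y)"
    using U clinear_map_cip[OF y] by (rule clinear_map_compose)
  moreover have "cmod (cip H (U x) y) \<le> K * nrm H y * nrm H x" if x: "x \<in> carrier H" for x
  proof -
    have "cmod (cip H (U x) y) \<le> nrm H (U x) * nrm H y"
      by (rule cauchy_schwarz[OF clinear_mapD(1)[OF U x] y])
    also have "\<dots> \<le> K * nrm H x * nrm H y"
      using K[OF x] y by (intro mult_right_mono) (auto simp: nrm_nonneg)
    finally show ?thesis by (simp add: mult_ac)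
  qed
  ultimately obtain z where z: "z \<in> carrier H" "\<And>x. x \<in> carrier H \<Longrightarrow> cip H (U x) y = cip H x z"
    using riesz_representation by blast
  then have eq: "hadjoint H U y = z" by (rule hadjoint_eqI)
  show 1: "hadjoint H U y \<in> carrier H"
    and 2: "\<And>x. x \<in> carrier H \<Longrightarrow> cip H (U x) y = cip H x (hadjoint H U y)"
    using z by (auto simp: eq)
  have "(nrm H z)\<^sup>2 = Re (cip H (U z) y)"
    using z by (simp add: nrm_square)
  also have "\<dots> \<le> nrm H (U z) * nrm H y"
    using cauchy_schwarz[OF clinear_mapD(1)[OF U z(1)] y] complex_Re_le_cmod order_trans by blast
  also have "\<dots> \<le> K * nrm H z * nrm H y"
    using K[OF z(1)] y by (intro mult_right_mono) (auto simp: nrm_nonneg)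
  finally have "nrm H z * nrm H z \<le> nrm H z * (K * nrm H y)"
    by (simp add: power2_eq_square mult_ac)
  \<comment> \<open>Division by the norm of z fails here. The right-hand side is still nonnegative,
    since it dominates the norm of \<open>U y\<close>.\<close>
  moreover have "nrm H z = 0 \<Longrightarrow> 0 \<le> K * nrm H y"
    using K[OF y] nrm_nonneg[OF clinear_mapD(1)[OF U y]] by linarith
  ultimately show "nrm H (hadjoint H U y) \<le> K * nrm H y"
    using nrm_nonneg[OF z(1)] by (cases "nrm H z = 0") (auto simp: eq mult_le_cancel_left)
qed

text \<open>The image of the unit ball is totally bounded, hence bounded in distance; it contains 0,
  so distances bound norms, and scaling does the rest.\<close>

lemma compact_op_bounded:
  assumes U: "compact_op H H U"
  obtains K where "0 \<le> K" "\<And>x. x \<in> carrier H \<Longrightarrow> nrm H (U x) \<le> K * nrm H x"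
proof -
  interpret Met: Metric_space "carrier H" "ndist H" by (rule metric_space)
  let ?S = "U ` {x \<in> carrier H. nrm H x \<le> 1}"
  have lin: "clinear_map H H U" using U by (simp add: compact_op_def)
  have sub: "?S \<subseteq> carrier H" using clinear_mapD(1)[OF lin] by auto
  have "Met.mtotally_bounded ?S"
    using U sub by (intro Met.compact_closure_of_imp_mtotally_bounded) (auto simp: compact_op_def)
  then have "Met.mbounded ?S" by (rule Met.mtotally_bounded_imp_mbounded)
  then have "\<exists>B. \<forall>x\<in>?S. \<forall>y\<in>?S. ndist H x y \<le> B"
    unfolding Met.mbounded_alt by (rule conjunct2)
  then obtain B where B: "\<forall>x\<in>?S. \<forall>y\<in>?S. ndist H x y \<le> B" ..
  have U0: "U \<zero> = \<zero>"
    using clinear_mapD(3)[OF lin M.zero_closed, of 0] clinear_mapD(1)[OF lin M.zero_closed] by simp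
  have B1: "nrm H (U x) \<le> B" if "x \<in> carrier H" "nrm H x \<le> 1" for x
  proof -
    have "\<zero> \<in> ?S" using U0 by (intro image_eqI[of _ _ \<zero>]) auto
    then show ?thesis
      using B[rule_format, of "U x" \<zero>] that clinear_mapD(1)[OF lin] by (auto simp: ndist_def)
  qed
  have "0 \<le> B" using B1[of \<zero>] U0 by simp
  moreover have "nrm H (U x) \<le> B * nrm H x" if x: "x \<in> carrier H" for x
  proof (cases "x = \<zero>")
    case True
    then show ?thesis by (simp add: U0)
  next
    case False
    then have pos: "0 < nrm H x"
      using x nrm_eq_0_iff[OF x] nrm_nonneg[OF x] by linarith
    have "nrm H (U (complex_of_real (1 / nrm H x) \<odot> x)) \<le> B"
      using x pos by (intro B1) (auto simp: nrm_smult norm_divide)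
    then show ?thesis
      using x pos by (simp add: clinear_mapD[OF lin] nrm_smult norm_divide field_simps)
  qed
  ultimately show thesis using that by blast
qed

lemma compact_op_subsequence:
  fixes p :: "nat \<Rightarrow> 'a"
  assumes U: "compact_op H H U" and p: "\<And>n. p n \<in> carrier H" "\<And>n. nrm H (p n) \<le> 1"
  obtains y \<rho> where "y \<in> carrier H" "strict_mono \<rho>" "(\<lambda>n. nrm H (U (p (\<rho> n)) \<ominus> y)) \<longlonglongrightarrow> 0"
proof -
  interpret Met: Metric_space "carrier H" "ndist H" by (rule metric_space)
  let ?S = "U ` {x \<in> carrier H. nrm H x \<le> 1}"
  have lin: "clinear_map H H U" using U by (simp add: compact_op_def)
  have sub: "?S \<subseteq> carrier H" using clinear_mapD(1)[OF lin] by auto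
  have "Met.mtotally_bounded ?S"
    using U sub by (intro Met.compact_closure_of_imp_mtotally_bounded) (auto simp: compact_op_def)
  then have seq: "\<forall>s :: nat \<Rightarrow> 'a. range s \<subseteq> ?S \<longrightarrow> (\<exists>\<rho>. strict_mono \<rho> \<and> ncauchy H (s \<circ> \<rho>))"
    unfolding Met.mtotally_bounded_sequentially by simp
  have "range (\<lambda>n. U (p n)) \<subseteq> ?S" using p by auto
  then have "\<exists>\<rho>. strict_mono \<rho> \<and> ncauchy H ((\<lambda>n. U (p n)) \<circ> \<rho>)"
    by (rule seq[rule_format])
  then obtain \<rho> where \<rho>: "strict_mono \<rho>" "ncauchy H ((\<lambda>n. U (p n)) \<circ> \<rho>)"
    by (elim exE conjE)
  then obtain y where "y \<in> carrier H" "(\<lambda>n. nrm H (((\<lambda>n. U (p n)) \<circ> \<rho>) n \<ominus> y)) \<longlonglongrightarrow> 0"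
    using complete unfolding complete_iff by meson
  then show thesis
    using that[of y \<rho>] \<rho>(1) by (simp add: o_def)
qed

text \<open>A vector depending on its predecessors is turned into the zero vector and keeps its
  slot, so the length stays k. That the span is retained is expressed by orthogonality: whatever is
  orthogonal to the new vectors is orthogonal to the old ones.\<close>

lemma gram_schmidt:
  fixes k :: nat
  assumes S: "S \<subseteq> carrier H" "\<zero> \<in> S"
    "\<And>x y. x \<in> S \<Longrightarrow> y \<in> S \<Longrightarrow> x \<oplus> y \<in> S" "\<And>c x. x \<in> S \<Longrightarrow> c \<odot> x \<in> S"
    and b: "\<And>j. j < k \<Longrightarrow> b j \<in> S"
  shows "\<exists>g. (\<forall>j<k. g j \<in> S \<and> (nrm H (g j) = 1 \<or> g j = \<zero>)) \<and>
    (\<forall>i<k. \<forall>j<k. i \<noteq> j \<longrightarrow> cip H (g i) (g j) = 0) \<and>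
    (\<forall>x\<in>carrier H. (\<forall>j<k. cip H x (g j) = 0) \<longrightarrow> (\<forall>j<k. cip H x (b j) = 0))"
  using b
proof (induction k)
  case 0
  then show ?case by simp
next
  case (Suc k)
  obtain g where g: "(\<forall>j<k. g j \<in> S \<and> (nrm H (g j) = 1 \<or> g j = \<zero>)) \<and>
    (\<forall>i<k. \<forall>j<k. i \<noteq> j \<longrightarrow> cip H (g i) (g j) = 0) \<and>
    (\<forall>x\<in>carrier H. (\<forall>j<k. cip H x (g j) = 0) \<longrightarrow> (\<forall>j<k. cip H x (b j) = 0))"
    using Suc.IH Suc.prems less_SucI by blast
  then have gS: "\<And>j. j < k \<Longrightarrow> g j \<in> S" and g1: "\<And>j. j < k \<Longrightarrow> nrm H (g j) = 1 \<or> g j = \<zero>"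
    and orth: "\<And>i j. i < k \<Longrightarrow> j < k \<Longrightarrow> i \<noteq> j \<Longrightarrow> cip H (g i) (g j) = 0"
    and span: "\<And>x. x \<in> carrier H \<Longrightarrow> (\<And>j. j < k \<Longrightarrow> cip H x (g j) = 0) \<Longrightarrow> \<forall>j<k. cip H x (b j) = 0"
    by simp_all
  have bS: "b k \<in> S" using Suc by simp
  \<comment> \<open>w is the projection of \<open>b k\<close> onto the vectors already constructed;
    the residual v is normalised below.\<close>
  obtain w where w: "w \<in> S"
    "\<And>h. clinear_map H complex_line h \<Longrightarrow> h w = (\<Sum>j<k. cip H (b k) (g j) * h (g j))"
    using linear_combination_exists[OF complex_normed_space_axioms S, of k g "\<lambda>j. cip H (b k) (g j)"] gS by blast
  have cip_w: "cip H w y = (\<Sum>j<k. cip H (b k) (g j) * cip H (g j) y)" if "y \<in> carrier H" for y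
    using w(2)[OF clinear_map_cip[OF that]] .
  define v where "v = b k \<ominus> w"
  have [simp]: "b k \<in> carrier H" "w \<in> carrier H" "v \<in> carrier H"
    using S bS w by (auto simp: v_def)
  have gC: "g j \<in> carrier H" if "j < k" for j using gS[OF that] S by auto
  have vS: "v \<in> S"
    using bS w S by (simp add: v_def M.minus_eq uminus_eq_smult)
  have v_orth: "cip H v (g i) = 0" if i: "i < k" for i
  proof -
    have "cip H w (g i) = (\<Sum>j<k. if j = i then cip H (b k) (g i) * cip H (g i) (g i) else 0)"
      unfolding cip_w[OF gC[OF i]] using i orth by (intro sum.cong) auto
    also have "\<dots> = cip H (b k) (g i) * cip H (g i) (g i)" using i by simp
    also have "\<dots> = cip H (b k) (g i)"
      using g1[OF i] gC[OF i] by (auto simp: cip_self)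
    finally show ?thesis
      using gC[OF i] by (simp add: v_def cip_minus_left)
  qed
  define u where "u = (if v = \<zero> then \<zero> else complex_of_real (1 / nrm H v) \<odot> v)"
  have uS: "u \<in> S" and u1: "nrm H u = 1 \<or> u = \<zero>"
    using vS S nrm_eq_0_iff[of v] nrm_nonneg[of v] by (auto simp: u_def nrm_smult norm_divide)
  have uC: "u \<in> carrier H" using uS S by auto
  have u_orth: "cip H u (g i) = 0" if "i < k" for i
    using v_orth[OF that] gC[OF that] by (auto simp: u_def cip_smult_left)
  have u_orth': "cip H (g i) u = 0" if "i < k" for i
    by (rule cip_eq_0_commute[OF uC gC[OF that] u_orth[OF that]])
  define g' where "g' = g(k := u)"
  have "cip H x (b k) = 0"
    if x: "x \<in> carrier H" and perp: "\<And>j. j < k \<Longrightarrow> cip H x (g j) = 0" "cip H x u = 0" for x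
  proof -
    have "cip H x v = 0"
      using perp(2) x nrm_eq_0_iff[of v] by (auto simp: u_def cip_smult_right split: if_splits)
    moreover have "cip H w x = 0"
      unfolding cip_w[OF x] using cip_eq_0_commute[OF x gC perp(1)] by (intro sum.neutral) simp
    then have "cip H x w = 0" by (rule cip_eq_0_commute[rotated 2]) (use x in auto)
    ultimately show ?thesis using x by (simp add: v_def cip_minus_right)
  qed
  note b_perp = this
  have "\<forall>j<Suc k. cip H x (b j) = 0"
    if x: "x \<in> carrier H" and perp: "\<forall>j<Suc k. cip H x (g' j) = 0" for x
  proof -
    have g_perp: "cip H x (g j) = 0" if "j < k" for j
      using perp[rule_format, of j] that by (simp add: g'_def)
    have "cip H x u = 0"
      using perp[rule_format, of k] by (simp add: g'_def)
    then have "cip H x (b k) = 0"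
      using b_perp[OF x g_perp] by simp
    then show ?thesis
      using span[OF x g_perp] by (simp add: less_Suc_eq)
  qed
  then have "\<forall>x\<in>carrier H. (\<forall>j<Suc k. cip H x (g' j) = 0) \<longrightarrow> (\<forall>j<Suc k. cip H x (b j) = 0)"
    by simp
  moreover have "\<forall>j<Suc k. g' j \<in> S \<and> (nrm H (g' j) = 1 \<or> g' j = \<zero>)"
    using gS g1 uS u1 by (auto simp: g'_def less_Suc_eq)
  moreover have "\<forall>i<Suc k. \<forall>j<Suc k. i \<noteq> j \<longrightarrow> cip H (g' i) (g' j) = 0"
    using orth u_orth u_orth' by (auto simp: g'_def less_Suc_eq)
  ultimately show ?case by blast
qed

text \<open>w is the orthogonal projection onto the first N vectors. A zero \<open>e n\<close> is
  harmless: its coefficient is 0, so multiplication by the inner product of \<open>e n\<close> with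
  itself fixes the coefficient in both cases.\<close>

lemma bessel:
  fixes N :: nat
  assumes x: "x \<in> carrier H" and e: "\<And>n. e n \<in> carrier H" "\<And>n. nrm H (e n) = 1 \<or> e n = \<zero>"
    "\<And>i j. i \<noteq> j \<Longrightarrow> cip H (e i) (e j) = 0"
  obtains w where "w \<in> carrier H"
    "\<And>h. clinear_map H complex_line h \<Longrightarrow> h w = (\<Sum>n<N. cip H x (e n) * h (e n))"
    "\<And>n. n < N \<Longrightarrow> cip H (x \<ominus> w) (e n) = 0"
    "(nrm H (x \<ominus> w))\<^sup>2 = (nrm H x)\<^sup>2 - (\<Sum>n<N. (cmod (cip H x (e n)))\<^sup>2)"
proof -
  obtain w where w: "w \<in> carrier H"
    "\<And>h. clinear_map H complex_line h \<Longrightarrow> h w = (\<Sum>j<N. cip H x (e j) * h (e j))"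
    using linear_combination_exists[OF complex_normed_space_axioms, of "carrier H" N e "\<lambda>j. cip H x (e j)"] e(1)
    by auto
  have cip_w: "cip H w y = (\<Sum>j<N. cip H x (e j) * cip H (e j) y)" if "y \<in> carrier H" for y
    using w(2)[OF clinear_map_cip[OF that]] .
  have orth: "cip H (x \<ominus> w) (e i) = 0" if i: "i < N" for i
  proof -
    have "cip H w (e i) = (\<Sum>j<N. if j = i then cip H x (e i) * cip H (e i) (e i) else 0)"
      unfolding cip_w[OF e(1)] using e(3) by (intro sum.cong) auto
    also have "\<dots> = cip H x (e i) * cip H (e i) (e i)" using i by simp
    also have "\<dots> = cip H x (e i)"
      using e(2)[of i] e(1)[of i] x by (auto simp: cip_self)
    finally show ?thesis
      using e(1) x w(1) by (simp add: cip_minus_left)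
  qed
  have "cip H w (x \<ominus> w) = 0"
  proof -
    have "cip H (e j) (x \<ominus> w) = 0" if "j < N" for j
      by (rule cip_eq_0_commute[OF _ _ orth[OF that]]) (use x w(1) e(1) in auto)
    then show ?thesis using cip_w[of "x \<ominus> w"] x w(1) by simp
  qed
  then have "cip H (x \<ominus> w) (x \<ominus> w) = cip H x (x \<ominus> w)"
    using x w(1) by (simp add: cip_minus_left)
  also have "\<dots> = cip H x x - cnj (cip H w x)"
    using x w(1) cip_commute[of w x] by (simp add: cip_minus_right)
  also have "cip H w x = (\<Sum>n<N. complex_of_real ((cmod (cip H x (e n)))\<^sup>2))"
    unfolding cip_w[OF x] using x e(1)
    by (intro sum.cong) (auto simp: cip_commute[of x] complex_norm_square[symmetric])
  finally have "(nrm H (x \<ominus> w))\<^sup>2 = (nrm H x)\<^sup>2 - (\<Sum>n<N. (cmod (cip H x (e n)))\<^sup>2)"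
    using x w(1) by (simp add: nrm_square)
  then show thesis using that w orth by blast
qed

end

lemma clinear_functional_finsum:
  fixes k :: nat
  assumes X: "complex_normed_space X" and h: "clinear_map X complex_line h"
    and b: "\<And>j. j < k \<Longrightarrow> b j \<in> carrier X"
  shows "h (\<Oplus>\<^bsub>X\<^esub>j\<in>{..<k}. c j \<odot>\<^bsub>X\<^esub> b j) = (\<Sum>j<k. c j * h (b j))"
  using b
proof (induction k)
  interpret X: complex_normed_space X by fact
  case 0
  show ?case
    using clinear_mapD(3)[OF h X.M.zero_closed, of 0] by simp
next
  interpret X: complex_normed_space X by fact
  case (Suc k)
  have "(\<Oplus>\<^bsub>X\<^esub>j\<in>{..<Suc k}. c j \<odot>\<^bsub>X\<^esub> b j) = c k \<odot>\<^bsub>X\<^esub> b k \<oplus>\<^bsub>X\<^esub> (\<Oplus>\<^bsub>X\<^esub>j\<in>{..<k}. c j \<odot>\<^bsub>X\<^esub> b j)"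
    unfolding lessThan_Suc using Suc.prems by (subst X.M.finsum_insert) auto
  moreover have "(\<Oplus>\<^bsub>X\<^esub>j\<in>{..<k}. c j \<odot>\<^bsub>X\<^esub> b j) \<in> carrier X"
    using Suc.prems by (intro X.M.finsum_closed) auto
  ultimately show ?case
    using Suc clinear_mapD(2,3)[OF h] by simp
qed

section \<open>Singular vectors of a compact operator\<close>

context complex_hilbert_space
begin

text \<open>
  The vectors \<open>e n\<close> are the right singular vectors of \<open>U\<close>, with \<open>e n = \<zero>\<close> allowed; this spares
  the comparison of dimensions.
\<close>

lemma singular_vectors:
  assumes U: "compact_op H H U" and \<sigma>: "singular_numbers H U \<sigma>"
  obtains e where "\<And>n. e n \<in> carrier H" "\<And>n. nrm H (e n) = 1 \<or> e n = \<zero>"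
    "\<And>i j. i \<noteq> j \<Longrightarrow> cip H (e i) (e j) = 0"
    "\<And>n. \<sigma> n = 0 \<Longrightarrow> e n = \<zero>"
    "\<And>n x. x \<in> carrier H \<Longrightarrow> cip H (U x) (U (e n)) = complex_of_real ((\<sigma> n)\<^sup>2) * cip H x (e n)"
    "\<And>N x. x \<in> carrier H \<Longrightarrow> \<forall>n<N. cip H x (e n) = 0 \<Longrightarrow> nrm H (U x) \<le> \<sigma> N * nrm H x"
proof -
  have lin: "clinear_map H H U" using U by (simp add: compact_op_def)
  note Ucl = clinear_mapD(1)[OF lin]
  obtain K where K0: "0 \<le> K" and K: "\<And>x. x \<in> carrier H \<Longrightarrow> nrm H (U x) \<le> K * nrm H x"
    using compact_op_bounded[OF U] by blast
  let ?V = "hadjoint H U"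
  have V_carrier: "?V y \<in> carrier H" if "y \<in> carrier H" for y
    using lin K that by (rule hadjoint_bounded(1))
  have V_cip: "cip H (U x) y = cip H x (?V y)" if "y \<in> carrier H" "x \<in> carrier H" for x y
    using lin K that by (rule hadjoint_bounded(2))
  have V_nrm: "nrm H (?V y) \<le> K * nrm H y" if "y \<in> carrier H" for y
    using lin K that by (rule hadjoint_bounded(3))
  have dec: "decseq \<sigma>" and nonneg: "\<And>n. 0 \<le> \<sigma> n" and fin: "\<And>\<mu>. 0 < \<mu> \<Longrightarrow> finite {n. \<sigma> n = \<mu>}"
    using \<sigma> by (auto simp: singular_numbers_def)
  define E where "E \<mu> = {x \<in> carrier H. ?V (U x) = complex_of_real (\<mu>\<^sup>2) \<odot> x}" for \<mu>
  \<comment> \<open>The weak form of the eigenvalue equation lets U itself be used in place of its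
    adjoint.\<close>
  have E_iff: "x \<in> E \<mu> \<longleftrightarrow> x \<in> carrier H \<and>
      (\<forall>y\<in>carrier H. cip H (U y) (U x) = complex_of_real (\<mu>\<^sup>2) * cip H y x)" for x \<mu>
  proof (cases "x \<in> carrier H")
    case True
    have "?V (U x) = complex_of_real (\<mu>\<^sup>2) \<odot> x \<longleftrightarrow>
        (\<forall>y\<in>carrier H. cip H (U y) (U x) = cip H y (complex_of_real (\<mu>\<^sup>2) \<odot> x))"
    proof
      assume "?V (U x) = complex_of_real (\<mu>\<^sup>2) \<odot> x"
      then show "\<forall>y\<in>carrier H. cip H (U y) (U x) = cip H y (complex_of_real (\<mu>\<^sup>2) \<odot> x)"
        using V_cip[OF Ucl[OF True]] by simp
    next
      assume "\<forall>y\<in>carrier H. cip H (U y) (U x) = cip H y (complex_of_real (\<mu>\<^sup>2) \<odot> x)"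
      then show "?V (U x) = complex_of_real (\<mu>\<^sup>2) \<odot> x"
        using True by (intro hadjoint_eqI) auto
    qed
    then show ?thesis using True by (simp add: E_def cip_smult_right)
  qed (simp add: E_def)
  have E_sub: "E \<mu> \<subseteq> carrier H" "\<zero> \<in> E \<mu>"
    "x \<in> E \<mu> \<Longrightarrow> y \<in> E \<mu> \<Longrightarrow> x \<oplus> y \<in> E \<mu>" "x \<in> E \<mu> \<Longrightarrow> c \<odot> x \<in> E \<mu>" for \<mu> x y c
    using clinear_map_zero[OF complex_normed_space_axioms complex_normed_space_axioms lin]
    by (auto simp: E_iff clinear_mapD[OF lin] cip_add_right cip_smult_right algebra_simps)
  have E_orth: "cip H x y = 0" if x: "x \<in> E \<mu>" and y: "y \<in> E \<nu>" and ne: "\<mu>\<^sup>2 \<noteq> \<nu>\<^sup>2" for x y \<mu> \<nu>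
  proof -
    have xy: "x \<in> carrier H" "y \<in> carrier H" using x y E_sub(1) by blast+
    have "complex_of_real (\<nu>\<^sup>2) * cip H x y = cip H (U x) (U y)"
      using y xy by (simp add: E_iff)
    also have "\<dots> = cnj (cip H (U y) (U x))"
      using xy Ucl by (intro cip_commute) auto
    also have "\<dots> = complex_of_real (\<mu>\<^sup>2) * cip H x y"
      using x xy cip_commute[of y x] by (simp add: E_iff)
    finally have "complex_of_real (\<nu>\<^sup>2 - \<mu>\<^sup>2) * cip H x y = 0"
      by (simp add: algebra_simps)
    then show ?thesis using ne by (simp flip: of_real_power)
  qed
  \<comment> \<open>The last clause stands in for a dimension count: only zero in the eigenspace is
    orthogonal to all of the family.\<close>
  define G where "G \<mu> g \<longleftrightarrow>
      (\<forall>j<card {n. \<sigma> n = \<mu>}. g j \<in> E \<mu> \<and> (nrm H (g j) = 1 \<or> g j = \<zero>)) \<and>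
      (\<forall>i<card {n. \<sigma> n = \<mu>}. \<forall>j<card {n. \<sigma> n = \<mu>}. i \<noteq> j \<longrightarrow> cip H (g i) (g j) = 0) \<and>
      (\<forall>x\<in>E \<mu>. (\<forall>j<card {n. \<sigma> n = \<mu>}. cip H x (g j) = 0) \<longrightarrow> x = \<zero>)" for \<mu> g
  have "\<exists>g. G \<mu> g" if \<mu>: "0 < \<mu>" for \<mu>
  proof -
    let ?k = "card {n. \<sigma> n = \<mu>}"
    obtain b where basis: "is_basis_of H (E \<mu>) ?k b"
      using \<sigma> \<mu> unfolding singular_numbers_def E_def by blast
    then have bE: "b j \<in> E \<mu>" if "j < ?k" for j
      using that by (auto simp: is_basis_of_def)
    have span: "\<exists>c. x = (\<Oplus>j\<in>{..<?k}. c j \<odot> b j)" if "x \<in> E \<mu>" for x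
      using basis that unfolding is_basis_of_def by (blast dest: bspec ex1_implies_ex)
    have "\<exists>g. (\<forall>j<?k. g j \<in> E \<mu> \<and> (nrm H (g j) = 1 \<or> g j = \<zero>)) \<and>
      (\<forall>i<?k. \<forall>j<?k. i \<noteq> j \<longrightarrow> cip H (g i) (g j) = 0) \<and>
      (\<forall>x\<in>carrier H. (\<forall>j<?k. cip H x (g j) = 0) \<longrightarrow> (\<forall>j<?k. cip H x (b j) = 0))"
      by (rule gram_schmidt[OF E_sub(1,2)]) (auto intro: E_sub(3,4) bE)
    then obtain g where g: "(\<forall>j<?k. g j \<in> E \<mu> \<and> (nrm H (g j) = 1 \<or> g j = \<zero>)) \<and>
      (\<forall>i<?k. \<forall>j<?k. i \<noteq> j \<longrightarrow> cip H (g i) (g j) = 0) \<and>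
      (\<forall>x\<in>carrier H. (\<forall>j<?k. cip H x (g j) = 0) \<longrightarrow> (\<forall>j<?k. cip H x (b j) = 0))"
      by (elim exE)
    \<comment> \<open>x is a combination of the basis vectors and orthogonal to each of them, hence
      orthogonal to itself.\<close>
    have "x = \<zero>" if x: "x \<in> E \<mu>" and perp: "\<forall>j<?k. cip H x (g j) = 0" for x
    proof -
      have xC: "x \<in> carrier H" using x E_sub(1) by blast
      have bC: "b j \<in> carrier H" if "j < ?k" for j using bE[OF that] E_sub(1) by blast
      have b_perp: "cip H x (b j) = 0" if "j < ?k" for j
        using g xC perp that by blast
      have "cip H (b j) x = 0" if "j < ?k" for j
        by (rule cip_eq_0_commute[OF xC bC[OF that] b_perp[OF that]])
      moreover obtain c where c: "x = (\<Oplus>j\<in>{..<?k}. c j \<odot> b j)" using span[OF x] ..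
      ultimately have "cip H (\<Oplus>j\<in>{..<?k}. c j \<odot> b j) x = 0"
        using clinear_functional_finsum[where k = ?k and c = c and b = b,
            OF complex_normed_space_axioms clinear_map_cip[OF xC]] bC by simp
      then have "cip H x x = 0" by (simp flip: c)
      then show ?thesis using xC by (simp add: cip_self nrm_eq_0_iff)
    qed
    then show ?thesis
      using conjunct1[OF g] conjunct1[OF conjunct2[OF g]] unfolding G_def by (intro exI[of _ g] conjI) simp_all
  qed
  then have "\<forall>\<mu>. \<exists>g. 0 < \<mu> \<longrightarrow> G \<mu> g" by simp
  from choice[OF this] obtain g where "\<forall>\<mu>. 0 < \<mu> \<longrightarrow> G \<mu> (g \<mu>)" ..
  then have gE: "\<And>\<mu> j. 0 < \<mu> \<Longrightarrow> j < card {n. \<sigma> n = \<mu>} \<Longrightarrow> g \<mu> j \<in> E \<mu>"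
    and g1: "\<And>\<mu> j. 0 < \<mu> \<Longrightarrow> j < card {n. \<sigma> n = \<mu>} \<Longrightarrow> nrm H (g \<mu> j) = 1 \<or> g \<mu> j = \<zero>"
    and g_orth: "\<And>\<mu> i j. 0 < \<mu> \<Longrightarrow> i < card {n. \<sigma> n = \<mu>} \<Longrightarrow> j < card {n. \<sigma> n = \<mu>} \<Longrightarrow> i \<noteq> j \<Longrightarrow>
        cip H (g \<mu> i) (g \<mu> j) = 0"
    and g_span: "\<And>\<mu> x. 0 < \<mu> \<Longrightarrow> x \<in> E \<mu> \<Longrightarrow> \<forall>j<card {n. \<sigma> n = \<mu>}. cip H x (g \<mu> j) = 0 \<Longrightarrow> x = \<zero>"
    unfolding G_def by simp_all
  have "\<exists>f. bij_betw f {n. \<sigma> n = \<mu>} {0..<card {n. \<sigma> n = \<mu>}}" if "0 < \<mu>" for \<mu>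
    using fin[OF that] by (rule ex_bij_betw_finite_nat)
  then have "\<forall>\<mu>. \<exists>f. 0 < \<mu> \<longrightarrow> bij_betw f {n. \<sigma> n = \<mu>} {0..<card {n. \<sigma> n = \<mu>}}" by simp
  from choice[OF this] obtain idx
    where "\<forall>\<mu>. 0 < \<mu> \<longrightarrow> bij_betw (idx \<mu>) {n. \<sigma> n = \<mu>} {0..<card {n. \<sigma> n = \<mu>}}" ..
  then have idx: "\<And>\<mu>. 0 < \<mu> \<Longrightarrow> bij_betw (idx \<mu>) {n. \<sigma> n = \<mu>} {0..<card {n. \<sigma> n = \<mu>}}"
    by simp
  have idx_less: "idx (\<sigma> n) n < card {k. \<sigma> k = \<sigma> n}" if "0 < \<sigma> n" for n
    using bij_betw_apply[OF idx[OF that], of n] by simp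
  \<comment> \<open>\<open>idx\<close> numbers the positions at which \<open>\<sigma>\<close> takes
    a given value, so along these positions e runs once through the orthogonal family of that
    eigenspace.\<close>
  define e where "e n = (if 0 < \<sigma> n then g (\<sigma> n) (idx (\<sigma> n) n) else \<zero>)" for n
  have eE: "e n \<in> E (\<sigma> n)" for n
    using gE idx_less E_sub(2) by (auto simp: e_def)
  have eC: "e n \<in> carrier H" for n using eE E_sub(1) by blast
  have e1: "nrm H (e n) = 1 \<or> e n = \<zero>" for n
    using g1 idx_less by (auto simp: e_def)
  have e_orth: "cip H (e i) (e j) = 0" if "i \<noteq> j" for i j
  proof (cases "\<sigma> i = \<sigma> j")
    case False
    then have "(\<sigma> i)\<^sup>2 \<noteq> (\<sigma> j)\<^sup>2"
      using nonneg by (simp add: power2_eq_iff_nonneg)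
    then show ?thesis using E_orth eE by blast
  next
    case True
    show ?thesis
    proof (cases "0 < \<sigma> i")
      case pos: True
      have "idx (\<sigma> i) i \<noteq> idx (\<sigma> i) j"
        using bij_betw_imp_inj_on[OF idx[OF pos]] that True by (auto dest: inj_onD)
      then show ?thesis
        using g_orth[OF pos] idx_less[of i] idx_less[of j] pos True by (simp add: e_def)
    qed (use eC in \<open>simp add: e_def\<close>)
  qed
  \<comment> \<open>A value that \<open>\<sigma>\<close> never takes is included: its eigenspace has
    a basis of length 0, and the orthogonality condition is vacuous.\<close>
  have e_span: "x = \<zero>" if \<mu>: "0 < \<mu>" and x: "x \<in> E \<mu>" and perp: "\<And>n. \<sigma> n = \<mu> \<Longrightarrow> cip H x (e n) = 0" for x \<mu>
  proof (rule g_span[OF \<mu> x], intro allI impI)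
    fix j assume "j < card {n. \<sigma> n = \<mu>}"
    then have "j \<in> idx \<mu> ` {n. \<sigma> n = \<mu>}"
      using idx[OF \<mu>] by (simp add: bij_betw_def)
    then obtain n where "\<sigma> n = \<mu>" "idx \<mu> n = j" by blast
    then show "cip H x (g \<mu> j) = 0"
      using perp[of n] \<mu> by (simp add: e_def)
  qed
  have e_eigen: "cip H (U x) (U (e n)) = complex_of_real ((\<sigma> n)\<^sup>2) * cip H x (e n)"
    if "x \<in> carrier H" for n x
    using eE[of n] that by (simp add: E_iff)
  have bound: "nrm H (U x) \<le> \<sigma> N * nrm H x"
    if x: "x \<in> carrier H" and perp: "\<forall>n<N. cip H x (e n) = 0" for N x
  proof -
    define M where "M = {x \<in> carrier H. \<forall>n<N. cip H x (e n) = 0}"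
    \<comment> \<open>The norm of U on the orthogonal complement of the first N singular
      vectors.\<close>
    define \<mu> where "\<mu> = (SUP x\<in>{x\<in>M. nrm H x \<le> 1}. nrm H (U x))"
    have MC: "x \<in> carrier H" if "x \<in> M" for x using that by (simp add: M_def)
    have M0: "\<zero> \<in> M" using eC by (simp add: M_def)
    have M_smult: "c \<odot> x \<in> M" if "x \<in> M" for c x
      using that eC by (simp add: M_def cip_smult_left)
    have bdd: "bdd_above ((\<lambda>x. nrm H (U x)) ` {x\<in>M. nrm H x \<le> 1})"
    proof (rule bdd_aboveI2)
      fix x assume "x \<in> {x\<in>M. nrm H x \<le> 1}"
      then have "nrm H (U x) \<le> K * nrm H x" "K * nrm H x \<le> K"
        using K MC K0 by (auto simp: mult_left_le)
      then show "nrm H (U x) \<le> K" by simp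
    qed
    have upper: "nrm H (U x) \<le> \<mu>" if "x \<in> M" "nrm H x \<le> 1" for x
      unfolding \<mu>_def using bdd that by (intro cSUP_upper) auto
    have \<mu>0: "0 \<le> \<mu>"
      using upper[OF M0] nrm_nonneg[OF Ucl[OF M.zero_closed]] by simp
    have le_\<mu>: "nrm H (U x) \<le> \<mu> * nrm H x" if x: "x \<in> M" for x
    proof (cases "x = \<zero>")
      case True
      then show ?thesis using K[of x] by simp
    next
      case False
      then have pos: "0 < nrm H x"
        using MC[OF x] nrm_eq_0_iff[of x] nrm_nonneg[of x] by fastforce
      have "nrm H (U (complex_of_real (1 / nrm H x) \<odot> x)) \<le> \<mu>"
        using MC[OF x] pos by (intro upper M_smult x) (auto simp: nrm_smult norm_divide)
      then show ?thesis
        using MC[OF x] Ucl pos by (simp add: clinear_mapD[OF lin] nrm_smult norm_divide field_simps)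
    qed
    \<comment> \<open>Otherwise a maximising sequence has, by compactness, a subsequence converging
      to a vector of M at which the norm is attained, and this vector is an eigenvector for the
      square of \<open>\<mu>\<close>. Positions with value \<open>\<mu>\<close> all precede N, since
      \<open>\<sigma>\<close> decreases; so the vector is orthogonal to all of them and must be
      zero.\<close>
    have "\<mu> \<le> \<sigma> N"
    proof (rule ccontr)
      assume "\<not> \<mu> \<le> \<sigma> N"
      then have less: "\<sigma> N < \<mu>" and \<mu>: "0 < \<mu>" using nonneg[of N] by auto
      have "\<exists>x\<in>M. nrm H x \<le> 1 \<and> \<mu> - 1 / real (Suc k) < nrm H (U x)" for k
      proof -
        have "\<mu> - 1 / real (Suc k) < (SUP x\<in>{x\<in>M. nrm H x \<le> 1}. nrm H (U x))"
          by (simp add: \<mu>_def)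
        moreover have "\<zero> \<in> {x\<in>M. nrm H x \<le> 1}" using M0 by simp
        ultimately show ?thesis
          using less_cSUP_iff[OF _ bdd] by blast
      qed
      then obtain p where pM: "\<And>k. p k \<in> M" and p1: "\<And>k. nrm H (p k) \<le> 1"
        and p\<mu>: "\<And>k. \<mu> - 1 / real (Suc k) < nrm H (U (p k))" by metis
      note pC = MC[OF pM]
      have "(\<lambda>k. \<mu> - 1 / real (Suc k)) \<longlonglongrightarrow> \<mu> - 0"
        by (intro tendsto_intros LIMSEQ_Suc[OF lim_1_over_n])
      then have "(\<lambda>k. \<mu> - 1 / real (Suc k)) \<longlonglongrightarrow> \<mu>" by simp
      from tendsto_sandwich[OF _ _ this tendsto_const] have lim_\<mu>: "(\<lambda>k. nrm H (U (p k))) \<longlonglongrightarrow> \<mu>"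
        using less_imp_le[OF p\<mu>] upper[OF pM p1] by (simp add: eventuallyI)
      \<comment> \<open>M is invariant because the \<open>e n\<close> are eigenvectors of the
        self-adjoint product.\<close>
      have V_M: "?V (U x) \<in> M" if x: "x \<in> M" for x
      proof -
        have "cip H (?V (U x)) (e n) = 0" if n: "n < N" for n
        proof -
          have "cip H (e n) (?V (U x)) = cip H (U (e n)) (U x)"
            using V_cip[OF Ucl[OF MC[OF x]] eC] by simp
          also have "\<dots> = cnj (cip H (U x) (U (e n)))"
            using Ucl eC MC[OF x] by (intro cip_commute) auto
          also have "\<dots> = 0" using e_eigen[OF MC[OF x]] x n by (simp add: M_def)
          finally show ?thesis
            by (rule cip_eq_0_commute[OF eC V_carrier[OF Ucl[OF MC[OF x]]]])
        qed
        then show ?thesis using V_carrier[OF Ucl[OF MC[OF x]]] by (simp add: M_def)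
      qed
      \<comment> \<open>Invariance allows the sharp constant \<open>\<mu>\<close> to be applied to
        \<open>?V (U x)\<close>, which also lies in M; the general constant K would be too weak
        below.\<close>
      have V_le: "nrm H (?V (U x)) \<le> \<mu> * nrm H (U x)" if x: "x \<in> M" for x
      proof -
        let ?z = "?V (U x)"
        have zC: "?z \<in> carrier H" using V_M[OF x] MC by blast
        have "(nrm H ?z)\<^sup>2 = Re (cip H (U ?z) (U x))"
          using V_cip[OF Ucl[OF MC[OF x]] zC] zC by (simp add: nrm_square)
        also have "\<dots> \<le> nrm H (U ?z) * nrm H (U x)"
          using cauchy_schwarz[OF Ucl[OF zC] Ucl[OF MC[OF x]]] complex_Re_le_cmod order_trans by blast
        also have "\<dots> \<le> \<mu> * nrm H ?z * nrm H (U x)"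
          using le_\<mu>[OF V_M[OF x]] nrm_nonneg[OF Ucl[OF MC[OF x]]] by (rule mult_right_mono)
        finally have "nrm H ?z * nrm H ?z \<le> nrm H ?z * (\<mu> * nrm H (U x))"
          by (simp add: power2_eq_square mult_ac)
        moreover have "0 \<le> \<mu> * nrm H (U x)"
          using \<mu>0 nrm_nonneg[OF Ucl[OF MC[OF x]]] by simp
        ultimately show ?thesis
          using nrm_nonneg[OF zC] by (cases "nrm H ?z = 0") (auto simp: mult_le_cancel_left)
      qed
      \<comment> \<open>The defect of \<open>p k\<close> in the eigenvalue equation. Expanding its
        square and using the sharp constant twice bounds it by a quantity that tends to 0 with
        \<open>nrm H (U (p k))\<close> tending to \<open>\<mu>\<close>.\<close>
      define d where "d k = ?V (U (p k)) \<ominus> complex_of_real (\<mu>\<^sup>2) \<odot> p k" for k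
      have VC: "?V (U (p k)) \<in> carrier H" for k using V_M[OF pM] MC by blast
      have d_le: "(nrm H (d k))\<^sup>2 \<le> \<mu>\<^sup>2 * (\<mu>\<^sup>2 - (nrm H (U (p k)))\<^sup>2)" for k
      proof -
        let ?u = "nrm H (U (p k))"
        have "cip H (?V (U (p k))) (p k) = cnj (cip H (p k) (?V (U (p k))))"
          using pC VC by (intro cip_commute) auto
        also have "\<dots> = cnj (cip H (U (p k)) (U (p k)))"
          using V_cip[OF Ucl[OF pC] pC, of k k] by simp
        also have "\<dots> = complex_of_real (?u\<^sup>2)"
          using Ucl[OF pC, of k] by (simp add: cip_self)
        finally have "(nrm H (d k))\<^sup>2 = (nrm H (?V (U (p k))))\<^sup>2 + (\<mu>\<^sup>2 * nrm H (p k))\<^sup>2 - 2 * (\<mu>\<^sup>2 * ?u\<^sup>2)"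
          using pC VC unfolding d_def
          by (simp add: nrm_minus_square cip_smult_right nrm_smult norm_power flip: of_real_power)
        also have "(nrm H (?V (U (p k))))\<^sup>2 \<le> (\<mu> * ?u)\<^sup>2"
          using V_le[OF pM] nrm_nonneg[OF VC] by (intro power_mono) auto
        also have "(\<mu>\<^sup>2 * nrm H (p k))\<^sup>2 \<le> (\<mu>\<^sup>2)\<^sup>2"
          using p1[of k] nrm_nonneg[OF pC, of k] \<mu>0 by (intro power_mono) (auto simp: mult_left_le)
        finally show ?thesis by (simp add: power2_eq_square algebra_simps)
      qed
      have dC: "d k \<in> carrier H" for k using VC pC by (simp add: d_def)
      have "(\<lambda>k. \<mu>\<^sup>2 * (\<mu>\<^sup>2 - (nrm H (U (p k)))\<^sup>2)) \<longlonglongrightarrow> \<mu>\<^sup>2 * (\<mu>\<^sup>2 - \<mu>\<^sup>2)"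
        by (intro tendsto_intros lim_\<mu>)
      then have "(\<lambda>k. \<mu>\<^sup>2 * (\<mu>\<^sup>2 - (nrm H (U (p k)))\<^sup>2)) \<longlonglongrightarrow> 0" by simp
      from tendsto_zero_majorant[OF this _ d_le] have "(\<lambda>k. (nrm H (d k))\<^sup>2) \<longlonglongrightarrow> 0"
        by simp
      then have lim_d: "(\<lambda>k. nrm H (d k)) \<longlonglongrightarrow> 0"
        using tendsto_real_sqrt[of "\<lambda>k. (nrm H (d k))\<^sup>2" 0] dC by (simp add: nrm_nonneg)
      obtain y \<rho> where y: "y \<in> carrier H" and \<rho>: "strict_mono \<rho>"
        and lim_y: "(\<lambda>n. nrm H (U (p (\<rho> n)) \<ominus> y)) \<longlonglongrightarrow> 0"
        by (rule compact_op_subsequence[OF U pC p1])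
      \<comment> \<open>With vanishing defect, \<open>p k\<close> is close to
        \<open>?V (U (p k))\<close> divided by the square of \<open>\<mu>\<close>, and
        \<open>U (p k)\<close> converges to y along the subsequence; this identifies the
        limit.\<close>
      define x where "x = complex_of_real (1 / \<mu>\<^sup>2) \<odot> ?V y"
      have Vy: "?V y \<in> carrier H" using y by (rule V_carrier)
      have xC: "x \<in> carrier H" using Vy by (simp add: x_def)
      have V_minus: "?V a \<ominus> ?V b = ?V (a \<ominus> b)" if ab: "a \<in> carrier H" "b \<in> carrier H" for a b
        using ab V_carrier V_cip Ucl
        by (intro hadjoint_eqI[symmetric]) (auto simp: cip_minus_right)
      have x_le: "nrm H (p k \<ominus> x) \<le> 1 / \<mu>\<^sup>2 * (nrm H (d k) + K * nrm H (U (p k) \<ominus> y))" for k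
      proof -
        have *: "complex_of_real (\<mu>\<^sup>2) \<odot> (p k \<ominus> x) = complex_of_real (\<mu>\<^sup>2) \<odot> p k \<ominus> ?V y"
          using \<mu> pC xC Vy by (simp add: smult_minus_right x_def flip: smult_assoc of_real_mult)
        have "nrm H (complex_of_real (\<mu>\<^sup>2) \<odot> p k \<ominus> ?V y)
            \<le> nrm H (complex_of_real (\<mu>\<^sup>2) \<odot> p k \<ominus> ?V (U (p k))) + nrm H (?V (U (p k)) \<ominus> ?V y)"
          using pC VC Vy by (intro nrm_triangle_minus) auto
        also have "nrm H (complex_of_real (\<mu>\<^sup>2) \<odot> p k \<ominus> ?V (U (p k))) = nrm H (d k)"
          unfolding d_def using pC VC by (intro nrm_minus_commute) auto
        also have "nrm H (?V (U (p k)) \<ominus> ?V y) \<le> K * nrm H (U (p k) \<ominus> y)"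
          unfolding V_minus[OF Ucl[OF pC] y] using Ucl[OF pC] y by (intro V_nrm) auto
        finally have "nrm H (complex_of_real (\<mu>\<^sup>2) \<odot> (p k \<ominus> x)) \<le> nrm H (d k) + K * nrm H (U (p k) \<ominus> y)"
          by (simp only: *)
        then show ?thesis
          using \<mu> pC xC by (simp add: nrm_smult norm_power field_simps)
      qed
      have "(\<lambda>k. 1 / \<mu>\<^sup>2 * (nrm H (d (\<rho> k)) + K * nrm H (U (p (\<rho> k)) \<ominus> y))) \<longlonglongrightarrow> 1 / \<mu>\<^sup>2 * (0 + K * 0)"
        using LIMSEQ_subseq_LIMSEQ[OF lim_d \<rho>] lim_y by (intro tendsto_intros) (simp_all add: o_def)
      then have "(\<lambda>k. 1 / \<mu>\<^sup>2 * (nrm H (d (\<rho> k)) + K * nrm H (U (p (\<rho> k)) \<ominus> y))) \<longlonglongrightarrow> 0" by simp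
      from tendsto_zero_majorant[OF this _ x_le] have lim_x: "(\<lambda>k. nrm H (p (\<rho> k) \<ominus> x)) \<longlonglongrightarrow> 0"
        using pC xC by (simp add: nrm_nonneg)
      have Kx: "(\<lambda>k. c * nrm H (p (\<rho> k) \<ominus> x)) \<longlonglongrightarrow> 0" for c
        using tendsto_mult_right_zero[OF lim_x] .
      have U_diff: "U (p k) \<ominus> U x = U (p k \<ominus> x)" for k
        using clinear_map_minus[OF complex_normed_space_axioms complex_normed_space_axioms lin pC xC] by simp
      have "(\<lambda>k. nrm H (U (p (\<rho> k))) - nrm H (U x)) \<longlonglongrightarrow> 0"
      proof (rule Lim_null_comparison[OF _ Kx[of K]])
        have "norm (nrm H (U (p k)) - nrm H (U x)) \<le> K * nrm H (p k \<ominus> x)" for k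
          using nrm_diff_le[OF Ucl[OF pC] Ucl[OF xC], of k] K[of "p k \<ominus> x"] pC xC by (simp add: U_diff)
        then show "eventually (\<lambda>k. norm (nrm H (U (p (\<rho> k))) - nrm H (U x)) \<le> K * nrm H (p (\<rho> k) \<ominus> x)) sequentially"
          by simp
      qed
      then have "(\<lambda>k. nrm H (U (p (\<rho> k)))) \<longlonglongrightarrow> nrm H (U x)"
        by (simp add: Lim_null[symmetric])
      moreover have "(\<lambda>k. nrm H (U (p (\<rho> k)))) \<longlonglongrightarrow> \<mu>"
        using LIMSEQ_subseq_LIMSEQ[OF lim_\<mu> \<rho>] by (simp add: o_def)
      ultimately have Ux: "nrm H (U x) = \<mu>" using LIMSEQ_unique by blast
      have "cip H x (e n) = 0" if n: "n < N" for n
      proof -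
        have "cmod (cip H x (e n)) \<le> 1 * nrm H (p k \<ominus> x)" for k
        proof -
          have "cip H (x \<ominus> p k) (e n) = cip H x (e n)"
            using pM[of k] n xC eC by (simp add: M_def cip_minus_left)
          then have "cmod (cip H x (e n)) \<le> nrm H (p k \<ominus> x) * nrm H (e n)"
            using cauchy_schwarz[of "x \<ominus> p k" "e n"] xC pC eC by (simp add: nrm_minus_commute)
          then show ?thesis using e1[of n] nrm_nonneg[of "p k \<ominus> x"] pC xC by auto
        qed
        then have "cmod (cip H x (e n)) \<le> 0"
          using LIMSEQ_le_const[OF Kx[of 1]] by blast
        then show ?thesis by simp
      qed
      then have xM: "x \<in> M" using xC by (simp add: M_def)
      have "x \<in> E \<mu>"
      proof -
        \<comment> \<open>The eigenvalue equation passes to the limit: both terms of the bound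
          vanish along the subsequence.\<close>
        have "nrm H (?V (U x) \<ominus> complex_of_real (\<mu>\<^sup>2) \<odot> x)
            \<le> nrm H (d k) + (K * K + \<mu>\<^sup>2) * nrm H (p k \<ominus> x)" for k
        proof -
          let ?m = "complex_of_real (\<mu>\<^sup>2)"
          have C: "?V (U x) \<in> carrier H" "?m \<odot> x \<in> carrier H" "?m \<odot> p k \<in> carrier H"
            using V_carrier Ucl xC pC by auto
          have "nrm H (?V (U x) \<ominus> ?m \<odot> x) \<le> nrm H (?V (U x) \<ominus> ?V (U (p k))) + nrm H (?V (U (p k)) \<ominus> ?m \<odot> x)"
            using C VC by (intro nrm_triangle_minus) auto
          also have "nrm H (?V (U (p k)) \<ominus> ?m \<odot> x) \<le> nrm H (d k) + nrm H (?m \<odot> p k \<ominus> ?m \<odot> x)"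
            unfolding d_def using C VC by (intro nrm_triangle_minus) auto
          also have "nrm H (?m \<odot> p k \<ominus> ?m \<odot> x) = \<mu>\<^sup>2 * nrm H (p k \<ominus> x)"
            using xC pC by (simp add: nrm_smult norm_power flip: smult_minus_right)
          also have "nrm H (?V (U x) \<ominus> ?V (U (p k))) \<le> K * nrm H (U (p k) \<ominus> U x)"
            unfolding V_minus[OF Ucl[OF xC] Ucl[OF pC]]
            using V_nrm[of "U x \<ominus> U (p k)"] Ucl[OF pC, of k] Ucl[OF xC] by (simp add: nrm_minus_commute)
          also have "\<dots> \<le> K * (K * nrm H (p k \<ominus> x))"
            unfolding U_diff using K[of "p k \<ominus> x"] pC xC K0 by (intro mult_left_mono) auto
          finally show ?thesis by (simp add: algebra_simps)
        qed
        moreover have "(\<lambda>k. nrm H (d (\<rho> k)) + (K * K + \<mu>\<^sup>2) * nrm H (p (\<rho> k) \<ominus> x)) \<longlonglongrightarrow> 0 + 0"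
          using LIMSEQ_subseq_LIMSEQ[OF lim_d \<rho>] Kx by (intro tendsto_add) (simp_all add: o_def)
        ultimately have "nrm H (?V (U x) \<ominus> complex_of_real (\<mu>\<^sup>2) \<odot> x) \<le> 0 + 0"
          using LIMSEQ_le_const by blast
        then have "nrm H (?V (U x) \<ominus> complex_of_real (\<mu>\<^sup>2) \<odot> x) = 0"
          using nrm_nonneg[of "?V (U x) \<ominus> complex_of_real (\<mu>\<^sup>2) \<odot> x"] V_carrier Ucl xC by simp
        then show ?thesis
          using V_carrier[OF Ucl[OF xC]] xC by (simp add: E_def nrm_eq_0_iff minus_eq_zero_iff)
      qed
      moreover have "cip H x (e n) = 0" if "\<sigma> n = \<mu>" for n
      proof -
        have "n < N"
          using less that dec by (metis decseq_def linorder_not_less)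
        then show ?thesis using xM by (simp add: M_def)
      qed
      ultimately have "x = \<zero>" using e_span[OF \<mu>] by blast
      then show False
        using Ux K[of \<zero>] \<mu> by simp
    qed
    then have "\<mu> * nrm H x \<le> \<sigma> N * nrm H x"
      using x nrm_nonneg by (intro mult_right_mono) auto
    moreover have "x \<in> M" using x perp by (simp add: M_def)
    ultimately show ?thesis using le_\<mu>[of x] by simp
  qed
  show thesis
    using that[of e] eC e1 e_orth e_eigen bound nonneg by (simp add: e_def)
qed

end

section \<open>Expansions of factorable operators\<close>

text \<open>Duality: evaluating the functional at the combination w with coefficients
  \<open>cnj (\<eta> (f n))\<close> returns the square sum S, whereas w has norm at most the square
  root of S.\<close>

lemma bounded_linear_combination:
  fixes N :: nat
  assumes H: "complex_hilbert_space H" and B: "clinear_map H complex_line \<eta>"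
    and K: "0 \<le> K" "\<And>x. x \<in> carrier H \<Longrightarrow> cmod (\<eta> x) \<le> K * nrm H x"
    and f: "\<And>n. f n \<in> carrier H" "\<And>n. nrm H (f n) \<le> 1" "\<And>i j. i \<noteq> j \<Longrightarrow> cip H (f i) (f j) = 0"
  shows "(\<Sum>n<N. (cmod (\<eta> (f n)))\<^sup>2) \<le> K\<^sup>2"
proof -
  interpret H: complex_hilbert_space H by fact
  define S where "S = (\<Sum>n<N. (cmod (\<eta> (f n)))\<^sup>2)"
  have S0: "0 \<le> S" by (simp add: S_def sum_nonneg)
  obtain w where w: "w \<in> carrier H"
    "\<And>h. clinear_map H complex_line h \<Longrightarrow> h w = (\<Sum>n<N. cnj (\<eta> (f n)) * h (f n))"
    using linear_combination_exists[OF H.complex_normed_space_axioms, of "carrier H" N f "\<lambda>n. cnj (\<eta> (f n))"] f(1)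
    by auto
  have \<eta>w: "\<eta> w = complex_of_real S"
    unfolding w(2)[OF B] S_def of_real_sum
    by (intro sum.cong) (auto simp: complex_norm_square[symmetric] mult.commute)
  have cip_w: "cip H w x = (\<Sum>n<N. cnj (\<eta> (f n)) * cip H (f n) x)" if "x \<in> carrier H" for x
    using w(2)[OF H.clinear_map_cip[OF that]] .
  have "cip H (f i) w = \<eta> (f i) * complex_of_real ((nrm H (f i))\<^sup>2)" if i: "i < N" for i
  proof -
    have "cip H w (f i) = (\<Sum>n<N. if n = i then cnj (\<eta> (f i)) * cip H (f i) (f i) else 0)"
      unfolding cip_w[OF f(1)] using f(3) by (intro sum.cong) auto
    also have "\<dots> = cnj (\<eta> (f i)) * complex_of_real ((nrm H (f i))\<^sup>2)"
      using i f(1) by (simp add: H.cip_self)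
    finally show ?thesis
      using H.cip_commute[OF w(1) f(1), of i] by simp
  qed
  then have "cip H w w = (\<Sum>n<N. complex_of_real ((cmod (\<eta> (f n)))\<^sup>2 * (nrm H (f n))\<^sup>2))"
    unfolding cip_w[OF w(1)] by (intro sum.cong) (auto simp: complex_norm_square[symmetric] mult_ac)
  then have "(nrm H w)\<^sup>2 = (\<Sum>n<N. (cmod (\<eta> (f n)))\<^sup>2 * (nrm H (f n))\<^sup>2)"
    using w(1) by (simp add: H.nrm_square)
  also have "\<dots> \<le> S"
    unfolding S_def using f(1,2) H.nrm_nonneg
    by (intro sum_mono) (auto intro!: mult_left_le power_le_one)
  finally have nw: "nrm H w \<le> sqrt S"
    by (rule real_le_rsqrt)
  have "S \<le> K * nrm H w"
    using K(2)[OF w(1)] S0 by (simp add: \<eta>w)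
  also have "\<dots> \<le> K * sqrt S"
    using nw K(1) by (rule mult_left_mono)
  finally have *: "sqrt S * sqrt S \<le> K * sqrt S" using S0 by simp
  have "sqrt S \<le> K"
  proof (cases "S = 0")
    case False
    then have "0 < sqrt S" using S0 by simp
    with * show ?thesis by (rule mult_right_le_imp_le)
  qed (use K(1) in simp)
  then show ?thesis
    unfolding S_def[symmetric] using S0 by (simp add: sqrt_le_D)
qed

text \<open>A weak Schmidt expansion. The square-sum bounds say that the functionals map X boundedly
  into l^2 and, dually, that the vectors map l^2 boundedly into Y; the series is asserted only after
  a functional of norm at most 1 has been applied.\<close>

definition lorentz_expansion ::
    "real \<Rightarrow> real \<Rightarrow> ('a, 'e) normed_scheme \<Rightarrow> ('b, 'f) normed_scheme \<Rightarrow> ('a \<Rightarrow> 'b) \<Rightarrow>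
      (nat \<Rightarrow> real) \<Rightarrow> (nat \<Rightarrow> 'a \<Rightarrow> complex) \<Rightarrow> (nat \<Rightarrow> 'b) \<Rightarrow> real \<Rightarrow> bool" where
  "lorentz_expansion r s X Y T \<sigma> a y C \<longleftrightarrow>
     decseq \<sigma> \<and> (\<forall>n. 0 \<le> \<sigma> n) \<and> \<sigma> \<longlonglongrightarrow> 0 \<and>
     summable (\<lambda>n. real (Suc n) powr (s / r - 1) * \<sigma> n powr s) \<and> 0 < C \<and>
     (\<forall>n. clinear_map X complex_line (a n)) \<and> (\<forall>n. y n \<in> carrier Y) \<and>
     (\<forall>x\<in>carrier X. \<forall>N. (\<Sum>n<N. (cmod (a n x))\<^sup>2) \<le> (C * nrm X x)\<^sup>2) \<and>
     (\<forall>\<phi>. clinear_map Y complex_line \<phi> \<longrightarrow> (\<forall>y\<in>carrier Y. cmod (\<phi> y) \<le> nrm Y y) \<longrightarrow>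
        (\<forall>N. (\<Sum>n<N. (cmod (\<phi> (y n)))\<^sup>2) \<le> C\<^sup>2) \<and>
        (\<forall>x\<in>carrier X. (\<lambda>n. complex_of_real (\<sigma> n) * a n x * \<phi> (y n)) sums \<phi> (T x)))"

text \<open>A and B are absorbed into the right and left singular vectors of U. After N terms the
  remaining vector is orthogonal to the first N right singular vectors, so U shrinks it by the
  factor \<open>\<sigma> N\<close>, which tends to 0.\<close>

lemma factors_lorentz_schatten_expansion:
  fixes X :: "'a normed" and Y :: "'b normed"
  assumes X: "complex_normed_space X" and Y: "complex_normed_space Y"
    and r: "0 < r" and s: "0 < s"
    and fac: "factors_lorentz_schatten TYPE('h) r s X Y T"
  shows "\<exists>\<sigma> a y C. lorentz_expansion r s X Y T \<sigma> a y C"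
proof -
  obtain H :: "'h inner_normed" and U A B where H: "complex_hilbert_space H"
    and U: "U \<in> lorentz_schatten r s H" and A: "bounded_op X H A" and B: "bounded_op H Y B"
    and T: "\<And>x. x \<in> carrier X \<Longrightarrow> T x = B (U (A x))"
    using fac unfolding factors_lorentz_schatten_def by blast
  interpret X: complex_normed_space X by fact
  interpret Y: complex_normed_space Y by fact
  interpret H: complex_hilbert_space H by fact
  obtain \<sigma> where cU: "compact_op H H U" and \<sigma>: "singular_numbers H U \<sigma>"
    and summ: "summable (\<lambda>n. real (Suc n) powr (s / r - 1) * \<sigma> n powr s)"
    using U by (auto simp: lorentz_schatten_def)
  have dec: "decseq \<sigma>" and nonneg: "\<And>n. 0 \<le> \<sigma> n"
    using \<sigma> by (auto simp: singular_numbers_def)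
  have null: "\<sigma> \<longlonglongrightarrow> 0"
    using s r dec nonneg summ by (rule lorentz_summable_imp_tendsto_zero)
  obtain KA where KA0: "0 \<le> KA" and linA: "clinear_map X H A"
    and KA: "\<And>x. x \<in> carrier X \<Longrightarrow> nrm H (A x) \<le> KA * nrm X x"
    using X A by (rule bounded_opE) (rule that; assumption)
  obtain KB where KB0: "0 \<le> KB" and linB: "clinear_map H Y B"
    and KB: "\<And>x. x \<in> carrier H \<Longrightarrow> nrm Y (B x) \<le> KB * nrm H x"
    using H.complex_normed_space_axioms B by (rule bounded_opE) (rule that; assumption)
  have linU: "clinear_map H H U" using cU by (simp add: compact_op_def)
  note Acl = clinear_mapD(1)[OF linA] and Bcl = clinear_mapD(1)[OF linB] and Ucl = clinear_mapD(1)[OF linU]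
  obtain e where eC: "\<And>n. e n \<in> carrier H" and e1: "\<And>n. nrm H (e n) = 1 \<or> e n = \<zero>\<^bsub>H\<^esub>"
    and e_orth: "\<And>i j. i \<noteq> j \<Longrightarrow> cip H (e i) (e j) = 0"
    and e0: "\<And>n. \<sigma> n = 0 \<Longrightarrow> e n = \<zero>\<^bsub>H\<^esub>"
    and eig: "\<And>n x. x \<in> carrier H \<Longrightarrow> cip H (U x) (U (e n)) = complex_of_real ((\<sigma> n)\<^sup>2) * cip H x (e n)"
    and tail: "\<And>N x. x \<in> carrier H \<Longrightarrow> \<forall>n<N. cip H x (e n) = 0 \<Longrightarrow> nrm H (U x) \<le> \<sigma> N * nrm H x"
    using cU \<sigma> by (rule H.singular_vectors) (rule that; assumption)
  define a where "a n x = cip H (A x) (e n)" for n x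
  \<comment> \<open>The left singular vectors. Division by zero yields 0, so \<open>f n\<close>
    vanishes where \<open>\<sigma> n\<close> does.\<close>
  define f where "f n = complex_of_real (1 / \<sigma> n) \<odot>\<^bsub>H\<^esub> U (e n)" for n
  define y where "y n = B (f n)" for n
  \<comment> \<open>One constant for both square-sum bounds; the maximum with 1 makes it
    positive.\<close>
  define C where "C = max 1 (max KA KB)"
  have C0: "0 < C" "KA \<le> C" "KB \<le> C" by (auto simp: C_def)
  have UeC: "U (e n) \<in> carrier H" for n by (rule Ucl[OF eC])
  have fC: "f n \<in> carrier H" for n by (simp add: f_def UeC)
  have yC: "y n \<in> carrier Y" for n by (simp add: y_def Bcl fC)
  have f_orth: "cip H (f i) (f j) = 0" if "i \<noteq> j" for i j
    using UeC that by (simp add: f_def H.cip_smult_left H.cip_smult_right eig eC e_orth)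
  have f1: "nrm H (f n) \<le> 1" for n
  proof (cases "\<sigma> n = 0")
    case True
    then show ?thesis using UeC by (simp add: f_def)
  next
    case False
    then have pos: "0 < \<sigma> n" using nonneg[of n] by simp
    have "(nrm H (U (e n)))\<^sup>2 = Re (complex_of_real ((\<sigma> n)\<^sup>2) * cip H (e n) (e n))"
      unfolding H.nrm_square[OF UeC] eig[OF eC] ..
    also have "\<dots> = (\<sigma> n)\<^sup>2 * (nrm H (e n))\<^sup>2"
      unfolding H.cip_self[OF eC] of_real_mult[symmetric] by (rule Re_complex_of_real)
    also have "\<dots> \<le> (\<sigma> n)\<^sup>2"
      using e1[of n] by auto
    finally have "nrm H (U (e n)) \<le> \<sigma> n"
      using nonneg by (rule power2_le_imp_le)
    then show ?thesis
      using pos UeC by (simp add: f_def H.nrm_smult norm_divide)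
  qed
  have lin_a: "clinear_map X complex_line (a n)" for n
    unfolding a_def using clinear_map_compose[OF linA H.clinear_map_cip[OF eC]] .
  have bessel: "(\<Sum>n<N. (cmod (a n x))\<^sup>2) \<le> (C * nrm X x)\<^sup>2" if x: "x \<in> carrier X" for x N
  proof -
    obtain w where "w \<in> carrier H" and w:
      "(nrm H (A x \<ominus>\<^bsub>H\<^esub> w))\<^sup>2 = (nrm H (A x))\<^sup>2 - (\<Sum>n<N. (cmod (cip H (A x) (e n)))\<^sup>2)"
      by (rule H.bessel[where x = "A x" and e = e and N = N, OF Acl[OF x] eC e1]) (rule e_orth that; assumption)+
    then have "(\<Sum>n<N. (cmod (a n x))\<^sup>2) \<le> (nrm H (A x))\<^sup>2"
      unfolding a_def using zero_le_power2[of "nrm H (A x \<ominus>\<^bsub>H\<^esub> w)"] by simp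
    also have "\<dots> \<le> (C * nrm X x)\<^sup>2"
      using order_trans[OF KA[OF x] mult_right_mono[OF C0(2) X.nrm_nonneg[OF x]]]
        H.nrm_nonneg[OF Acl[OF x]] by (rule power_mono)
    finally show ?thesis .
  qed
  have linB\<phi>: "clinear_map H complex_line (\<lambda>h. \<phi> (B h))" if "\<phi> \<in> dual_ball Y" for \<phi>
    using that linB by (auto simp: dual_ball_def intro: clinear_map_compose)
  have \<phi>B: "cmod (\<phi> (B h)) \<le> KB * nrm H h" if "\<phi> \<in> dual_ball Y" "h \<in> carrier H" for \<phi> h
  proof -
    have "cmod (\<phi> (B h)) \<le> nrm Y (B h)"
      using that Bcl by (simp add: dual_ball_def)
    also have "\<dots> \<le> KB * nrm H h" using KB that by simp
    finally show ?thesis .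
  qed
  have dual: "(\<Sum>n<N. (cmod (\<phi> (y n)))\<^sup>2) \<le> C\<^sup>2" if "\<phi> \<in> dual_ball Y" for \<phi> N
  proof -
    have "(\<Sum>n<N. (cmod (\<phi> (B (f n))))\<^sup>2) \<le> KB\<^sup>2"
      using H linB\<phi>[OF that] KB0 \<phi>B[OF that] fC f1 f_orth by (rule bounded_linear_combination)
    also have "\<dots> \<le> C\<^sup>2" using C0 KB0 by (intro power_mono) auto
    finally show ?thesis by (simp add: y_def)
  qed
  have expand: "(\<lambda>n. complex_of_real (\<sigma> n) * a n x * \<phi> (y n)) sums \<phi> (T x)"
    if \<phi>: "\<phi> \<in> dual_ball Y" and x: "x \<in> carrier X" for \<phi> x
  proof -
    let ?h = "A x"
    have hC: "?h \<in> carrier H" by (rule Acl[OF x])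
    let ?\<psi> = "\<lambda>h. \<phi> (B (U h))"
    have lin\<psi>: "clinear_map H complex_line ?\<psi>"
      using clinear_map_compose[OF linU linB\<phi>[OF \<phi>]] .
    have coeff: "?\<psi> (e n) = complex_of_real (\<sigma> n) * \<phi> (y n)" for n
    proof (cases "\<sigma> n = 0")
      case True
      then show ?thesis
        using clinear_mapD(3)[OF lin\<psi> H.M.zero_closed, of 0] by (simp add: e0)
    next
      case False
      then have "U (e n) = complex_of_real (\<sigma> n) \<odot>\<^bsub>H\<^esub> f n"
        using UeC by (simp add: f_def flip: H.smult_assoc of_real_mult)
      then show ?thesis
        using clinear_mapD(3)[OF linB\<phi>[OF \<phi>] fC] by (simp add: y_def)
    qed
    have "cmod ((\<Sum>n<N. complex_of_real (\<sigma> n) * a n x * \<phi> (y n)) - \<phi> (T x)) \<le> KB * nrm H ?h * \<sigma> N" for N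
    proof -
      \<comment> \<open>The partial sum of the expansion is the image of the projection w, so the
        error is the image of the part of \<open>?h\<close> orthogonal to the first N
        vectors.\<close>
      obtain w where wC: "w \<in> carrier H"
        and w: "\<And>h. clinear_map H complex_line h \<Longrightarrow> h w = (\<Sum>n<N. cip H ?h (e n) * h (e n))"
        and perp: "\<And>n. n < N \<Longrightarrow> cip H (?h \<ominus>\<^bsub>H\<^esub> w) (e n) = 0"
        and sq: "(nrm H (?h \<ominus>\<^bsub>H\<^esub> w))\<^sup>2 = (nrm H ?h)\<^sup>2 - (\<Sum>n<N. (cmod (cip H ?h (e n)))\<^sup>2)"
        by (rule H.bessel[where x = ?h and e = e and N = N, OF hC eC e1]) (rule e_orth that; assumption)+
      have dC: "?h \<ominus>\<^bsub>H\<^esub> w \<in> carrier H" using hC wC by simp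
      have "(nrm H (?h \<ominus>\<^bsub>H\<^esub> w))\<^sup>2 \<le> (nrm H ?h)\<^sup>2"
        unfolding sq by (simp add: sum_nonneg)
      then have d_le: "nrm H (?h \<ominus>\<^bsub>H\<^esub> w) \<le> nrm H ?h"
        using H.nrm_nonneg[OF hC] by (rule power2_le_imp_le)
      have "(\<Sum>n<N. complex_of_real (\<sigma> n) * a n x * \<phi> (y n)) = ?\<psi> w"
        unfolding w[OF lin\<psi>] coeff a_def by (simp add: mult_ac)
      moreover have "\<phi> (T x) - ?\<psi> w = ?\<psi> (?h \<ominus>\<^bsub>H\<^esub> w)"
        using clinear_mapD(2)[OF lin\<psi> dC wC] hC wC by (simp add: T[OF x] H.minus_add_cancel)
      ultimately have "cmod ((\<Sum>n<N. complex_of_real (\<sigma> n) * a n x * \<phi> (y n)) - \<phi> (T x)) = cmod (?\<psi> (?h \<ominus>\<^bsub>H\<^esub> w))"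
        by (metis norm_minus_commute)
      also have "\<dots> \<le> KB * nrm H (U (?h \<ominus>\<^bsub>H\<^esub> w))"
        using \<phi>B[OF \<phi> Ucl[OF dC]] .
      also have "\<dots> \<le> KB * (\<sigma> N * nrm H (?h \<ominus>\<^bsub>H\<^esub> w))"
        using tail[OF dC, of N] perp KB0 by (intro mult_left_mono) auto
      also have "\<dots> \<le> KB * (\<sigma> N * nrm H ?h)"
        using d_le KB0 nonneg by (intro mult_left_mono) auto
      finally show ?thesis by (simp add: mult_ac)
    qed
    then have "(\<lambda>N. (\<Sum>n<N. complex_of_real (\<sigma> n) * a n x * \<phi> (y n)) - \<phi> (T x)) \<longlonglongrightarrow> 0"
      by (intro Lim_null_comparison[OF _ tendsto_mult_right_zero[OF null]] always_eventually allI)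
    then show ?thesis
      by (simp add: sums_def Lim_null[symmetric])
  qed
  show ?thesis
    using dec nonneg null summ C0(1) lin_a yC bessel dual expand
    by (intro exI[of _ \<sigma>] exI[of _ a] exI[of _ y] exI[of _ C]) (simp add: lorentz_expansion_def dual_ball_def)
qed

section \<open>Diagonal operators on \<open>\<ell>\<^sup>2\<close>\<close>

definition ell2 :: "(nat \<Rightarrow> complex) inner_normed" where
  "ell2 = \<lparr>carrier = {x. summable (\<lambda>n. (cmod (x n))\<^sup>2)}, mult = undefined, one = undefined,
     zero = (\<lambda>_. 0), add = (\<lambda>x y n. x n + y n), smult = (\<lambda>c x n. c * x n),
     nrm = (\<lambda>x. sqrt (\<Sum>n. (cmod (x n))\<^sup>2)), cip = (\<lambda>x y. \<Sum>n. x n * cnj (y n))\<rparr>"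

lemma ell2_simps [simp]:
  "x \<in> carrier ell2 \<longleftrightarrow> summable (\<lambda>n. (cmod (x n))\<^sup>2)"
  "\<zero>\<^bsub>ell2\<^esub> = (\<lambda>_. 0)" "x \<oplus>\<^bsub>ell2\<^esub> y = (\<lambda>n. x n + y n)" "c \<odot>\<^bsub>ell2\<^esub> x = (\<lambda>n. c * x n)"
  "nrm ell2 x = sqrt (\<Sum>n. (cmod (x n))\<^sup>2)" "cip ell2 x y = (\<Sum>n. x n * cnj (y n))"
  by (simp_all add: ell2_def)

lemma ell2_boundedI:
  assumes "0 \<le> B" "\<And>N. (\<Sum>n<N. (cmod (x n))\<^sup>2) \<le> B\<^sup>2"
  shows "x \<in> carrier ell2" "nrm ell2 x \<le> B"
proof -
  show "x \<in> carrier ell2"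
    using summableI_nonneg_bounded[OF _ assms(2)] by simp
  then have "(\<Sum>n. (cmod (x n))\<^sup>2) \<le> B\<^sup>2"
    using assms(2) by (intro suminf_le_const) auto
  then show "nrm ell2 x \<le> B"
    using assms(1) by (simp add: real_le_lsqrt suminf_nonneg)
qed

lemma ell2_partial_sum_le:
  "x \<in> carrier ell2 \<Longrightarrow> (\<Sum>n<N. (cmod (x n))\<^sup>2) \<le> (nrm ell2 x)\<^sup>2"
  by (simp add: suminf_nonneg sum_le_suminf)

lemma ell2_nrm_nonneg: "x \<in> carrier ell2 \<Longrightarrow> 0 \<le> nrm ell2 x"
  by (simp add: suminf_nonneg)

lemma ell2_coord_le:
  assumes x: "x \<in> carrier ell2"
  shows "cmod (x n) \<le> nrm ell2 x"
proof (rule power2_le_imp_le[OF _ ell2_nrm_nonneg[OF x]])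
  from x have "(\<Sum>n<Suc n. (cmod (x n))\<^sup>2) \<le> (nrm ell2 x)\<^sup>2"
    by (rule ell2_partial_sum_le)
  then show "(cmod (x n))\<^sup>2 \<le> (nrm ell2 x)\<^sup>2"
    using sum_nonneg[of "{..<n}" "\<lambda>n. (cmod (x n))\<^sup>2"] by (simp del: ell2_simps)
qed

text \<open>Minkowski's inequality on finite sections yields membership and the norm bound at
  once.\<close>

lemma ell2_add:
  assumes x: "x \<in> carrier ell2" and y: "y \<in> carrier ell2"
  shows "(\<lambda>n. x n + y n) \<in> carrier ell2 \<and> nrm ell2 (\<lambda>n. x n + y n) \<le> nrm ell2 x + nrm ell2 y"
proof -
  have le: "(\<Sum>n<N. (cmod (x n + y n))\<^sup>2) \<le> (nrm ell2 x + nrm ell2 y)\<^sup>2" for N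
  proof -
    have *: "L2_set (\<lambda>n. cmod (z n)) {..<N} \<le> nrm ell2 z" if "z \<in> carrier ell2" for z
      unfolding L2_set_def using ell2_partial_sum_le[OF that] ell2_nrm_nonneg[OF that]
      by (intro real_le_lsqrt) (auto intro: sum_nonneg)
    have "L2_set (\<lambda>n. cmod (x n + y n)) {..<N} \<le> L2_set (\<lambda>n. cmod (x n) + cmod (y n)) {..<N}"
      by (intro L2_set_mono) (auto simp: norm_triangle_ineq)
    also have "\<dots> \<le> nrm ell2 x + nrm ell2 y"
      using L2_set_triangle_ineq[of "\<lambda>n. cmod (x n)" "\<lambda>n. cmod (y n)" "{..<N}"] *[OF x] *[OF y] by linarith
    finally show ?thesis
      unfolding L2_set_def by (rule sqrt_le_D)
  qed
  show ?thesis
    using ell2_boundedI[OF _ le] ell2_nrm_nonneg[OF x] ell2_nrm_nonneg[OF y] by simp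
qed

lemma ell2_smult:
  assumes "x \<in> carrier ell2"
  shows "(\<lambda>n. c * x n) \<in> carrier ell2 \<and> nrm ell2 (\<lambda>n. c * x n) = cmod c * nrm ell2 x"
  using assms suminf_mult[of "\<lambda>n. (cmod (x n))\<^sup>2" "(cmod c)\<^sup>2"]
  by (simp add: norm_mult power_mult_distrib summable_mult real_sqrt_mult)

lemma ell2_summable_cip:
  assumes "x \<in> carrier ell2" "y \<in> carrier ell2"
  shows "summable (\<lambda>n. x n * cnj (y n))"
proof (rule summable_comparison_test')
  show "summable (\<lambda>n. (cmod (x n))\<^sup>2 + (cmod (y n))\<^sup>2)"
    using assms by (simp add: summable_add)
  fix n
  show "norm (x n * cnj (y n)) \<le> (cmod (x n))\<^sup>2 + (cmod (y n))\<^sup>2"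
    using sum_squares_bound[of "cmod (x n)" "cmod (y n)"] mult_nonneg_nonneg[of "cmod (x n)" "cmod (y n)"]
    by (simp add: norm_mult del: mult_nonneg_nonneg)
qed

lemma ell2_normed_space: "complex_normed_space ell2"
proof -
  have grp: "abelian_group ell2"
  proof (rule abelian_groupI)
    show "\<exists>y\<in>carrier ell2. y \<oplus>\<^bsub>ell2\<^esub> x = \<zero>\<^bsub>ell2\<^esub>" if "x \<in> carrier ell2" for x
      using that by (intro bexI[of _ "\<lambda>n. - x n"]) auto
  qed (use ell2_add in \<open>auto simp: algebra_simps\<close>)
  have "module complex_line ell2"
    by (rule moduleI[OF cring_complex_line grp]) (use ell2_smult in \<open>auto simp: algebra_simps\<close>)
  then show ?thesis
  proof (rule complex_normed_space.intro, unfold_locales)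
    fix x c assume x: "x \<in> carrier ell2"
    show "0 \<le> nrm ell2 x" by (rule ell2_nrm_nonneg[OF x])
    show "nrm ell2 x = 0 \<longleftrightarrow> x = \<zero>\<^bsub>ell2\<^esub>"
    proof
      assume "nrm ell2 x = 0"
      then have "cmod (x n) = 0" for n
        using ell2_coord_le[OF x, of n] by simp
      then show "x = \<zero>\<^bsub>ell2\<^esub>" by auto
    qed simp
    show "nrm ell2 (c \<odot>\<^bsub>ell2\<^esub> x) = cmod c * nrm ell2 x"
      using ell2_smult[OF x] by (simp del: ell2_simps(5))
  next
    fix x y assume "x \<in> carrier ell2" "y \<in> carrier ell2"
    then show "nrm ell2 (x \<oplus>\<^bsub>ell2\<^esub> y) \<le> nrm ell2 x + nrm ell2 y"
      using ell2_add by (simp del: ell2_simps(5))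
  qed
qed

lemma ell2_minus:
  assumes "x \<in> carrier ell2" "y \<in> carrier ell2"
  shows "x \<ominus>\<^bsub>ell2\<^esub> y = (\<lambda>n. x n - y n)"
proof -
  interpret complex_normed_space ell2 by (rule ell2_normed_space)
  show ?thesis
    unfolding M.minus_eq uminus_eq_smult[OF assms(2)] by simp
qed

text \<open>Coordinates of a Cauchy sequence converge. The Cauchy estimate on a finite section
  survives the limit in the second index and is uniform in the length of the section.\<close>

lemma ell2_complete: "Metric_space.mcomplete (carrier ell2) (ndist ell2)"
proof -
  interpret complex_normed_space ell2 by (rule ell2_normed_space)
  show ?thesis
    unfolding complete_iff
  proof (intro allI impI)
    fix p assume "ncauchy ell2 p"
    note p = this[unfolded ncauchy_iff]
    have pC: "\<And>k. p k \<in> carrier ell2"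
      using p by blast
    have cauchy: "\<exists>N. \<forall>k\<ge>N. \<forall>l\<ge>N. nrm ell2 (\<lambda>n. p k n - p l n) < e" if "0 < e" for e
      using conjunct2[OF p, rule_format, OF that] unfolding ell2_minus[OF pC pC] .
    have dC: "(\<lambda>n. p k n - p l n) \<in> carrier ell2" for k l
      using M.minus_closed[OF pC pC, of k l] by (simp only: ell2_minus[OF pC pC])
    have "Cauchy (\<lambda>k. p k n)" for n
      unfolding Cauchy_iff
    proof (intro allI impI)
      fix e :: real assume "0 < e"
      from cauchy[OF this] obtain N where "\<forall>k\<ge>N. \<forall>l\<ge>N. nrm ell2 (\<lambda>n. p k n - p l n) < e" ..
      then show "\<exists>N. \<forall>k\<ge>N. \<forall>l\<ge>N. norm (p k n - p l n) < e"
        using le_less_trans[OF ell2_coord_le[OF dC]] by blast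
    qed
    then have "convergent (\<lambda>k. p k n)" for n
      by (rule Cauchy_convergent)
    then obtain x where x: "\<And>n. (\<lambda>k. p k n) \<longlonglongrightarrow> x n"
      unfolding convergent_def by metis
    have tail: "\<exists>N. \<forall>k\<ge>N. (\<lambda>n. p k n - x n) \<in> carrier ell2 \<and> nrm ell2 (\<lambda>n. p k n - x n) \<le> e"
      if e: "0 < e" for e
    proof -
      from cauchy[OF e] obtain N where N: "\<forall>k\<ge>N. \<forall>l\<ge>N. nrm ell2 (\<lambda>n. p k n - p l n) < e" ..
      have "(\<Sum>n<M. (cmod (p k n - x n))\<^sup>2) \<le> e\<^sup>2" if k: "N \<le> k" for k M
      proof (rule LIMSEQ_le_const2)
        show "(\<lambda>l. \<Sum>n<M. (cmod (p k n - p l n))\<^sup>2) \<longlonglongrightarrow> (\<Sum>n<M. (cmod (p k n - x n))\<^sup>2)"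
          by (intro tendsto_intros x)
        have "(\<Sum>n<M. (cmod (p k n - p l n))\<^sup>2) \<le> e\<^sup>2" if "N \<le> l" for l
        proof -
          have "(\<Sum>n<M. (cmod (p k n - p l n))\<^sup>2) \<le> (nrm ell2 (\<lambda>n. p k n - p l n))\<^sup>2"
            by (rule ell2_partial_sum_le[OF dC])
          also have "\<dots> \<le> e\<^sup>2"
            by (rule power_mono[OF less_imp_le[OF N[rule_format, OF k that]] ell2_nrm_nonneg[OF dC]])
          finally show ?thesis .
        qed
        then show "\<exists>N. \<forall>l\<ge>N. (\<Sum>n<M. (cmod (p k n - p l n))\<^sup>2) \<le> e\<^sup>2" by blast
      qed
      then show ?thesis
        using ell2_boundedI[OF less_imp_le[OF e]] by (intro exI[of _ N]) simp
    qed
    \<comment> \<open>The limit x is recovered as \<open>p k0\<close> minus this difference, and so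
      belongs to the space.\<close>
    obtain k0 where k0: "(\<lambda>n. p k0 n - x n) \<in> carrier ell2"
      using tail[OF zero_less_one] by blast
    have xC: "x \<in> carrier ell2"
      using M.minus_closed[OF pC k0, of k0] unfolding ell2_minus[OF pC k0] by simp
    have "(\<lambda>k. nrm ell2 (p k \<ominus>\<^bsub>ell2\<^esub> x)) \<longlonglongrightarrow> 0"
    proof (rule LIMSEQ_I)
      fix e :: real assume "0 < e"
      then obtain N where "\<forall>k\<ge>N. nrm ell2 (\<lambda>n. p k n - x n) \<le> e / 2"
        using tail[of "e / 2"] by auto
      then have "\<forall>k\<ge>N. norm (nrm ell2 (p k \<ominus>\<^bsub>ell2\<^esub> x) - 0) < e"
        using \<open>0 < e\<close> nrm_nonneg[OF M.minus_closed[OF pC xC]]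
        by (force simp: ell2_minus[OF pC xC] simp del: ell2_simps)
      then show "\<exists>N. \<forall>k\<ge>N. norm (nrm ell2 (p k \<ominus>\<^bsub>ell2\<^esub> x) - 0) < e" ..
    qed
    then show "\<exists>x\<in>carrier ell2. (\<lambda>k. nrm ell2 (p k \<ominus>\<^bsub>ell2\<^esub> x)) \<longlonglongrightarrow> 0"
      using xC by blast
  qed
qed

lemma ell2_hilbert_space: "complex_hilbert_space ell2"
proof -
  have "complex_banach_space ell2"
    using ell2_normed_space ell2_complete
    by (simp add: complex_banach_space_def complex_banach_space_axioms_def)
  then show ?thesis
  proof (rule complex_hilbert_space.intro, unfold_locales)
    fix x y z c assume x: "x \<in> carrier ell2" and y: "y \<in> carrier ell2" and z: "z \<in> carrier ell2"
    show "cip ell2 (x \<oplus>\<^bsub>ell2\<^esub> y) z = cip ell2 x z + cip ell2 y z"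
      using suminf_add[OF ell2_summable_cip[OF x z] ell2_summable_cip[OF y z]]
      by (simp add: algebra_simps)
  next
    fix x y c assume x: "x \<in> carrier ell2" and y: "y \<in> carrier ell2"
    show "cip ell2 (c \<odot>\<^bsub>ell2\<^esub> x) y = c * cip ell2 x y"
      using suminf_mult[OF ell2_summable_cip[OF x y], of c] by (simp add: mult.assoc)
    have "(\<lambda>n. cnj (x n * cnj (y n))) sums cnj (\<Sum>n. x n * cnj (y n))"
      using summable_sums[OF ell2_summable_cip[OF x y]] by (simp only: sums_cnj)
    then show "cip ell2 y x = cnj (cip ell2 x y)"
      by (simp add: sums_iff mult.commute)
  next
    fix x assume x: "x \<in> carrier ell2"
    have "(\<lambda>n. complex_of_real ((cmod (x n))\<^sup>2)) sums complex_of_real (\<Sum>n. (cmod (x n))\<^sup>2)"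
      using x by (intro sums_of_real summable_sums) simp
    then have "(\<Sum>n. x n * cnj (x n)) = complex_of_real (\<Sum>n. (cmod (x n))\<^sup>2)"
      by (simp only: complex_norm_square sums_iff)
    then show "cip ell2 x x = complex_of_real ((nrm ell2 x)\<^sup>2)"
      using x by (simp add: suminf_nonneg)
  qed
qed

definition unit_vector :: "nat \<Rightarrow> nat \<Rightarrow> complex" where
  "unit_vector k n = (if n = k then 1 else 0)"

lemma unit_vector_in_ell2: "unit_vector k \<in> carrier ell2"
proof -
  have "summable (\<lambda>n. (cmod (unit_vector k n))\<^sup>2)"
    by (rule summable_finite[of "{k}"]) (auto simp: unit_vector_def)
  then show ?thesis by simp
qed

definition diagonal_op :: "(nat \<Rightarrow> real) \<Rightarrow> (nat \<Rightarrow> complex) \<Rightarrow> nat \<Rightarrow> complex" where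
  "diagonal_op c x n = complex_of_real (c n) * x n"

lemma diagonal_op_bound:
  assumes c: "\<And>n. \<bar>c n\<bar> \<le> B" and x: "x \<in> carrier ell2"
  shows "diagonal_op c x \<in> carrier ell2" "nrm ell2 (diagonal_op c x) \<le> B * nrm ell2 x"
proof -
  have B: "0 \<le> B" using c[of 0] by simp
  have "(\<Sum>n<N. (cmod (diagonal_op c x n))\<^sup>2) \<le> (B * nrm ell2 x)\<^sup>2" for N
  proof -
    have "(\<Sum>n<N. (cmod (diagonal_op c x n))\<^sup>2) \<le> (\<Sum>n<N. B\<^sup>2 * (cmod (x n))\<^sup>2)"
    proof (rule sum_mono)
      fix n
      have "\<bar>c n\<bar>\<^sup>2 \<le> B\<^sup>2" using c by (intro power_mono) auto
      then show "(cmod (diagonal_op c x n))\<^sup>2 \<le> B\<^sup>2 * (cmod (x n))\<^sup>2"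
        by (simp add: diagonal_op_def norm_mult power_mult_distrib mult_right_mono)
    qed
    also have "\<dots> \<le> B\<^sup>2 * (nrm ell2 x)\<^sup>2"
      unfolding sum_distrib_left[symmetric] using ell2_partial_sum_le[OF x] by (intro mult_left_mono) auto
    finally show ?thesis by (simp only: power_mult_distrib)
  qed
  from ell2_boundedI[OF _ this] B ell2_nrm_nonneg[OF x]
  show "diagonal_op c x \<in> carrier ell2" "nrm ell2 (diagonal_op c x) \<le> B * nrm ell2 x"
    by (simp_all del: ell2_simps)
qed

lemma diagonal_op_clinear:
  assumes "\<And>n. \<bar>c n\<bar> \<le> B"
  shows "clinear_map ell2 ell2 (diagonal_op c)"
  by (rule clinear_mapI)
    (use diagonal_op_bound(1)[of c B, OF assms] in
      \<open>auto simp: diagonal_op_def fun_eq_iff algebra_simps simp del: ell2_simps(1)\<close>)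

text \<open>A bounded sequence has a coordinatewise convergent subsequence. Finitely many
  coordinates are controlled by this convergence, the others by the smallness of c.\<close>

lemma diagonal_op_compact:
  assumes dec: "decseq c" and nonneg: "\<And>n. 0 \<le> c n" and null: "c \<longlonglongrightarrow> 0"
  shows "compact_op ell2 ell2 (diagonal_op c)"
proof -
  interpret H: complex_hilbert_space ell2 by (rule ell2_hilbert_space)
  interpret Met: Metric_space "carrier ell2" "ndist ell2" by (rule H.metric_space)
  let ?U = "diagonal_op c"
  have c0: "\<bar>c n\<bar> \<le> c 0" for n
    using dec nonneg by (auto simp: decseq_def)
  note UC = diagonal_op_bound(1)[of c "c 0", OF c0]
  let ?S = "?U ` {x \<in> carrier ell2. nrm ell2 x \<le> 1}"
  have sub: "?S \<subseteq> carrier ell2" using UC by blast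
  have "\<exists>\<rho>. strict_mono \<rho> \<and> ncauchy ell2 (s \<circ> \<rho>)" if s: "range s \<subseteq> ?S" for s :: "nat \<Rightarrow> nat \<Rightarrow> complex"
  proof -
    have "\<exists>x. x \<in> carrier ell2 \<and> nrm ell2 x \<le> 1 \<and> s k = ?U x" for k
      using s by blast
    then obtain p where pC: "\<And>k. p k \<in> carrier ell2" and p1: "\<And>k. nrm ell2 (p k) \<le> 1"
      and s_eq: "\<And>k. s k = ?U (p k)" by metis
    \<comment> \<open>By Tychonoff the product of closed unit discs is compact; it is metrizable, so
      sequential compactness follows, and it contains the unit ball.\<close>
    have "compact (\<Pi>\<^sub>E n\<in>(UNIV::nat set). cball (0::complex) 1)"
      using compactin_PiE[of "\<lambda>_::nat. euclidean" UNIV "\<lambda>_. cball (0::complex) 1"]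
      by (simp add: euclidean_product_topology)
    then have "seq_compact (\<Pi>\<^sub>E n\<in>(UNIV::nat set). cball (0::complex) 1)"
      by (simp add: compact_eq_seq_compact_metric)
    moreover have "\<forall>k. p k \<in> (\<Pi>\<^sub>E n\<in>UNIV. cball 0 1)"
      using order_trans[OF ell2_coord_le[OF pC] p1] by (auto simp del: ell2_simps)
    ultimately obtain \<rho> x where \<rho>: "strict_mono \<rho>" and lim: "(p \<circ> \<rho>) \<longlonglongrightarrow> x"
      by (rule seq_compactE)
    have x: "(\<lambda>k. p (\<rho> k) n) \<longlonglongrightarrow> x n" for n
    proof -
      have "continuous_on UNIV (\<lambda>x :: nat \<Rightarrow> complex. x n)"
        by (rule continuous_on_product_coordinates)
      then have "isCont (\<lambda>x :: nat \<Rightarrow> complex. x n) x"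
        using continuous_on_eq_continuous_at[OF open_UNIV] by blast
      from isCont_tendsto_compose[OF this lim] show ?thesis by (simp add: o_def)
    qed
    have "ncauchy ell2 (\<lambda>k. ?U (p (\<rho> k)))"
      unfolding H.ncauchy_iff
    proof (intro conjI allI impI)
      show "?U (p (\<rho> k)) \<in> carrier ell2" for k by (rule UC[OF pC])
      fix e :: real assume e: "0 < e"
      \<comment> \<open>Differences of two points of the unit ball have norm at most 2, so the tail
        contributes strictly less than e / 2.\<close>
      obtain M where M: "c M < e / 4"
        using order_tendstoD(2)[OF null, of "e / 4"] e by (auto simp: eventually_sequentially)
      \<comment> \<open>Chosen so that each of the first M coordinates of the image is at most e /
        (2 (M + 1)), whence the head has norm at most e / 2; c 0 + 1 is a positive bound for
        c.\<close>
      define \<delta> where "\<delta> = e / (2 * (real M + 1)) / (c 0 + 1)"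
      have \<delta>: "0 < \<delta>"
        unfolding \<delta>_def using e nonneg[of 0] by (intro divide_pos_pos mult_pos_pos) auto
      have "\<exists>N. \<forall>k\<ge>N. \<forall>l\<ge>N. norm (p (\<rho> k) n - p (\<rho> l) n) < \<delta>" for n
        using LIMSEQ_imp_Cauchy[OF x, of n] \<delta> unfolding Cauchy_iff by blast
      then obtain N where N: "\<And>n k l. N n \<le> k \<Longrightarrow> N n \<le> l \<Longrightarrow> norm (p (\<rho> k) n - p (\<rho> l) n) < \<delta>"
        by metis
      define N' where "N' = Max (insert 0 (N ` {..<M}))"
      have "nrm ell2 (?U (p (\<rho> k)) \<ominus>\<^bsub>ell2\<^esub> ?U (p (\<rho> l))) < e" if kl: "N' \<le> k" "N' \<le> l" for k l
      proof -
        define d where "d = p (\<rho> k) \<ominus>\<^bsub>ell2\<^esub> p (\<rho> l)"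
        have dC: "d \<in> carrier ell2" unfolding d_def by (rule H.M.minus_closed[OF pC pC])
        have d2: "nrm ell2 d \<le> 2"
        proof -
          have "nrm ell2 d \<le> nrm ell2 (p (\<rho> k)) + nrm ell2 (\<ominus>\<^bsub>ell2\<^esub> p (\<rho> l))"
            unfolding d_def H.M.minus_eq by (rule H.nrm_triangle[OF pC H.M.a_inv_closed[OF pC]])
          then show ?thesis
            using p1[of "\<rho> k"] p1[of "\<rho> l"] H.nrm_uminus[OF pC, of "\<rho> l"] by linarith
        qed
        let ?c1 = "\<lambda>n. if n < M then c n else 0" and ?c2 = "\<lambda>n. if n < M then 0 else c n"
        have split: "?U d = diagonal_op ?c1 d \<oplus>\<^bsub>ell2\<^esub> diagonal_op ?c2 d"
          by (auto simp: diagonal_op_def)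
        have c1: "diagonal_op ?c1 d \<in> carrier ell2" "nrm ell2 (diagonal_op ?c1 d) \<le> e / 2"
        proof -
          have d_small: "cmod (d n) \<le> \<delta>" if "n < M" for n
          proof -
            have "N n \<le> N'" unfolding N'_def using that by (intro Max_ge) auto
            then show ?thesis
              using N[of n k l] kl unfolding d_def ell2_minus[OF pC pC] by simp
          qed
          have "(\<Sum>n<K. (cmod (diagonal_op ?c1 d n))\<^sup>2) \<le> (e / 2)\<^sup>2" for K
          proof -
            let ?t = "e / (2 * (real M + 1))"
            have t: "0 \<le> ?t" using e by simp
            have small: "cmod (diagonal_op ?c1 d n) \<le> (if n < M then ?t else 0)" for n
            proof (cases "n < M")
              case True
              have "c n * cmod (d n) \<le> (c 0 + 1) * \<delta>"
                using d_small[OF True] c0[of n] nonneg[of n] by (intro mult_mono) auto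
              also have "c 0 + 1 \<noteq> 0" using nonneg[of 0] by linarith
              then have "(c 0 + 1) * \<delta> = ?t" by (simp add: \<delta>_def)
              finally show ?thesis
                using True nonneg[of n] by (simp add: diagonal_op_def norm_mult)
            qed (simp add: diagonal_op_def)
            have "(\<Sum>n<K. (cmod (diagonal_op ?c1 d n))\<^sup>2) \<le> (\<Sum>n<K. (if n < M then ?t else 0)\<^sup>2)"
              using small by (intro sum_mono power_mono) auto
            also have "\<dots> = (\<Sum>n\<in>{..<K} \<inter> {..<M}. ?t\<^sup>2)"
              by (rule sum.mono_neutral_cong_right) auto
            also have "\<dots> \<le> (\<Sum>n<M. ?t\<^sup>2)" by (rule sum_mono2) auto
            also have "\<dots> = real M * ?t\<^sup>2" by simp
            also have "\<dots> \<le> (real M + 1)\<^sup>2 * ?t\<^sup>2"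
              by (intro mult_right_mono) (auto simp: power2_eq_square algebra_simps)
            also have "\<dots> = ((real M + 1) * ?t)\<^sup>2" by (simp only: power_mult_distrib)
            also have "(real M + 1) * ?t = e / 2"
              by (simp add: field_simps add_eq_0_iff)
            finally show ?thesis .
          qed
          from ell2_boundedI[OF _ this] e
          show "diagonal_op ?c1 d \<in> carrier ell2" "nrm ell2 (diagonal_op ?c1 d) \<le> e / 2" by simp_all
        qed
        have c2: "diagonal_op ?c2 d \<in> carrier ell2" "nrm ell2 (diagonal_op ?c2 d) \<le> c M * nrm ell2 d"
        proof -
          have "\<bar>?c2 n\<bar> \<le> c M" for n using dec nonneg by (auto simp: decseq_def)
          from diagonal_op_bound[OF this dC]
          show "diagonal_op ?c2 d \<in> carrier ell2" "nrm ell2 (diagonal_op ?c2 d) \<le> c M * nrm ell2 d" .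
        qed
        have "nrm ell2 (?U d) \<le> e / 2 + c M * nrm ell2 d"
          unfolding split by (rule order_trans[OF H.nrm_triangle[OF c1(1) c2(1)] add_mono[OF c1(2) c2(2)]])
        also have "c M * nrm ell2 d \<le> c M * 2" using d2 nonneg by (rule mult_left_mono)
        also have "e / 2 + c M * 2 < e" using M by simp
        also have "?U d = ?U (p (\<rho> k)) \<ominus>\<^bsub>ell2\<^esub> ?U (p (\<rho> l))"
          unfolding d_def
          by (rule clinear_map_minus[OF ell2_normed_space ell2_normed_space diagonal_op_clinear[of c "c 0", OF c0] pC pC])
        finally show ?thesis by simp
      qed
      then show "\<exists>N. \<forall>k\<ge>N. \<forall>l\<ge>N. nrm ell2 (?U (p (\<rho> k)) \<ominus>\<^bsub>ell2\<^esub> ?U (p (\<rho> l))) < e" by blast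
    qed
    moreover have "s \<circ> \<rho> = (\<lambda>k. ?U (p (\<rho> k)))" by (auto simp: s_eq)
    ultimately show ?thesis using \<rho> by auto
  qed
  then have "Met.mtotally_bounded ?S"
    unfolding Met.mtotally_bounded_sequentially using sub by simp
  then show ?thesis
    using Met.mtotally_bounded_eq_compact_closure_of[OF ell2_complete] diagonal_op_clinear[of c "c 0", OF c0]
    by (simp add: compact_op_def del: ell2_simps)
qed

text \<open>The operator is its own adjoint. As c is nonnegative, the eigenspace for the square of
  \<open>\<mu>\<close> consists of the sequences supported where c equals \<open>\<mu>\<close>, and
  the unit vectors there form its basis.\<close>

lemma diagonal_op_singular_numbers:
  assumes dec: "decseq c" and nonneg: "\<And>n. 0 \<le> c n" and null: "c \<longlonglongrightarrow> 0"
  shows "singular_numbers ell2 (diagonal_op c) c"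
  unfolding singular_numbers_def
proof (intro conjI allI impI dec nonneg)
  interpret H: complex_hilbert_space ell2 by (rule ell2_hilbert_space)
  fix \<mu> :: real assume \<mu>: "0 < \<mu>"
  let ?I = "{n. c n = \<mu>}" and ?U = "diagonal_op c"
  let ?k = "card ?I"
  let ?E = "{x \<in> carrier ell2. hadjoint ell2 ?U (?U x) = complex_of_real (\<mu>\<^sup>2) \<odot>\<^bsub>ell2\<^esub> x}"
  have c0: "\<bar>c n\<bar> \<le> c 0" for n
    using dec nonneg by (auto simp: decseq_def)
  note UC = diagonal_op_bound(1)[of c "c 0", OF c0]
  have "eventually (\<lambda>n. c n < \<mu>) sequentially"
    using order_tendstoD(2)[OF null \<mu>] .
  then obtain N where N: "\<And>n. N \<le> n \<Longrightarrow> c n < \<mu>"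
    by (auto simp: eventually_sequentially)
  have "?I \<subseteq> {..<N}" using N by (metis (mono_tags) lessThan_iff less_irrefl mem_Collect_eq not_le subsetI)
  then show fin: "finite ?I" using finite_subset by blast
  have adj: "hadjoint ell2 ?U y = ?U y" if "y \<in> carrier ell2" for y
    by (rule H.hadjoint_eqI) (use UC[OF that] in \<open>simp_all add: diagonal_op_def mult_ac\<close>)
  have E_iff: "x \<in> ?E \<longleftrightarrow> x \<in> carrier ell2 \<and> (\<forall>n. c n \<noteq> \<mu> \<longrightarrow> x n = 0)" for x
  proof -
    have "(c n)\<^sup>2 = \<mu>\<^sup>2 \<longleftrightarrow> c n = \<mu>" for n
      using nonneg[of n] \<mu> by (simp add: power2_eq_iff_nonneg)
    then have "complex_of_real (c n) * (complex_of_real (c n) * x n) = complex_of_real (\<mu>\<^sup>2) * x n \<longleftrightarrow>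
        (c n \<noteq> \<mu> \<longrightarrow> x n = 0)" for n
      by (auto simp: power2_eq_square simp flip: mult.assoc of_real_mult)
    then show ?thesis
      using adj[OF UC] by (auto simp: diagonal_op_def fun_eq_iff)
  qed
  obtain idx where idx: "bij_betw idx {..<?k} ?I"
    using ex_bij_betw_nat_finite[OF fin] by (auto simp: atLeast0LessThan)
  have idx_c: "c (idx j) = \<mu>" if "j < ?k" for j
    using bij_betw_apply[OF idx, of j] that by simp
  define b where "b j = unit_vector (idx j)" for j
  have bC: "b j \<in> carrier ell2" for j unfolding b_def by (rule unit_vector_in_ell2)
  have comb: "(\<Oplus>\<^bsub>ell2\<^esub>j\<in>{..<?k}. d j \<odot>\<^bsub>ell2\<^esub> b j) n = (\<Sum>j<?k. d j * b j n)" for d n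
    by (rule clinear_functional_finsum[OF ell2_normed_space _ bC]) (auto intro: clinear_mapI)
  have comb_idx: "(\<Oplus>\<^bsub>ell2\<^esub>j\<in>{..<?k}. d j \<odot>\<^bsub>ell2\<^esub> b j) (idx i) = d i" if i: "i < ?k" for d i
  proof -
    have "(\<Sum>j<?k. d j * b j (idx i)) = (\<Sum>j<?k. if j = i then d i else 0)"
      using bij_betw_imp_inj_on[OF idx] i
      by (intro sum.cong) (auto simp: b_def unit_vector_def dest: inj_onD)
    then show ?thesis unfolding comb using i by simp
  qed
  have comb_other: "(\<Oplus>\<^bsub>ell2\<^esub>j\<in>{..<?k}. d j \<odot>\<^bsub>ell2\<^esub> b j) n = 0" if "c n \<noteq> \<mu>" for d n
    unfolding comb using that idx_c by (intro sum.neutral) (auto simp: b_def unit_vector_def)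
  have "is_basis_of ell2 ?E ?k b"
    unfolding is_basis_of_def
  proof (intro conjI ballI)
    show "b \<in> {..<?k} \<rightarrow> ?E"
    proof
      fix j assume "j \<in> {..<?k}"
      then show "b j \<in> ?E"
        unfolding E_iff using bC idx_c[of j] by (auto simp: b_def unit_vector_def simp del: ell2_simps)
    qed
    fix x assume "x \<in> ?E"
    then have x0: "\<And>n. c n \<noteq> \<mu> \<Longrightarrow> x n = 0" unfolding E_iff by blast
    show "\<exists>!d. d \<in> {..<?k} \<rightarrow>\<^sub>E UNIV \<and> x = (\<Oplus>\<^bsub>ell2\<^esub>j\<in>{..<?k}. d j \<odot>\<^bsub>ell2\<^esub> b j)"
    proof (rule ex1I)
      let ?d = "\<lambda>j\<in>{..<?k}. x (idx j)"
      have expand: "x n = (\<Oplus>\<^bsub>ell2\<^esub>j\<in>{..<?k}. ?d j \<odot>\<^bsub>ell2\<^esub> b j) n" for n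
      proof (cases "c n = \<mu>")
        case True
        then obtain i where "i < ?k" "n = idx i"
          using idx by (auto simp: bij_betw_def)
        then show ?thesis using comb_idx[of i ?d] by simp
      next
        case False
        show ?thesis using x0[OF False] comb_other[OF False, of ?d] by (simp only:)
      qed
      show "?d \<in> {..<?k} \<rightarrow>\<^sub>E UNIV \<and> x = (\<Oplus>\<^bsub>ell2\<^esub>j\<in>{..<?k}. ?d j \<odot>\<^bsub>ell2\<^esub> b j)"
      proof
        show "?d \<in> {..<?k} \<rightarrow>\<^sub>E UNIV" by simp
      qed (rule ext, rule expand)
    next
      fix d assume d: "d \<in> {..<?k} \<rightarrow>\<^sub>E UNIV \<and> x = (\<Oplus>\<^bsub>ell2\<^esub>j\<in>{..<?k}. d j \<odot>\<^bsub>ell2\<^esub> b j)"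
      then show "d = (\<lambda>j\<in>{..<?k}. x (idx j))"
        using comb_idx[of _ d] by (intro extensionalityI[of _ "{..<?k}"]) (auto simp: PiE_def)
    qed
  qed
  then show "\<exists>b. is_basis_of ell2 ?E ?k b" by blast
qed

lemma diagonal_op_lorentz_schatten:
  assumes "decseq c" "\<And>n. 0 \<le> c n" "c \<longlonglongrightarrow> 0"
    and "summable (\<lambda>n. real (Suc n) powr (s / r - 1) * c n powr s)"
  shows "diagonal_op c \<in> lorentz_schatten r s ell2"
  using diagonal_op_compact[OF assms(1-3)] diagonal_op_singular_numbers[OF assms(1-3)] assms(4)
  by (auto simp: lorentz_schatten_def)

section \<open>Tensor norms\<close>

text \<open>Finitely many vectors are reproduced by bounded functionals \<open>\<psi> l\<close> and
  fixed vectors \<open>e l\<close>. Since h may be any linear functional, bounded or not, this is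
  the device that replaces arbitrary forms by bounded ones.\<close>

lemma finite_rank_reproduction:
  fixes n :: nat
  assumes X: "complex_normed_space X" and x: "\<And>k. k < n \<Longrightarrow> x k \<in> carrier X"
  shows "\<exists>L \<psi> e. (\<forall>l<(L::nat). bounded_op X complex_line (\<psi> l) \<and> e l \<in> carrier X) \<and>
    (\<forall>k<n. \<forall>h. clinear_map X complex_line h \<longrightarrow> h (x k) = (\<Sum>l<L. \<psi> l (x k) * h (e l)))"
  using x
proof (induction n)
  case 0
  show ?case by (intro exI[of _ 0]) simp
next
  case (Suc n)
  interpret X: complex_normed_space X by fact
  have "\<exists>L \<psi> e. (\<forall>l<(L::nat). bounded_op X complex_line (\<psi> l) \<and> e l \<in> carrier X) \<and>
    (\<forall>k<n. \<forall>h. clinear_map X complex_line h \<longrightarrow> h (x k) = (\<Sum>l<L. \<psi> l (x k) * h (e l)))"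
    using Suc.IH Suc.prems by simp
  then obtain L :: nat and \<psi> e where IH: "(\<forall>l<L. bounded_op X complex_line (\<psi> l) \<and> e l \<in> carrier X) \<and>
    (\<forall>k<n. \<forall>h. clinear_map X complex_line h \<longrightarrow> h (x k) = (\<Sum>l<L. \<psi> l (x k) * h (e l)))"
    by (elim exE)
  then have \<psi>: "\<And>l. l < L \<Longrightarrow> bounded_op X complex_line (\<psi> l)" and e: "\<And>l. l < L \<Longrightarrow> e l \<in> carrier X"
    and rep: "\<And>k h. k < n \<Longrightarrow> clinear_map X complex_line h \<Longrightarrow> h (x k) = (\<Sum>l<L. \<psi> l (x k) * h (e l))"
    by simp_all
  have xn: "x n \<in> carrier X" using Suc.prems by simp
  have "\<exists>v\<in>carrier X. \<forall>h. clinear_map X complex_line h \<longrightarrow> h v = h (x n) - (\<Sum>l<j. \<psi> l (x n) * h (e l))"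
    if "j \<le> L" for j
    using that
  proof (induction j)
    case 0
    show ?case using xn by (intro bexI[of _ "x n"]) simp_all
  next
    case (Suc j)
    then obtain v where v: "v \<in> carrier X"
      "\<And>h. clinear_map X complex_line h \<Longrightarrow> h v = h (x n) - (\<Sum>l<j. \<psi> l (x n) * h (e l))"
      by auto
    have ej: "e j \<in> carrier X" using e Suc.prems by simp
    have "h (v \<oplus>\<^bsub>X\<^esub> (- \<psi> j (x n)) \<odot>\<^bsub>X\<^esub> e j) = h (x n) - (\<Sum>l<Suc j. \<psi> l (x n) * h (e l))"
      if h: "clinear_map X complex_line h" for h
      using clinear_mapD(2)[OF h v(1) X.smult_in_carrier[OF ej]] clinear_mapD(3)[OF h ej] v(2)[OF h] by simp
    then show ?case
      using v(1) ej by (intro bexI[of _ "v \<oplus>\<^bsub>X\<^esub> (- \<psi> j (x n)) \<odot>\<^bsub>X\<^esub> e j"]) simp_all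
  qed
  then obtain v where v: "v \<in> carrier X"
    "\<And>h. clinear_map X complex_line h \<Longrightarrow> h v = h (x n) - (\<Sum>l<L. \<psi> l (x n) * h (e l))"
    by auto
  show ?case
  proof (cases "v = \<zero>\<^bsub>X\<^esub>")
    case True
    have "h (x n) = (\<Sum>l<L. \<psi> l (x n) * h (e l))" if h: "clinear_map X complex_line h" for h
      using v(2)[OF h] clinear_mapD(3)[OF h X.M.zero_closed, of 0] True by simp
    then show ?thesis
      using IH by (intro exI[of _ L] exI[of _ \<psi>] exI[of _ e]) (simp add: less_Suc_eq all_conj_distrib)
  next
    case False
    then obtain \<phi> where \<phi>: "clinear_map X complex_line \<phi>"
      "\<And>x. x \<in> carrier X \<Longrightarrow> cmod (\<phi> x) \<le> nrm X x" "\<phi> v \<noteq> 0"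
      using X.separating_functional[OF v(1)] by metis
    \<comment> \<open>Subtracting the earlier functionals makes this vanish at the vectors already
      reproduced; at \<open>x n\<close> the numerator is \<open>\<phi> v\<close>, so the division
      gives the value 1.\<close>
    define \<psi>' where "\<psi>' z = (\<phi> z - (\<Sum>l<L. \<psi> l z * \<phi> (e l))) / \<phi> v" for z
    have lin\<psi>: "clinear_map X complex_line (\<psi> l)" if "l < L" for l
      using \<psi>[OF that] by (simp add: bounded_op_def)
    have lin\<psi>': "clinear_map X complex_line \<psi>'"
      using clinear_mapD(2,3)[OF \<phi>(1)] clinear_mapD(2,3)[OF lin\<psi>]
      by (intro clinear_mapI)
        (simp_all add: \<psi>'_def algebra_simps sum.distrib sum_distrib_left add_divide_distrib diff_divide_distrib)
    have "\<exists>K. \<forall>l<L. \<forall>z\<in>carrier X. cmod (\<psi> l z) \<le> K l * nrm X z"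
    proof -
      have "\<forall>l. \<exists>K. l < L \<longrightarrow> (\<forall>z\<in>carrier X. cmod (\<psi> l z) \<le> K * nrm X z)"
        using \<psi> by (auto simp: bounded_op_def)
      from choice[OF this] show ?thesis by blast
    qed
    then obtain K where K: "\<And>l z. l < L \<Longrightarrow> z \<in> carrier X \<Longrightarrow> cmod (\<psi> l z) \<le> K l * nrm X z" by blast
    have "cmod (\<psi>' z) \<le> ((1 + (\<Sum>l<L. K l * cmod (\<phi> (e l)))) / cmod (\<phi> v)) * nrm X z"
      if z: "z \<in> carrier X" for z
    proof -
      have "cmod (\<phi> z - (\<Sum>l<L. \<psi> l z * \<phi> (e l))) \<le> cmod (\<phi> z) + (\<Sum>l<L. cmod (\<psi> l z * \<phi> (e l)))"
        by (intro order_trans[OF norm_triangle_ineq4] add_mono norm_sum order_refl)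
      also have "\<dots> \<le> nrm X z + (\<Sum>l<L. K l * nrm X z * cmod (\<phi> (e l)))"
        unfolding norm_mult using K z \<phi>(2) by (intro add_mono sum_mono mult_right_mono) auto
      also have "\<dots> = (1 + (\<Sum>l<L. K l * cmod (\<phi> (e l)))) * nrm X z"
        by (simp add: algebra_simps sum_distrib_left)
      finally show ?thesis
        using \<phi>(3) by (simp add: \<psi>'_def norm_divide divide_right_mono)
    qed
    then have bdd: "bounded_op X complex_line \<psi>'"
      using lin\<psi>' unfolding bounded_op_def complex_line_simps by blast
    have \<psi>'0: "\<psi>' (x k) = 0" if "k < n" for k
      using rep[OF that \<phi>(1)] by (simp add: \<psi>'_def)
    have \<psi>'1: "\<psi>' (x n) = 1"
      using v(2)[OF \<phi>(1)] \<phi>(3) by (simp add: \<psi>'_def)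
    have "h (x k) = (\<Sum>l<Suc L. (\<psi>(L := \<psi>')) l (x k) * h ((e(L := v)) l))"
      if k: "k < Suc n" and h: "clinear_map X complex_line h" for k h
    proof -
      have "(\<Sum>l<Suc L. (\<psi>(L := \<psi>')) l (x k) * h ((e(L := v)) l))
          = (\<Sum>l<L. \<psi> l (x k) * h (e l)) + \<psi>' (x k) * h v"
      proof -
        have "(\<Sum>l<L. (\<psi>(L := \<psi>')) l (x k) * h ((e(L := v)) l)) = (\<Sum>l<L. \<psi> l (x k) * h (e l))"
          by (intro sum.cong) auto
        then show ?thesis by simp
      qed
      then show ?thesis
        using k rep[OF _ h] \<psi>'0 \<psi>'1 v(2)[OF h] by (auto simp: less_Suc_eq)
    qed
    then show ?thesis
      using \<psi> e bdd v(1)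
      by (intro exI[of _ "Suc L"] exI[of _ "\<psi>(L := \<psi>')"] exI[of _ "e(L := v)"]) (simp add: less_Suc_eq)
  qed
qed

text \<open>With at least one factor available, a scalar multiple of an elementary tensor is again
  elementary.\<close>

locale tensor_factors =
  fixes m :: nat and X :: "nat \<Rightarrow> 'a normed"
  assumes m: "1 \<le> m" and normed: "\<And>i. i \<in> {1..m} \<Longrightarrow> complex_normed_space (X i)"
begin

abbreviation forms :: "((nat \<Rightarrow> 'a) \<Rightarrow> complex) set" where
  "forms \<equiv> multilinear_forms m X"

definition tensors :: "'a tensor set" where
  "tensors = {tensor_sum m X n xs | n xs. xs \<in> {..<n} \<rightarrow> tuples m X}"

definition product_form :: "(nat \<Rightarrow> 'a \<Rightarrow> complex) \<Rightarrow> (nat \<Rightarrow> 'a) \<Rightarrow> complex" where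
  "product_form \<phi> = (\<lambda>x\<in>tuples m X. \<Prod>i=1..m. \<phi> i (x i))"

lemma tensor_product_simps [simp]:
  "carrier (tensor_product m X N) = tensors"
  "\<zero>\<^bsub>tensor_product m X N\<^esub> = (\<lambda>F\<in>forms. 0)"
  "u \<oplus>\<^bsub>tensor_product m X N\<^esub> v = (\<lambda>F\<in>forms. u F + v F)"
  "c \<odot>\<^bsub>tensor_product m X N\<^esub> u = (\<lambda>F\<in>forms. c * u F)"
  "nrm (tensor_product m X N) = N"
  by (simp_all add: tensor_product_def tensors_def)

lemma tuples_upd: "x \<in> tuples m X \<Longrightarrow> i \<in> {1..m} \<Longrightarrow> a \<in> carrier (X i) \<Longrightarrow> x(i := a) \<in> tuples m X"
  by (auto simp: PiE_iff extensional_def)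

lemma tuples_component: "x \<in> tuples m X \<Longrightarrow> i \<in> {1..m} \<Longrightarrow> x i \<in> carrier (X i)"
  by (auto simp: PiE_iff)

lemma product_form_in_forms:
  assumes \<phi>: "\<And>i. i \<in> {1..m} \<Longrightarrow> clinear_map (X i) complex_line (\<phi> i)"
  shows "product_form \<phi> \<in> forms"
  unfolding multilinear_forms_def
proof (intro CollectI conjI ballI)
  show "product_form \<phi> \<in> extensional (tuples m X)" by (simp add: product_form_def)
  fix x i assume x: "x \<in> tuples m X" and i: "i \<in> {1..m}"
  interpret Xi: complex_normed_space "X i" using normed[OF i] .
  have eq: "product_form \<phi> (x(i := a)) = \<phi> i a * (\<Prod>j\<in>{1..m} - {i}. \<phi> j (x j))"
    if "a \<in> carrier (X i)" for a
  proof -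
    have "(\<Prod>j=1..m. \<phi> j ((x(i := a)) j)) = \<phi> i a * (\<Prod>j\<in>{1..m} - {i}. \<phi> j ((x(i := a)) j))"
      using i by (subst prod.remove[of _ i]) auto
    also have "(\<Prod>j\<in>{1..m} - {i}. \<phi> j ((x(i := a)) j)) = (\<Prod>j\<in>{1..m} - {i}. \<phi> j (x j))"
      by (intro prod.cong) auto
    finally show ?thesis
      using tuples_upd[OF x i that] unfolding product_form_def by simp
  qed
  show "clinear_map (X i) complex_line (\<lambda>a. product_form \<phi> (x(i := a)))"
    using clinear_mapD(2,3)[OF \<phi>[OF i]]
    by (intro clinear_mapI) (simp_all add: eq algebra_simps)
qed

lemma form_linear:
  "F \<in> forms \<Longrightarrow> x \<in> tuples m X \<Longrightarrow> i \<in> {1..m} \<Longrightarrow> clinear_map (X i) complex_line (\<lambda>a. F (x(i := a)))"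
  by (simp add: multilinear_forms_def)

lemma tensor_sum_apply: "F \<in> forms \<Longrightarrow> tensor_sum m X n xs F = (\<Sum>k<n. F (xs k))"
  by (simp add: tensor_sum_def)

lemma tensorsE:
  assumes "u \<in> tensors"
  obtains n xs where "xs \<in> {..<n} \<rightarrow> tuples m X" "u = tensor_sum m X n xs"
  using assms by (auto simp: tensors_def)

lemma tensor_sum_in_tensors: "xs \<in> {..<n} \<rightarrow> tuples m X \<Longrightarrow> tensor_sum m X n xs \<in> tensors"
  by (auto simp: tensors_def)

lemma tensors_extensional: "u \<in> tensors \<Longrightarrow> u \<in> extensional forms"
  by (auto simp: tensors_def tensor_sum_def)

text \<open>Representations are concatenated. The last claim holds for any summand f, so it also
  adds the costs that define the projective norm.\<close>

lemma tensor_sum_add: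
  fixes n n' :: nat
  assumes "xs \<in> {..<n} \<rightarrow> tuples m X" "xs' \<in> {..<n'} \<rightarrow> tuples m X"
  defines "ys \<equiv> \<lambda>k. if k < n then xs k else xs' (k - n)"
  shows "ys \<in> {..<n + n'} \<rightarrow> tuples m X"
    and "(\<lambda>F\<in>forms. tensor_sum m X n xs F + tensor_sum m X n' xs' F) = tensor_sum m X (n + n') ys"
    and "(\<Sum>k<n + n'. f (ys k)) = (\<Sum>k<n. f (xs k)) + (\<Sum>k<n'. f (xs' k))"
proof -
  have sum: "(\<Sum>k<n + n'. f (ys k)) = (\<Sum>k<n. f (xs k)) + (\<Sum>k<n'. f (xs' k))"
    for f :: "(nat \<Rightarrow> 'a) \<Rightarrow> 'z :: comm_monoid_add"
  proof -
    have "(\<Sum>k<n + n'. f (ys k)) = (\<Sum>k<n. f (ys k)) + (\<Sum>k<n'. f (ys (n + k)))"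
      by (induction n') (simp_all add: add.assoc)
    then show ?thesis by (simp add: ys_def)
  qed
  show "ys \<in> {..<n + n'} \<rightarrow> tuples m X"
    using assms(1,2) by (auto simp: ys_def Pi_iff)
  show "(\<Sum>k<n + n'. f (ys k)) = (\<Sum>k<n. f (xs k)) + (\<Sum>k<n'. f (xs' k))" by (rule sum)
  show "(\<lambda>F\<in>forms. tensor_sum m X n xs F + tensor_sum m X n' xs' F) = tensor_sum m X (n + n') ys"
    unfolding tensor_sum_def by (auto simp: sum fun_eq_iff)
qed

text \<open>The scalar is absorbed into the first coordinate, which keeps the number of summands and
  multiplies the cost by its modulus.\<close>

lemma tensor_sum_smult:
  fixes c :: complex
  assumes xs: "xs \<in> {..<n} \<rightarrow> tuples m X"
  defines "ys \<equiv> \<lambda>k. (xs k)(1 := c \<odot>\<^bsub>X 1\<^esub> xs k 1)"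
  shows "ys \<in> {..<n} \<rightarrow> tuples m X"
    and "(\<lambda>F\<in>forms. c * tensor_sum m X n xs F) = tensor_sum m X n ys"
    and "(\<Sum>k<n. \<Prod>i=1..m. nrm (X i) (ys k i)) = cmod c * (\<Sum>k<n. \<Prod>i=1..m. nrm (X i) (xs k i))"
proof -
  have 1: "1 \<in> {1..m}" using m by simp
  interpret X1: complex_normed_space "X 1" using normed[OF 1] .
  have x1: "xs k 1 \<in> carrier (X 1)" if "k < n" for k
    using xs that 1 by (intro tuples_component) auto
  show "ys \<in> {..<n} \<rightarrow> tuples m X"
  proof
    fix k assume "k \<in> {..<n}"
    then have "xs k \<in> tuples m X" "k < n" using xs by auto
    then show "ys k \<in> tuples m X"
      unfolding ys_def by (intro tuples_upd 1 X1.smult_in_carrier x1)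
  qed
  have "F (ys k) = c * F (xs k)" if F: "F \<in> forms" and k: "k < n" for F k
  proof -
    have "clinear_map (X 1) complex_line (\<lambda>a. F ((xs k)(1 := a)))"
      using F xs k 1 by (intro form_linear) auto
    from clinear_mapD(3)[OF this x1[OF k], of c] show ?thesis by (simp add: ys_def)
  qed
  then show "(\<lambda>F\<in>forms. c * tensor_sum m X n xs F) = tensor_sum m X n ys"
    unfolding tensor_sum_def by (auto simp: fun_eq_iff sum_distrib_left)
  have "(\<Prod>i=1..m. nrm (X i) (ys k i)) = cmod c * (\<Prod>i=1..m. nrm (X i) (xs k i))" if k: "k < n" for k
  proof -
    have "(\<Prod>i=1..m. nrm (X i) (ys k i)) = nrm (X 1) (ys k 1) * (\<Prod>i\<in>{1..m} - {1}. nrm (X i) (ys k i))"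
      using 1 by (intro prod.remove) auto
    also have "(\<Prod>i\<in>{1..m} - {1}. nrm (X i) (ys k i)) = (\<Prod>i\<in>{1..m} - {1}. nrm (X i) (xs k i))"
      by (intro prod.cong) (auto simp: ys_def)
    also have "nrm (X 1) (ys k 1) = cmod c * nrm (X 1) (xs k 1)"
      unfolding ys_def fun_upd_same by (rule X1.nrm_smult[OF x1[OF k]])
    also have "cmod c * nrm (X 1) (xs k 1) * (\<Prod>i\<in>{1..m} - {1}. nrm (X i) (xs k i))
        = cmod c * (\<Prod>i=1..m. nrm (X i) (xs k i))"
      using 1 by (subst (2) prod.remove[of _ 1]) auto
    finally show ?thesis .
  qed
  then show "(\<Sum>k<n. \<Prod>i=1..m. nrm (X i) (ys k i)) = cmod c * (\<Sum>k<n. \<Prod>i=1..m. nrm (X i) (xs k i))"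
    by (simp add: sum_distrib_left)
qed

lemma tensors_zero: "(\<lambda>F\<in>forms. 0) \<in> tensors"
  using tensor_sum_in_tensors[of "\<lambda>_. undefined" 0] by (simp add: tensor_sum_def)

lemma tensors_add: "u \<in> tensors \<Longrightarrow> v \<in> tensors \<Longrightarrow> (\<lambda>F\<in>forms. u F + v F) \<in> tensors"
  by (elim tensorsE) (simp add: tensor_sum_add tensor_sum_in_tensors del: One_nat_def)

lemma tensors_smult: "u \<in> tensors \<Longrightarrow> (\<lambda>F\<in>forms. c * u F) \<in> tensors"
  by (elim tensorsE) (simp add: tensor_sum_smult tensor_sum_in_tensors del: One_nat_def)

lemma elementary_in_tensors: "x \<in> tuples m X \<Longrightarrow> elementary_tensor m X x \<in> tensors"
  using tensor_sum_in_tensors[of "\<lambda>_. x" 1] by (simp add: tensor_sum_def elementary_tensor_def)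

lemma tensor_module: "module complex_line (tensor_product m X N)"
proof (rule moduleI[OF cring_complex_line])
  show "abelian_group (tensor_product m X N)"
  proof (rule abelian_groupI)
    fix u assume u: "u \<in> carrier (tensor_product m X N)"
    then have "(\<lambda>F\<in>forms. (-1) * u F) \<in> tensors" by (intro tensors_smult) simp
    then show "\<exists>v\<in>carrier (tensor_product m X N). v \<oplus>\<^bsub>tensor_product m X N\<^esub> u = \<zero>\<^bsub>tensor_product m X N\<^esub>"
      by (intro bexI[of _ "\<lambda>F\<in>forms. (-1) * u F"]) (auto simp: fun_eq_iff)
    show "\<zero>\<^bsub>tensor_product m X N\<^esub> \<oplus>\<^bsub>tensor_product m X N\<^esub> u = u"
      using tensors_extensional[of u] u by (auto simp: fun_eq_iff extensional_def)
  qed (auto simp: tensors_zero tensors_add fun_eq_iff algebra_simps)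
  show "\<one>\<^bsub>complex_line\<^esub> \<odot>\<^bsub>tensor_product m X N\<^esub> u = u"
    if "u \<in> carrier (tensor_product m X N)" for u
    using tensors_extensional[of u] that by (auto simp: fun_eq_iff extensional_def)
qed (auto simp: tensors_smult fun_eq_iff algebra_simps)

section \<open>The injective norm and its definiteness\<close>

definition dual_families :: "(nat \<Rightarrow> 'a \<Rightarrow> complex) set" where
  "dual_families = {\<phi>. \<forall>i\<in>{1..m}. \<phi> i \<in> dual_ball (X i)}"

lemma dual_families_form: "\<phi> \<in> dual_families \<Longrightarrow> product_form \<phi> \<in> forms"
  by (intro product_form_in_forms) (auto simp: dual_families_def dual_ball_def)

lemma injective_norm_eq: "injective_norm m X u = (SUP \<phi>\<in>dual_families. cmod (u (product_form \<phi>)))"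
  unfolding injective_norm_def dual_families_def product_form_def
  by (rule arg_cong[where f = Sup]) auto

lemma product_form_tensor_sum_le:
  assumes \<phi>: "\<phi> \<in> dual_families" and xs: "xs \<in> {..<n} \<rightarrow> tuples m X"
  shows "cmod (tensor_sum m X n xs (product_form \<phi>)) \<le> (\<Sum>k<n. \<Prod>i=1..m. nrm (X i) (xs k i))"
proof -
  have "cmod (tensor_sum m X n xs (product_form \<phi>)) \<le> (\<Sum>k<n. cmod (product_form \<phi> (xs k)))"
    using dual_families_form[OF \<phi>] by (simp add: tensor_sum_apply norm_sum)
  also have "\<dots> \<le> (\<Sum>k<n. \<Prod>i=1..m. nrm (X i) (xs k i))"
  proof (rule sum_mono)
    fix k assume "k \<in> {..<n}"
    then have x: "xs k \<in> tuples m X" using xs by auto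
    have "cmod (product_form \<phi> (xs k)) = (\<Prod>i=1..m. cmod (\<phi> i (xs k i)))"
      using x by (simp add: product_form_def prod_norm)
    also have "\<dots> \<le> (\<Prod>i=1..m. nrm (X i) (xs k i))"
      using \<phi> tuples_component[OF x] by (intro prod_mono) (auto simp: dual_families_def dual_ball_def)
    finally show "cmod (product_form \<phi> (xs k)) \<le> (\<Prod>i=1..m. nrm (X i) (xs k i))" .
  qed
  finally show ?thesis .
qed

lemma injective_bdd:
  assumes "u \<in> tensors"
  shows "bdd_above ((\<lambda>\<phi>. cmod (u (product_form \<phi>))) ` dual_families)"
  using assms
proof (rule tensorsE)
  fix n xs assume "xs \<in> {..<n} \<rightarrow> tuples m X" "u = tensor_sum m X n xs"
  then show ?thesis using product_form_tensor_sum_le by (intro bdd_aboveI2) auto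
qed

lemma injective_norm_upper:
  "u \<in> tensors \<Longrightarrow> \<phi> \<in> dual_families \<Longrightarrow> cmod (u (product_form \<phi>)) \<le> injective_norm m X u"
  unfolding injective_norm_eq by (intro cSUP_upper injective_bdd)

text \<open>Keeps the set under the supremum nonempty, so that the supremum obeys its
  bounds.\<close>

lemma zero_in_dual_families: "(\<lambda>_ _. 0) \<in> dual_families"
  unfolding dual_families_def dual_ball_def
  using normed by (auto intro!: clinear_mapI simp: complex_normed_space.nrm_nonneg)

lemma injective_norm_nonneg: "u \<in> tensors \<Longrightarrow> 0 \<le> injective_norm m X u"
  by (rule order_trans[OF norm_ge_zero injective_norm_upper[OF _ zero_in_dual_families]])

lemma injective_norm_least:
  assumes "\<And>\<phi>. \<phi> \<in> dual_families \<Longrightarrow> cmod (u (product_form \<phi>)) \<le> B"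
  shows "injective_norm m X u \<le> B"
  unfolding injective_norm_eq using assms zero_in_dual_families by (intro cSUP_least) auto

text \<open>Vanishing on products of bounded functionals must imply vanishing on every multilinear
  form. On the finitely many vectors of a representation, each coordinate of the form can be
  expanded in bounded functionals, so all forms reduce to such products.\<close>

lemma tensor_eq_zeroI:
  assumes u: "u \<in> tensors" and zero: "\<And>\<phi>. \<phi> \<in> dual_families \<Longrightarrow> u (product_form \<phi>) = 0"
  shows "u = (\<lambda>F\<in>forms. 0)"
  using u
proof (rule tensorsE)
  fix n xs assume xs: "xs \<in> {..<n} \<rightarrow> tuples m X" and u_eq: "u = tensor_sum m X n xs"
  have x_tup: "xs k \<in> tuples m X" if "k < n" for k using xs that by auto
  have bounded_zero: "(\<Sum>k<n. \<Prod>i=1..m. \<phi> i (xs k i)) = 0"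
    if \<phi>: "\<And>i. i \<in> {1..m} \<Longrightarrow> bounded_op (X i) complex_line (\<phi> i)" for \<phi>
  proof -
    have "\<exists>K>0. \<forall>x\<in>carrier (X i). cmod (\<phi> i x) \<le> K * nrm (X i) x" if i: "i \<in> {1..m}" for i
    proof -
      obtain K where "0 \<le> K" and K: "\<forall>x\<in>carrier (X i). cmod (\<phi> i x) \<le> K * nrm (X i) x"
        using bounded_opE[OF normed[OF i] \<phi>[OF i]] by (metis complex_line_simps(7))
      have "K * nrm (X i) x \<le> (K + 1) * nrm (X i) x" if "x \<in> carrier (X i)" for x
        using complex_normed_space.nrm_nonneg[OF normed[OF i] that] by (intro mult_right_mono) auto
      then show ?thesis
        using K \<open>0 \<le> K\<close> by (intro exI[of _ "K + 1"]) (auto intro: order_trans)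
    qed
    then have "\<forall>i. \<exists>K. i \<in> {1..m} \<longrightarrow> 0 < K \<and> (\<forall>x\<in>carrier (X i). cmod (\<phi> i x) \<le> K * nrm (X i) x)"
      by blast
    from choice[OF this] obtain K where K:
      "\<forall>i. i \<in> {1..m} \<longrightarrow> 0 < K i \<and> (\<forall>x\<in>carrier (X i). cmod (\<phi> i x) \<le> K i * nrm (X i) x)" ..
    \<comment> \<open>Scaling brings the functionals into the dual balls; the constants are made
      positive so that the scaling can be undone.\<close>
    define \<phi>' where "\<phi>' i x = \<phi> i x / complex_of_real (K i)" for i x
    have \<phi>': "\<phi>' \<in> dual_families"
      unfolding dual_families_def dual_ball_def
    proof (intro CollectI ballI conjI)
      fix i assume i: "i \<in> {1..m}"
      have "clinear_map (X i) complex_line (\<phi> i)" using \<phi>[OF i] by (simp add: bounded_op_def)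
      then show "clinear_map (X i) complex_line (\<phi>' i)"
        using clinear_mapD(2,3) by (intro clinear_mapI) (simp_all add: \<phi>'_def clinear_mapD add_divide_distrib)
      show "cmod (\<phi>' i x) \<le> nrm (X i) x" if "x \<in> carrier (X i)" for x
        using K i that by (auto simp: \<phi>'_def norm_divide pos_divide_le_eq mult.commute)
    qed
    have "(\<Sum>k<n. \<Prod>i=1..m. \<phi>' i (xs k i)) = u (product_form \<phi>')"
      unfolding u_eq tensor_sum_apply[OF dual_families_form[OF \<phi>']] using x_tup
      by (intro sum.cong) (simp_all add: product_form_def del: One_nat_def)
    then have "(\<Sum>k<n. \<Prod>i=1..m. \<phi>' i (xs k i)) = 0"
      unfolding zero[OF \<phi>'] .
    moreover have "(\<Sum>k<n. \<Prod>i=1..m. \<phi>' i (xs k i)) = (\<Sum>k<n. \<Prod>i=1..m. \<phi> i (xs k i)) / complex_of_real (\<Prod>i=1..m. K i)"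
      by (simp add: \<phi>'_def prod_dividef sum_divide_distrib)
    moreover have "(\<Prod>i=1..m. K i) \<noteq> 0" using K by (force simp: prod_zero_iff)
    ultimately show ?thesis by simp
  qed
  text \<open>The arguments of \<open>F\<close> are freed one coordinate at a time, starting from a constant.\<close>
  have main: "(\<Sum>k<n. F (\<lambda>i. if i \<le> j then xs k i else e i) * (\<Prod>i\<in>{Suc j..m}. \<phi> i (xs k i))) = 0"
    if "j \<le> m" "F \<in> forms" "e \<in> tuples m X" "\<And>i. i \<in> {1..m} \<Longrightarrow> bounded_op (X i) complex_line (\<phi> i)"
    for j F e \<phi>
    using that
  proof (induction j arbitrary: F e \<phi>)
    case 0
    have "(\<lambda>i. if i \<le> 0 then xs k i else e i) = e" if "k < n" for k
      using x_tup[OF that] 0 by (auto simp: fun_eq_iff PiE_iff extensional_def)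
    then have "(\<Sum>k<n. F (\<lambda>i. if i \<le> 0 then xs k i else e i) * (\<Prod>i\<in>{Suc 0..m}. \<phi> i (xs k i)))
        = (\<Sum>k<n. F e * (\<Prod>i=1..m. \<phi> i (xs k i)))"
      by (intro sum.cong) auto
    also have "\<dots> = F e * (\<Sum>k<n. \<Prod>i=1..m. \<phi> i (xs k i))"
      by (rule sum_distrib_left[symmetric])
    finally have "(\<Sum>k<n. F (\<lambda>i. if i \<le> 0 then xs k i else e i) * (\<Prod>i\<in>{Suc 0..m}. \<phi> i (xs k i)))
        = F e * (\<Sum>k<n. \<Prod>i=1..m. \<phi> i (xs k i))" .
    then show ?case using bounded_zero[OF 0(4)] by simp
  next
    case (Suc j)
    let ?i = "Suc j"
    have i: "?i \<in> {1..m}" using Suc.prems by simp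
    have "\<exists>L \<psi> g. (\<forall>l<(L::nat). bounded_op (X ?i) complex_line (\<psi> l) \<and> g l \<in> carrier (X ?i)) \<and>
      (\<forall>k<n. \<forall>h. clinear_map (X ?i) complex_line h \<longrightarrow> h (xs k ?i) = (\<Sum>l<L. \<psi> l (xs k ?i) * h (g l)))"
      using normed[OF i] tuples_component[OF x_tup i] by (rule finite_rank_reproduction)
    then obtain L :: nat and \<psi> g where
      Lg: "(\<forall>l<L. bounded_op (X ?i) complex_line (\<psi> l) \<and> g l \<in> carrier (X ?i)) \<and>
      (\<forall>k<n. \<forall>h. clinear_map (X ?i) complex_line h \<longrightarrow> h (xs k ?i) = (\<Sum>l<L. \<psi> l (xs k ?i) * h (g l)))"
      by (elim exE)
    define z where "z k = (\<lambda>i. if i \<le> j then xs k i else e i)" for k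
    have z: "z k \<in> tuples m X" if "k < n" for k
      using x_tup[OF that] Suc.prems(3) by (auto simp: z_def PiE_iff extensional_def)
    \<comment> \<open>Reproduction in coordinate \<open>Suc j\<close> turns the free argument of F
      into a fixed vector \<open>g l\<close>, stored in e, and a bounded functional
      \<open>\<psi> l\<close>, stored in \<open>\<phi>\<close>. What remains has only j free
      coordinates.\<close>
    have term_eq: "F (\<lambda>i. if i \<le> ?i then xs k i else e i) * (\<Prod>i\<in>{Suc ?i..m}. \<phi> i (xs k i))
      = (\<Sum>l<L. F (\<lambda>i. if i \<le> j then xs k i else (e(?i := g l)) i) * (\<Prod>i\<in>{Suc j..m}. (\<phi>(?i := \<psi> l)) i (xs k i)))"
      if k: "k < n" for k
    proof -
      have "F (\<lambda>i. if i \<le> ?i then xs k i else e i) = F ((z k)(?i := xs k ?i))"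
        by (rule arg_cong[where f = F]) (auto simp: z_def fun_eq_iff le_Suc_eq)
      also have "\<dots> = (\<Sum>l<L. \<psi> l (xs k ?i) * F ((z k)(?i := g l)))"
        using conjunct2[OF Lg, rule_format, OF k form_linear[OF Suc.prems(2) z[OF k] i]] .
      also have "\<dots> = (\<Sum>l<L. \<psi> l (xs k ?i) * F (\<lambda>i. if i \<le> j then xs k i else (e(?i := g l)) i))"
        by (intro sum.cong refl arg_cong2[where f = "(*)"] arg_cong[where f = F]) (auto simp: z_def fun_eq_iff)
      finally have "F (\<lambda>i. if i \<le> ?i then xs k i else e i) * (\<Prod>i\<in>{Suc ?i..m}. \<phi> i (xs k i))
        = (\<Sum>l<L. F (\<lambda>i. if i \<le> j then xs k i else (e(?i := g l)) i) * (\<psi> l (xs k ?i) * (\<Prod>i\<in>{Suc ?i..m}. \<phi> i (xs k i))))"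
        by (simp add: sum_distrib_left mult_ac)
      moreover have "(\<Prod>i\<in>{Suc j..m}. (\<phi>(?i := \<psi> l)) i (xs k i)) = \<psi> l (xs k ?i) * (\<Prod>i\<in>{Suc ?i..m}. \<phi> i (xs k i))" for l
      proof -
        have "{Suc j..m} = insert ?i {Suc ?i..m}" using i by auto
        moreover have "(\<Prod>i\<in>{Suc ?i..m}. (\<phi>(?i := \<psi> l)) i (xs k i)) = (\<Prod>i\<in>{Suc ?i..m}. \<phi> i (xs k i))"
          by (intro prod.cong) auto
        ultimately show ?thesis by simp
      qed
      ultimately show ?thesis by simp
    qed
    have "(\<Sum>k<n. F (\<lambda>i. if i \<le> j then xs k i else (e(?i := g l)) i) * (\<Prod>i\<in>{Suc j..m}. (\<phi>(?i := \<psi> l)) i (xs k i))) = 0"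
      if l: "l < L" for l
      using Suc.prems Lg l i by (intro Suc.IH tuples_upd) auto
    then have "(\<Sum>l<L. \<Sum>k<n. F (\<lambda>i. if i \<le> j then xs k i else (e(?i := g l)) i) * (\<Prod>i\<in>{Suc j..m}. (\<phi>(?i := \<psi> l)) i (xs k i))) = 0"
      by (intro sum.neutral) auto
    then have "(\<Sum>k<n. \<Sum>l<L. F (\<lambda>i. if i \<le> j then xs k i else (e(?i := g l)) i) * (\<Prod>i\<in>{Suc j..m}. (\<phi>(?i := \<psi> l)) i (xs k i))) = 0"
      by (rule trans[OF sum.swap])
    moreover have "(\<Sum>k<n. F (\<lambda>i. if i \<le> ?i then xs k i else e i) * (\<Prod>i\<in>{Suc ?i..m}. \<phi> i (xs k i)))
      = (\<Sum>k<n. \<Sum>l<L. F (\<lambda>i. if i \<le> j then xs k i else (e(?i := g l)) i) * (\<Prod>i\<in>{Suc j..m}. (\<phi>(?i := \<psi> l)) i (xs k i)))"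
      by (rule sum.cong[OF refl term_eq]) simp
    ultimately show ?case by (rule trans[rotated])
  qed
  have "(\<Sum>k<n. F (xs k)) = 0" if F: "F \<in> forms" for F
  proof -
    define e where "e = (\<lambda>i\<in>{1..m}. \<zero>\<^bsub>X i\<^esub>)"
    have C: "\<zero>\<^bsub>X i\<^esub> \<in> carrier (X i)" if "i \<in> {1..m}" for i
    proof -
      interpret complex_normed_space "X i" using normed[OF that] .
      show ?thesis by simp
    qed
    then have e: "e \<in> tuples m X" by (simp add: e_def)
    have z: "bounded_op (X i) complex_line (\<lambda>_. 0)" if "i \<in> {1..m}" for i
      unfolding bounded_op_def by (auto intro!: clinear_mapI exI[of _ 0])
    have xs_eq: "(\<lambda>i. if i \<le> m then xs k i else e i) = xs k" if "k < n" for k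
      using x_tup[OF that] by (auto simp: e_def fun_eq_iff PiE_iff extensional_def)
    have "(\<Sum>k<n. F (xs k)) = (\<Sum>k<n. F (\<lambda>i. if i \<le> m then xs k i else e i) * (\<Prod>i\<in>{Suc m..m}. 0))"
      using xs_eq by (intro sum.cong refl) simp
    also have "\<dots> = 0"
      using main[OF order_refl F e, of "\<lambda>_ _. 0"] z by simp
    finally show ?thesis .
  qed
  then show ?thesis
    unfolding u_eq tensor_sum_def by (auto simp: fun_eq_iff)
qed

lemma injective_normed_space: "complex_normed_space (tensor_product m X (injective_norm m X))"
proof (rule complex_normed_space.intro[OF tensor_module], unfold_locales, unfold tensor_product_simps)
  fix u c assume u: "u \<in> tensors"
  show nonneg: "0 \<le> injective_norm m X u"
    by (rule injective_norm_nonneg[OF u])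
  show "injective_norm m X u = 0 \<longleftrightarrow> u = (\<lambda>F\<in>forms. 0)"
  proof
    assume "injective_norm m X u = 0"
    then show "u = (\<lambda>F\<in>forms. 0)"
      using injective_norm_upper[OF u] by (intro tensor_eq_zeroI[OF u]) auto
  next
    assume "u = (\<lambda>F\<in>forms. 0)"
    then have "injective_norm m X u \<le> 0"
      by (intro injective_norm_least) (simp add: dual_families_form)
    then show "injective_norm m X u = 0" using nonneg by simp
  qed
  \<comment> \<open>The reverse inequality is this one applied to the scaled tensor with the factor
    \<open>inverse c\<close>.\<close>
  have le: "injective_norm m X (\<lambda>F\<in>forms. c * v F) \<le> cmod c * injective_norm m X v" if "v \<in> tensors" for c v
    by (rule injective_norm_least)
      (simp add: dual_families_form norm_mult mult_left_mono injective_norm_upper that)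
  show "injective_norm m X (\<lambda>F\<in>forms. c * u F) = cmod c * injective_norm m X u"
  proof (rule antisym[OF le[OF u]])
    show "cmod c * injective_norm m X u \<le> injective_norm m X (\<lambda>F\<in>forms. c * u F)"
    proof (cases "c = 0")
      case True
      then show ?thesis
        using injective_norm_nonneg[OF tensors_smult[OF u, of c]] by simp
    next
      case False
      have "(\<lambda>F\<in>forms. inverse c * (\<lambda>F\<in>forms. c * u F) F) = u"
        using False tensors_extensional[OF u] by (auto simp: fun_eq_iff extensional_def)
      then have "injective_norm m X u \<le> cmod (inverse c) * injective_norm m X (\<lambda>F\<in>forms. c * u F)"
        using le[OF tensors_smult[OF u], of "inverse c" c] by simp
      then show ?thesis using False by (simp add: norm_divide field_simps)
    qed
  qed
next
  fix u v assume u: "u \<in> tensors" and v: "v \<in> tensors"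
  show "injective_norm m X (\<lambda>F\<in>forms. u F + v F) \<le> injective_norm m X u + injective_norm m X v"
  proof (rule injective_norm_least)
    fix \<phi> assume \<phi>: "\<phi> \<in> dual_families"
    have "cmod ((\<lambda>F\<in>forms. u F + v F) (product_form \<phi>)) \<le> cmod (u (product_form \<phi>)) + cmod (v (product_form \<phi>))"
      using dual_families_form[OF \<phi>] by (simp add: norm_triangle_ineq)
    also have "\<dots> \<le> injective_norm m X u + injective_norm m X v"
      using u v \<phi> by (intro add_mono injective_norm_upper)
    finally show "cmod ((\<lambda>F\<in>forms. u F + v F) (product_form \<phi>)) \<le> injective_norm m X u + injective_norm m X v" .
  qed
qed

section \<open>The projective norm\<close>

definition projective_costs :: "'a tensor \<Rightarrow> real set" where
  "projective_costs u = {\<Sum>k<n. \<Prod>i=1..m. nrm (X i) (xs k i) | n xs.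
     xs \<in> {..<n} \<rightarrow> tuples m X \<and> u = tensor_sum m X n xs}"

lemma projective_norm_eq: "projective_norm m X u = Inf (projective_costs u)"
  by (simp add: projective_norm_def projective_costs_def)

lemma projective_costI:
  "xs \<in> {..<n} \<rightarrow> tuples m X \<Longrightarrow>
    (\<Sum>k<n. \<Prod>i=1..m. nrm (X i) (xs k i)) \<in> projective_costs (tensor_sum m X n xs)"
  unfolding projective_costs_def by blast

lemma projective_costE:
  assumes "t \<in> projective_costs u"
  obtains n xs where "xs \<in> {..<n} \<rightarrow> tuples m X" "u = tensor_sum m X n xs"
    "t = (\<Sum>k<n. \<Prod>i=1..m. nrm (X i) (xs k i))"
  using assms unfolding projective_costs_def by blast

lemma projective_costs_nonneg: "t \<in> projective_costs u \<Longrightarrow> 0 \<le> t"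
proof (erule projective_costE)
  fix n xs assume xs: "xs \<in> {..<n} \<rightarrow> tuples m X" and t: "t = (\<Sum>k<n. \<Prod>i=1..m. nrm (X i) (xs k i))"
  have "0 \<le> nrm (X i) (xs k i)" if "k < n" "i \<in> {1..m}" for k i
    using xs that by (intro complex_normed_space.nrm_nonneg normed tuples_component) auto
  then show "0 \<le> t" unfolding t by (intro sum_nonneg prod_nonneg) auto
qed

lemma projective_costs_nonempty: "u \<in> tensors \<Longrightarrow> projective_costs u \<noteq> {}"
  by (elim tensorsE) (use projective_costI in blast)

lemma projective_norm_lower: "t \<in> projective_costs u \<Longrightarrow> projective_norm m X u \<le> t"
  unfolding projective_norm_eq by (rule cInf_lower) (auto intro: projective_costs_nonneg bdd_belowI[of _ 0])

lemma projective_norm_greatest: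
  "u \<in> tensors \<Longrightarrow> (\<And>t. t \<in> projective_costs u \<Longrightarrow> b \<le> t) \<Longrightarrow> b \<le> projective_norm m X u"
  unfolding projective_norm_eq by (rule cInf_greatest[OF projective_costs_nonempty])

text \<open>The cost of any representation bounds every product of contractive functionals.
  Definiteness thereby passes from the injective to the projective norm.\<close>

lemma injective_le_projective: "u \<in> tensors \<Longrightarrow> injective_norm m X u \<le> projective_norm m X u"
  by (intro projective_norm_greatest injective_norm_least)
    (auto elim!: projective_costE intro: product_form_tensor_sum_le)

lemma projective_normed_space: "complex_normed_space (tensor_product m X (projective_norm m X))"
proof (rule complex_normed_space.intro[OF tensor_module], unfold_locales, unfold tensor_product_simps)
  interpret inj: complex_normed_space "tensor_product m X (injective_norm m X)"
    by (rule injective_normed_space)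
  fix u c assume u: "u \<in> tensors"
  show nonneg: "0 \<le> projective_norm m X u"
    using u projective_costs_nonneg by (intro projective_norm_greatest)
  show "projective_norm m X u = 0 \<longleftrightarrow> u = (\<lambda>F\<in>forms. 0)"
  proof
    assume "projective_norm m X u = 0"
    then have "injective_norm m X u = 0"
      using injective_le_projective[OF u] inj.nrm_nonneg[of u] u by simp
    then show "u = (\<lambda>F\<in>forms. 0)" using inj.nrm_eq_0_iff[of u] u by simp
  next
    assume "u = (\<lambda>F\<in>forms. 0)"
    then have "0 \<in> projective_costs u"
      using projective_costI[of "\<lambda>_. undefined" 0] by (simp add: tensor_sum_def)
    then show "projective_norm m X u = 0" using nonneg projective_norm_lower by force
  qed
  have le: "projective_norm m X (\<lambda>F\<in>forms. c * v F) \<le> cmod c * t"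
    if "t \<in> projective_costs v" for c v t
    using that
  proof (rule projective_costE)
    fix n xs assume xs: "xs \<in> {..<n} \<rightarrow> tuples m X" and v: "v = tensor_sum m X n xs"
      and t: "t = (\<Sum>k<n. \<Prod>i=1..m. nrm (X i) (xs k i))"
    show ?thesis
      using projective_norm_lower[OF projective_costI[OF tensor_sum_smult(1)[OF xs, of c]]]
      unfolding v t tensor_sum_smult(2)[OF xs] tensor_sum_smult(3)[OF xs] .
  qed
  \<comment> \<open>Dividing by the modulus of c carries the bound through the infimum, which is why
    c = 0 is handled apart.\<close>
  have le': "projective_norm m X (\<lambda>F\<in>forms. c * v F) \<le> cmod c * projective_norm m X v"
    if v: "v \<in> tensors" "c \<noteq> 0" for c v
  proof -
    have "projective_norm m X (\<lambda>F\<in>forms. c * v F) / cmod c \<le> projective_norm m X v"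
      using le v by (intro projective_norm_greatest) (auto simp: pos_divide_le_eq mult.commute)
    then show ?thesis using v by (simp add: pos_divide_le_eq mult.commute)
  qed
  show "projective_norm m X (\<lambda>F\<in>forms. c * u F) = cmod c * projective_norm m X u"
  proof (cases "c = 0")
    case True
    have "projective_norm m X (\<lambda>F\<in>forms. c * u F) \<le> 0"
      using projective_costs_nonempty[OF u] le[of _ u c] True by fastforce
    moreover have "0 \<le> projective_norm m X (\<lambda>F\<in>forms. c * u F)"
      using projective_costs_nonneg by (intro projective_norm_greatest tensors_smult u)
    ultimately show ?thesis using True by simp
  next
    case False
    have "(\<lambda>F\<in>forms. inverse c * (\<lambda>F\<in>forms. c * u F) F) = u"
      using False tensors_extensional[OF u] by (auto simp: fun_eq_iff extensional_def)
    then have "projective_norm m X u \<le> cmod (inverse c) * projective_norm m X (\<lambda>F\<in>forms. c * u F)"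
      using le'[OF tensors_smult[OF u], of "inverse c" c] False by simp
    then have "cmod c * projective_norm m X u \<le> projective_norm m X (\<lambda>F\<in>forms. c * u F)"
      using False by (simp add: norm_divide field_simps)
    then show ?thesis using le'[OF u False] by simp
  qed
next
  fix u v assume u: "u \<in> tensors" and v: "v \<in> tensors"
  let ?w = "\<lambda>F\<in>forms. u F + v F"
  have "projective_norm m X ?w \<le> t + t'" if t: "t \<in> projective_costs u" and t': "t' \<in> projective_costs v" for t t'
    using t
  proof (rule projective_costE)
    fix n xs assume xs: "xs \<in> {..<n} \<rightarrow> tuples m X" and u_eq: "u = tensor_sum m X n xs"
      and t_eq: "t = (\<Sum>k<n. \<Prod>i=1..m. nrm (X i) (xs k i))"
    show ?thesis
      using t'
    proof (rule projective_costE)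
      fix n' xs' assume xs': "xs' \<in> {..<n'} \<rightarrow> tuples m X" and v_eq: "v = tensor_sum m X n' xs'"
        and t'_eq: "t' = (\<Sum>k<n'. \<Prod>i=1..m. nrm (X i) (xs' k i))"
      show ?thesis
        using projective_norm_lower[OF projective_costI[OF tensor_sum_add(1)[OF xs xs']]]
        unfolding u_eq v_eq t_eq t'_eq tensor_sum_add(2)[OF xs xs']
          tensor_sum_add(3)[OF xs xs', of "\<lambda>x. \<Prod>i=1..m. nrm (X i) (x i)"] .
    qed
  qed
  \<comment> \<open>The infima over the two costs are taken one at a time, with the other quantity
    moved to the left.\<close>
  then have "projective_norm m X ?w - t' \<le> projective_norm m X u" if "t' \<in> projective_costs v" for t'
    using that by (intro projective_norm_greatest u) (simp add: algebra_simps)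
  then have "projective_norm m X ?w - projective_norm m X u \<le> projective_norm m X v"
    by (intro projective_norm_greatest v) (simp add: algebra_simps)
  then show "projective_norm m X ?w \<le> projective_norm m X u + projective_norm m X v" by simp
qed

end

section \<open>The tensor product of expansions\<close>

lemma L2_set_norm_sum_le:
  fixes f :: "'k \<Rightarrow> 'n \<Rightarrow> complex"
  assumes "finite K"
  shows "L2_set (\<lambda>n. cmod (\<Sum>k\<in>K. f k n)) A \<le> (\<Sum>k\<in>K. L2_set (\<lambda>n. cmod (f k n)) A)"
  using assms
proof (induction K)
  case (insert k K)
  have "L2_set (\<lambda>n. cmod (\<Sum>k\<in>insert k K. f k n)) A
      \<le> L2_set (\<lambda>n. cmod (f k n) + cmod (\<Sum>k\<in>K. f k n)) A"
    using insert by (intro L2_set_mono) (auto simp: norm_triangle_ineq)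
  also have "\<dots> \<le> L2_set (\<lambda>n. cmod (f k n)) A + L2_set (\<lambda>n. cmod (\<Sum>k\<in>K. f k n)) A"
    by (rule L2_set_triangle_ineq)
  finally show ?case using insert by simp
qed (simp add: L2_set_def)

lemma norm_sum_mult_le_L2_set:
  fixes f g :: "'n \<Rightarrow> complex"
  shows "cmod (\<Sum>n\<in>A. f n * g n) \<le> L2_set (\<lambda>n. cmod (f n)) A * L2_set (\<lambda>n. cmod (g n)) A"
proof -
  have "cmod (\<Sum>n\<in>A. f n * g n) \<le> (\<Sum>n\<in>A. \<bar>cmod (f n)\<bar> * \<bar>cmod (g n)\<bar>)"
    by (rule order_trans[OF norm_sum]) (simp add: norm_mult)
  also have "\<dots> \<le> L2_set (\<lambda>n. cmod (f n)) A * L2_set (\<lambda>n. cmod (g n)) A"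
    by (rule L2_set_mult_ineq)
  finally show ?thesis .
qed

section \<open>Extending bounded functionals to the completion\<close>

context plain_normed_space
begin

definition extension :: "('a \<Rightarrow> complex) \<Rightarrow> (nat \<Rightarrow> 'a) set \<Rightarrow> complex" where
  "extension f P = lim (\<lambda>k. f ((SOME p. p \<in> P) k))"

text \<open>Boundedness makes the values along a Cauchy sequence Cauchy, and along equivalent
  sequences asymptotically equal; so the choice made in \<open>extension\<close> does not affect the
  limit.\<close>

lemma extension_lim:
  assumes f: "clinear_map X complex_line f" and K: "\<And>x. x \<in> carrier X \<Longrightarrow> cmod (f x) \<le> K * nrm X x"
    and p: "ncauchy X p"
  shows "(\<lambda>k. f (p k)) \<longlonglongrightarrow> extension f (cls p)"
proof -
  define q where "q = (SOME q. q \<in> cls p)"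
  have "p \<in> cls p"
    using p equiv_class_self[OF equiv_cauchy_rel] by blast
  then have "q \<in> cls p"
    unfolding q_def by (rule someI[of "\<lambda>q. q \<in> cls p"])
  then have q: "ncauchy X q" and pq: "(\<lambda>n. nrm X (p n \<ominus> q n)) \<longlonglongrightarrow> 0"
    by (auto simp: cauchy_rel_iff)
  note [simp] = p[THEN ncauchy_carrier] q[THEN ncauchy_carrier]
  have diff: "cmod (f x - f y) \<le> K * nrm X (x \<ominus> y)" if "x \<in> carrier X" "y \<in> carrier X" for x y
    using clinear_mapD(2)[OF f, of "x \<ominus> y" y] K[of "x \<ominus> y"] that by (simp add: minus_add_cancel)
  have "Cauchy (\<lambda>k. f (q k))"
    unfolding Cauchy_iff
  proof (intro allI impI)
    fix e :: real assume e: "0 < e"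
    then have "0 < e / (\<bar>K\<bar> + 1)" by (intro divide_pos_pos) auto
    then obtain N where N: "\<And>n n'. n \<ge> N \<Longrightarrow> n' \<ge> N \<Longrightarrow> nrm X (q n \<ominus> q n') < e / (\<bar>K\<bar> + 1)"
      using q unfolding ncauchy_iff by meson
    have "cmod (f (q n) - f (q n')) < e" if "n \<ge> N" "n' \<ge> N" for n n'
    proof -
      have "cmod (f (q n) - f (q n')) \<le> K * nrm X (q n \<ominus> q n')" by (rule diff) simp_all
      also have "\<dots> \<le> (\<bar>K\<bar> + 1) * nrm X (q n \<ominus> q n')"
        by (intro mult_right_mono) (auto simp: nrm_nonneg)
      also have "\<dots> < e"
        using N[OF that] by (simp add: pos_less_divide_eq add_nonneg_pos mult.commute)
      finally show ?thesis .
    qed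
    then show "\<exists>N. \<forall>n\<ge>N. \<forall>n'\<ge>N. norm (f (q n) - f (q n')) < e" by blast
  qed
  then have L: "(\<lambda>k. f (q k)) \<longlonglongrightarrow> extension f (cls p)"
    using Cauchy_convergent convergent_LIMSEQ_iff unfolding extension_def q_def by blast
  have "(\<lambda>k. f (p k) - f (q k)) \<longlonglongrightarrow> 0"
    by (rule Lim_null_comparison[OF _ tendsto_mult_right_zero[OF pq, of K]]) (simp add: diff)
  from tendsto_add[OF this L] show ?thesis by simp
qed

end

context tensor_factors
begin

lemma injective_diff_le:
  assumes "u \<in> tensors" "v \<in> tensors"
    and "\<And>\<phi>. \<phi> \<in> dual_families \<Longrightarrow> cmod (u (product_form \<phi>) - v (product_form \<phi>)) \<le> B"
  shows "injective_norm m X (u \<ominus>\<^bsub>tensor_product m X (injective_norm m X)\<^esub> v) \<le> B"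
proof (rule injective_norm_least)
  interpret inj: complex_normed_space "tensor_product m X (injective_norm m X)"
    by (rule injective_normed_space)
  fix \<phi> assume \<phi>: "\<phi> \<in> dual_families"
  have "(u \<ominus>\<^bsub>tensor_product m X (injective_norm m X)\<^esub> v) (product_form \<phi>)
      = u (product_form \<phi>) - v (product_form \<phi>)"
    using assms(2) dual_families_form[OF \<phi>]
    by (simp add: inj.M.minus_eq inj.uminus_eq_smult)
  then show "cmod ((u \<ominus>\<^bsub>tensor_product m X (injective_norm m X)\<^esub> v) (product_form \<phi>)) \<le> B"
    using assms(3)[OF \<phi>] by simp
qed

end

text \<open>The expansions of all factors together with one rearrangement of their product
  coefficients. Lorentz summability of c enters only in
  \<open>tensor_operator_factors\<close>.\<close>

locale expanded_factors = X: tensor_factors m X + Y: tensor_factors m Y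
  for m :: nat and X :: "nat \<Rightarrow> 'a normed" and Y :: "nat \<Rightarrow> 'b normed" +
  fixes T :: "nat \<Rightarrow> 'a \<Rightarrow> 'b" and r s :: real and \<sigma> :: "nat \<Rightarrow> nat \<Rightarrow> real"
    and a :: "nat \<Rightarrow> nat \<Rightarrow> 'a \<Rightarrow> complex" and y :: "nat \<Rightarrow> nat \<Rightarrow> 'b" and C :: "nat \<Rightarrow> real"
    and c :: "nat \<Rightarrow> real" and \<pi> :: "nat \<Rightarrow> nat \<Rightarrow> nat"
  assumes T: "\<And>i x. i \<in> {1..m} \<Longrightarrow> x \<in> carrier (X i) \<Longrightarrow> T i x \<in> carrier (Y i)"
    and expansion: "\<And>i. i \<in> {1..m} \<Longrightarrow> lorentz_expansion r s (X i) (Y i) (T i) (\<sigma> i) (a i) (y i) (C i)"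
    and c_dec: "decseq c" and c_nonneg: "\<And>n. 0 \<le> c n" and c_null: "c \<longlonglongrightarrow> 0"
    and \<pi>_bij: "bij_betw \<pi> {n. 0 < c n} {j \<in> (\<Pi>\<^sub>E i\<in>{1..m}. UNIV). 0 < (\<Prod>i\<in>{1..m}. \<sigma> i (j i))}"
    and c_eq: "\<And>n. 0 < c n \<Longrightarrow> c n = (\<Prod>i\<in>{1..m}. \<sigma> i (\<pi> n i))"
begin

lemma expansionD:
  assumes i: "i \<in> {1..m}"
  shows "decseq (\<sigma> i)" "0 \<le> \<sigma> i n" "0 < C i" "clinear_map (X i) complex_line (a i n)" "y i n \<in> carrier (Y i)"
    "x \<in> carrier (X i) \<Longrightarrow> (\<Sum>n<N. (cmod (a i n x))\<^sup>2) \<le> (C i * nrm (X i) x)\<^sup>2"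
    "\<phi> \<in> dual_ball (Y i) \<Longrightarrow> (\<Sum>n<N. (cmod (\<phi> (y i n)))\<^sup>2) \<le> (C i)\<^sup>2"
    "\<phi> \<in> dual_ball (Y i) \<Longrightarrow> x \<in> carrier (X i) \<Longrightarrow>
      (\<lambda>n. complex_of_real (\<sigma> i n) * a i n x * \<phi> (y i n)) sums \<phi> (T i x)"
  using expansion[OF i] unfolding lorentz_expansion_def dual_ball_def by auto

definition G :: real where
  "G = (\<Prod>i=1..m. C i)"

lemma G_pos: "0 < G"
  unfolding G_def using expansionD(3) by (intro prod_pos) auto

lemma \<pi>_tuple: "0 < c n \<Longrightarrow> \<pi> n \<in> (\<Pi>\<^sub>E i\<in>{1..m}. UNIV)"
  using bij_betw_apply[OF \<pi>_bij, of n] by simp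

text \<open>Since \<open>\<pi>\<close> is injective, the square sum over positions is a square sum
  over distinct tuples and factors coordinatewise. With w built from \<open>a\<close> this bounds
  the map into l^2, with w built from \<open>y\<close> the map out of it.\<close>

lemma square_sum_product_le:
  assumes B: "\<And>i. i \<in> {1..m} \<Longrightarrow> 0 \<le> B i"
    and le: "\<And>i N. i \<in> {1..m} \<Longrightarrow> (\<Sum>k<N. (cmod (w i k))\<^sup>2) \<le> (B i)\<^sup>2"
  shows "L2_set (\<lambda>n. cmod (if 0 < c n then \<Prod>i=1..m. w i (\<pi> n i) else 0)) {..<N} \<le> (\<Prod>i=1..m. B i)"
proof -
  let ?P = "{n. n < N \<and> 0 < c n}"
  have "(\<Sum>n<N. (cmod (if 0 < c n then \<Prod>i=1..m. w i (\<pi> n i) else 0))\<^sup>2)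
      = (\<Sum>n\<in>?P. \<Prod>i\<in>{1..m}. (cmod (w i (\<pi> n i)))\<^sup>2)"
    by (rule sum.mono_neutral_cong_right) (auto simp: prod_norm[symmetric] prod_power_distrib)
  also have "\<dots> = (\<Sum>j\<in>\<pi> ` ?P. \<Prod>i\<in>{1..m}. (cmod (w i (j i)))\<^sup>2)"
    using bij_betw_imp_inj_on[OF \<pi>_bij] by (subst sum.reindex) (auto intro: inj_on_subset)
  also have "\<dots> \<le> (\<Prod>i\<in>{1..m}. (B i)\<^sup>2)"
    using \<pi>_tuple le by (intro sum_prod_PiE_le) auto
  also have "\<dots> = (\<Prod>i=1..m. B i)\<^sup>2" by (simp add: prod_power_distrib)
  finally show ?thesis
    unfolding L2_set_def using B by (intro real_le_lsqrt) (auto intro: sum_nonneg prod_nonneg)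
qed

definition coeff_form :: "nat \<Rightarrow> (nat \<Rightarrow> 'a) \<Rightarrow> complex" where
  "coeff_form n = X.product_form (\<lambda>i. a i (\<pi> n i))"

lemma coeff_form_in_forms: "coeff_form n \<in> X.forms"
  unfolding coeff_form_def using expansionD(4) by (intro X.product_form_in_forms)

text \<open>The value is set to 0 where c vanishes, because \<open>\<pi> n\<close> is tied to an
  index tuple only at positive coefficients.\<close>

definition coeff :: "nat \<Rightarrow> 'a tensor \<Rightarrow> complex" where
  "coeff n u = (if 0 < c n then u (coeff_form n) else 0)"

lemma coeff_elementary:
  assumes x: "x \<in> tuples m X"
  shows "coeff n (elementary_tensor m X x) = (if 0 < c n then \<Prod>i=1..m. a i (\<pi> n i) (x i) else 0)"
  using x coeff_form_in_forms[of n]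
  by (simp add: coeff_def elementary_tensor_def coeff_form_def X.product_form_def del: One_nat_def)

lemma coeff_elementary_le:
  assumes x: "x \<in> tuples m X"
  shows "L2_set (\<lambda>n. cmod (coeff n (elementary_tensor m X x))) {..<N} \<le> G * (\<Prod>i=1..m. nrm (X i) (x i))"
proof -
  have "L2_set (\<lambda>n. cmod (if 0 < c n then \<Prod>i=1..m. a i (\<pi> n i) (x i) else 0)) {..<N}
      \<le> (\<Prod>i=1..m. C i * nrm (X i) (x i))"
  proof (rule square_sum_product_le[where w = "\<lambda>i k. a i k (x i)"])
    fix i assume i: "i \<in> {1..m}"
    note xi = X.tuples_component[OF x i]
    show "0 \<le> C i * nrm (X i) (x i)"
      using expansionD(3)[OF i] complex_normed_space.nrm_nonneg[OF X.normed[OF i] xi] by simp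
    show "(\<Sum>k<N. (cmod (a i k (x i)))\<^sup>2) \<le> (C i * nrm (X i) (x i))\<^sup>2" for N
      by (rule expansionD(6)[OF i xi])
  qed
  then show ?thesis
    by (simp add: coeff_elementary[OF x] G_def prod.distrib del: One_nat_def)
qed

text \<open>Minkowski bounds the coefficients of a representation by G times its cost, and the
  infimum over all representations is the projective norm.\<close>

lemma coeff_le:
  assumes u: "u \<in> X.tensors"
  shows "L2_set (\<lambda>n. cmod (coeff n u)) {..<N} \<le> G * projective_norm m X u"
proof -
  have "L2_set (\<lambda>n. cmod (coeff n u)) {..<N} / G \<le> projective_norm m X u"
  proof (rule X.projective_norm_greatest[OF u], erule X.projective_costE)
    fix t n xs assume xs: "xs \<in> {..<n} \<rightarrow> tuples m X" and u_eq: "u = tensor_sum m X n xs"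
      and t: "t = (\<Sum>k<n. \<Prod>i=1..m. nrm (X i) (xs k i))"
    have "coeff n' u = (\<Sum>k<n. coeff n' (elementary_tensor m X (xs k)))" for n'
      using coeff_form_in_forms[of n'] by (simp add: coeff_def u_eq tensor_sum_def elementary_tensor_def)
    then have "L2_set (\<lambda>n. cmod (coeff n u)) {..<N}
        \<le> (\<Sum>k<n. L2_set (\<lambda>n'. cmod (coeff n' (elementary_tensor m X (xs k)))) {..<N})"
      by (simp add: L2_set_norm_sum_le)
    also have "\<dots> \<le> (\<Sum>k<n. G * (\<Prod>i=1..m. nrm (X i) (xs k i)))"
      using xs by (intro sum_mono coeff_elementary_le) auto
    finally show "L2_set (\<lambda>n. cmod (coeff n u)) {..<N} / G \<le> t"
      using G_pos by (simp add: t sum_distrib_left pos_divide_le_eq mult.commute)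
  qed
  then show ?thesis using G_pos by (simp add: pos_divide_le_eq mult.commute)
qed

abbreviation PX where "PX \<equiv> tensor_product m X (projective_norm m X)"
abbreviation IY where "IY \<equiv> tensor_product m Y (injective_norm m Y)"

sublocale PX: plain_normed_space PX
  by (rule plain_normed_space.intro[OF X.projective_normed_space])

sublocale IY: plain_normed_space IY
  by (rule plain_normed_space.intro[OF Y.injective_normed_space])

lemma coeff_clinear: "clinear_map PX complex_line (coeff n)"
  by (rule clinear_mapI) (simp_all add: coeff_def coeff_form_in_forms)

lemma coeff_bound: "u \<in> carrier PX \<Longrightarrow> cmod (coeff n u) \<le> G * nrm PX u"
proof -
  assume "u \<in> carrier PX"
  moreover have "cmod (coeff n u) \<le> L2_set (\<lambda>n. cmod (coeff n u)) {..<Suc n}"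
    by (rule member_le_L2_set) auto
  ultimately show ?thesis using coeff_le[of u "Suc n"] by simp
qed

section \<open>The map from the projective tensor product into l^2\<close>

definition analysis_op :: "'a ctensor \<Rightarrow> nat \<Rightarrow> complex" where
  "analysis_op P n = PX.extension (coeff n) P"

lemma analysis_lim: "ncauchy PX p \<Longrightarrow> (\<lambda>k. coeff n (p k)) \<longlonglongrightarrow> analysis_op (PX.cls p) n"
  unfolding analysis_op_def by (rule PX.extension_lim[OF coeff_clinear coeff_bound])

lemma analysis_op_bounded: "bounded_op (projective_tensor m X) ell2 analysis_op"
  unfolding projective_tensor_def bounded_op_def
proof (intro conjI exI ballI)
  have bd: "analysis_op P \<in> carrier ell2 \<and> nrm ell2 (analysis_op P) \<le> G * nrm (completion PX) P"
    if "P \<in> carrier (completion PX)" for P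
    using that
  proof (rule PX.completion_cases)
    fix p assume p: "ncauchy PX p" and P: "P = PX.cls p"
    \<comment> \<open>Both sides pass to the limit along the representative, for each fixed number
      of coordinates.\<close>
    have "(\<Sum>n<N. (cmod (analysis_op P n))\<^sup>2) \<le> (G * nrm (completion PX) P)\<^sup>2" for N
    proof (rule LIMSEQ_le)
      show "(\<lambda>k. \<Sum>n<N. (cmod (coeff n (p k)))\<^sup>2) \<longlonglongrightarrow> (\<Sum>n<N. (cmod (analysis_op P n))\<^sup>2)"
        unfolding P by (intro tendsto_intros analysis_lim p)
      show "(\<lambda>k. (G * nrm PX (p k))\<^sup>2) \<longlonglongrightarrow> (G * nrm (completion PX) P)\<^sup>2"
        unfolding P by (intro tendsto_intros PX.nrm_completion p)
      have "(\<Sum>n<N. (cmod (coeff n (p k)))\<^sup>2) \<le> (G * nrm PX (p k))\<^sup>2" for k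
        using coeff_le[of "p k" N] PX.ncauchy_carrier[OF p, of k] unfolding L2_set_def
        by (intro sqrt_le_D) simp
      then show "\<exists>K. \<forall>k\<ge>K. (\<Sum>n<N. (cmod (coeff n (p k)))\<^sup>2) \<le> (G * nrm PX (p k))\<^sup>2" by blast
    qed
    moreover have "0 \<le> G * nrm (completion PX) P"
      using G_pos complex_normed_space.nrm_nonneg[OF PX.completion_normed_space \<open>P \<in> _\<close>] by simp
    ultimately show ?thesis using ell2_boundedI by blast
  qed
  then show "nrm ell2 (analysis_op P) \<le> G * nrm (completion PX) P" if "P \<in> carrier (completion PX)" for P
    using that by blast
  show "clinear_map (completion PX) ell2 analysis_op"
  proof (rule clinear_mapI)
    show "analysis_op P \<in> carrier ell2" if "P \<in> carrier (completion PX)" for P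
      using bd[OF that] by blast
  next
    fix P Q assume "P \<in> carrier (completion PX)" "Q \<in> carrier (completion PX)"
    then obtain p q where p: "ncauchy PX p" "P = PX.cls p" and q: "ncauchy PX q" "Q = PX.cls q"
      by (metis PX.completion_cases)
    have "analysis_op (P \<oplus>\<^bsub>completion PX\<^esub> Q) n = analysis_op P n + analysis_op Q n" for n
    proof (rule LIMSEQ_unique)
      show "(\<lambda>k. coeff n (p k \<oplus>\<^bsub>PX\<^esub> q k)) \<longlonglongrightarrow> analysis_op (P \<oplus>\<^bsub>completion PX\<^esub> Q) n"
        unfolding p(2) q(2) PX.add_completion[OF p(1) q(1)]
        by (rule analysis_lim[OF PX.ncauchy_add[OF p(1) q(1)]])
      have "coeff n (p k \<oplus>\<^bsub>PX\<^esub> q k) = coeff n (p k) + coeff n (q k)" for k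
        using clinear_mapD(2)[OF coeff_clinear PX.ncauchy_carrier[OF p(1)] PX.ncauchy_carrier[OF q(1)]] by simp
      then show "(\<lambda>k. coeff n (p k \<oplus>\<^bsub>PX\<^esub> q k)) \<longlonglongrightarrow> analysis_op P n + analysis_op Q n"
        unfolding p(2) q(2) by (simp only:) (intro tendsto_add analysis_lim p q)
    qed
    then show "analysis_op (P \<oplus>\<^bsub>completion PX\<^esub> Q) = analysis_op P \<oplus>\<^bsub>ell2\<^esub> analysis_op Q"
      by (simp add: fun_eq_iff)
  next
    fix d P assume "P \<in> carrier (completion PX)"
    then obtain p where p: "ncauchy PX p" "P = PX.cls p"
      by (metis PX.completion_cases)
    have "analysis_op (d \<odot>\<^bsub>completion PX\<^esub> P) n = d * analysis_op P n" for n
    proof (rule LIMSEQ_unique)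
      show "(\<lambda>k. coeff n (d \<odot>\<^bsub>PX\<^esub> p k)) \<longlonglongrightarrow> analysis_op (d \<odot>\<^bsub>completion PX\<^esub> P) n"
        unfolding p(2) PX.smult_completion[OF p(1)]
        by (rule analysis_lim[OF PX.ncauchy_smult[OF p(1)]])
      have "coeff n (d \<odot>\<^bsub>PX\<^esub> p k) = d * coeff n (p k)" for k
        using clinear_mapD(3)[OF coeff_clinear PX.ncauchy_carrier[OF p(1)]] by simp
      then show "(\<lambda>k. coeff n (d \<odot>\<^bsub>PX\<^esub> p k)) \<longlonglongrightarrow> d * analysis_op P n"
        unfolding p(2) by (simp only:) (intro tendsto_mult_left analysis_lim p)
    qed
    then show "analysis_op (d \<odot>\<^bsub>completion PX\<^esub> P) = d \<odot>\<^bsub>ell2\<^esub> analysis_op P"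
      by (simp add: fun_eq_iff)
  qed
qed

section \<open>The map from l^2 into the injective tensor product\<close>

definition basis_tuple :: "nat \<Rightarrow> nat \<Rightarrow> 'b" where
  "basis_tuple n = (\<lambda>i\<in>{1..m}. y i (\<pi> n i))"

lemma basis_tuple_in_tuples: "basis_tuple n \<in> tuples m Y"
  unfolding basis_tuple_def using expansionD(5) by auto

definition basis_value :: "nat \<Rightarrow> ((nat \<Rightarrow> 'b) \<Rightarrow> complex) \<Rightarrow> complex" where
  "basis_value n F = (if 0 < c n then F (basis_tuple n) else 0)"

lemma basis_value_product_form:
  "basis_value n (Y.product_form \<phi>) = (if 0 < c n then \<Prod>i=1..m. \<phi> i (y i (\<pi> n i)) else 0)"
proof -
  have "Y.product_form \<phi> (basis_tuple n) = (\<Prod>i=1..m. \<phi> i (basis_tuple n i))"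
    using basis_tuple_in_tuples[of n] unfolding Y.product_form_def by simp
  also have "\<dots> = (\<Prod>i=1..m. \<phi> i (y i (\<pi> n i)))"
    by (intro prod.cong) (auto simp: basis_tuple_def)
  finally show ?thesis by (simp add: basis_value_def)
qed

lemma basis_value_le:
  assumes \<phi>: "\<phi> \<in> Y.dual_families"
  shows "L2_set (\<lambda>n. cmod (basis_value n (Y.product_form \<phi>))) {..<N} \<le> G"
  unfolding basis_value_product_form G_def
  using \<phi> expansionD(3,7) by (intro square_sum_product_le) (auto simp: Y.dual_families_def intro: less_imp_le)

lemma L2_set_interval_mono: "L2_set f {M..<N} \<le> L2_set f {..<N :: nat}"
  unfolding L2_set_def by (intro real_sqrt_le_mono sum_mono2) auto

definition partial_synthesis :: "(nat \<Rightarrow> complex) \<Rightarrow> nat \<Rightarrow> 'b tensor" where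
  "partial_synthesis v N = (\<lambda>F\<in>Y.forms. \<Sum>n<N. v n * basis_value n F)"

lemma partial_synthesis_in_tensors: "partial_synthesis v N \<in> Y.tensors"
proof (induction N)
  case 0
  show ?case using Y.tensors_zero by (simp only: partial_synthesis_def lessThan_0 sum.empty)
next
  case (Suc N)
  have "(\<lambda>F\<in>Y.forms. v N * basis_value N F) \<in> Y.tensors"
  proof (cases "0 < c N")
    case True
    then have "(\<lambda>F\<in>Y.forms. v N * basis_value N F) = (\<lambda>F\<in>Y.forms. v N * elementary_tensor m Y (basis_tuple N) F)"
      by (auto simp: basis_value_def elementary_tensor_def fun_eq_iff)
    then show ?thesis
      using Y.tensors_smult[OF Y.elementary_in_tensors[OF basis_tuple_in_tuples]] by simp
  next
    case False
    then have "(\<lambda>F\<in>Y.forms. v N * basis_value N F) = (\<lambda>F\<in>Y.forms. 0)"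
      by (auto simp: fun_eq_iff basis_value_def)
    then show ?thesis using Y.tensors_zero by (simp only:)
  qed
  moreover have "partial_synthesis v (Suc N)
      = (\<lambda>F\<in>Y.forms. partial_synthesis v N F + (\<lambda>F\<in>Y.forms. v N * basis_value N F) F)"
    by (auto simp: partial_synthesis_def fun_eq_iff)
  ultimately show ?case
    using Y.tensors_add[OF Suc] by (simp only:)
qed

text \<open>Cauchy-Schwarz on a block of coordinates. The factor G is the same for every family of
  functionals, as the supremum in the injective norm demands.\<close>

lemma synthesis_tail_le:
  assumes \<phi>: "\<phi> \<in> Y.dual_families" and "M \<le> N"
  shows "cmod (partial_synthesis v N (Y.product_form \<phi>) - partial_synthesis v M (Y.product_form \<phi>))
    \<le> L2_set (\<lambda>n. cmod (v n)) {M..<N} * G"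
proof -
  have eq: "partial_synthesis v N (Y.product_form \<phi>) - partial_synthesis v M (Y.product_form \<phi>)
      = (\<Sum>n\<in>{M..<N}. v n * basis_value n (Y.product_form \<phi>))"
    using Y.dual_families_form[OF \<phi>] sum_diff_nat_ivl[of 0 M N] \<open>M \<le> N\<close>
    by (simp add: partial_synthesis_def lessThan_atLeast0)
  show ?thesis
    unfolding eq
    by (rule order_trans[OF norm_sum_mult_le_L2_set mult_left_mono[OF
          order_trans[OF L2_set_interval_mono basis_value_le[OF \<phi>]] L2_set_nonneg]])
qed

lemma partial_synthesis_cauchy:
  assumes v: "v \<in> carrier ell2"
  shows "ncauchy IY (partial_synthesis v)"
  unfolding IY.ncauchy_iff
proof (intro conjI allI impI)
  show "partial_synthesis v N \<in> carrier IY" for N by (simp add: partial_synthesis_in_tensors)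
  fix e :: real assume e: "0 < e"
  have "summable (\<lambda>n. (cmod (v n))\<^sup>2)" using v by simp
  \<comment> \<open>Multiplying e / (2 G) by G leaves e / 2, so the supremum over all functionals
    stays strictly below e.\<close>
  then obtain K where K: "\<And>M N. K \<le> M \<Longrightarrow> norm (\<Sum>n\<in>{M..<N}. (cmod (v n))\<^sup>2) < (e / (2 * G))\<^sup>2"
    unfolding summable_Cauchy using e G_pos by (metis divide_pos_pos mult_pos_pos zero_less_numeral zero_less_power)
  have le: "nrm IY (partial_synthesis v N \<ominus>\<^bsub>IY\<^esub> partial_synthesis v M) < e" if "K \<le> M" "M \<le> N" for M N
  proof -
    have "(\<Sum>n\<in>{M..<N}. (cmod (v n))\<^sup>2) \<le> (e / (2 * G))\<^sup>2"
      using K[OF that(1), of N] by (simp add: abs_less_iff)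
    then have "L2_set (\<lambda>n. cmod (v n)) {M..<N} \<le> e / (2 * G)"
      unfolding L2_set_def using e G_pos by (intro real_le_lsqrt) (auto intro: sum_nonneg)
    then have "L2_set (\<lambda>n. cmod (v n)) {M..<N} * G \<le> e / (2 * G) * G"
      using G_pos by (intro mult_right_mono) auto
    also have "\<dots> = e / 2" using G_pos by simp
    finally have "cmod (partial_synthesis v N (Y.product_form \<phi>) - partial_synthesis v M (Y.product_form \<phi>)) \<le> e / 2"
      if "\<phi> \<in> Y.dual_families" for \<phi>
      by (rule order_trans[OF synthesis_tail_le[OF that \<open>M \<le> N\<close>]])
    then have "injective_norm m Y (partial_synthesis v N \<ominus>\<^bsub>IY\<^esub> partial_synthesis v M) \<le> e / 2"
      by (intro Y.injective_diff_le partial_synthesis_in_tensors)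
    then show ?thesis using e by simp
  qed
  have "nrm IY (partial_synthesis v M \<ominus>\<^bsub>IY\<^esub> partial_synthesis v N) < e" if "K \<le> M" "K \<le> N" for M N
  proof (cases "N \<le> M")
    case False
    then show ?thesis
      using le[of M N] that
      by (subst IY.nrm_minus_commute) (simp_all add: partial_synthesis_in_tensors)
  qed (use le that in blast)
  then show "\<exists>K. \<forall>M\<ge>K. \<forall>N\<ge>K. nrm IY (partial_synthesis v M \<ominus>\<^bsub>IY\<^esub> partial_synthesis v N) < e"
    by blast
qed

text \<open>The partial sums already form a Cauchy sequence, so the sum of the series is simply
  their class, and linearity can be checked termwise.\<close>

definition synthesis_op :: "(nat \<Rightarrow> complex) \<Rightarrow> 'b ctensor" where
  "synthesis_op v = IY.cls (partial_synthesis v)"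

lemma synthesis_op_bounded: "bounded_op ell2 (injective_tensor m Y) synthesis_op"
  unfolding injective_tensor_def bounded_op_def
proof (intro conjI exI ballI)
  show "clinear_map ell2 (completion IY) synthesis_op"
  proof (rule clinear_mapI)
    show "synthesis_op v \<in> carrier (completion IY)" if "v \<in> carrier ell2" for v
      unfolding synthesis_op_def by (rule IY.cls_in_completion[OF partial_synthesis_cauchy[OF that]])
  next
    fix v w assume v: "v \<in> carrier ell2" and w: "w \<in> carrier ell2"
    have "partial_synthesis (v \<oplus>\<^bsub>ell2\<^esub> w) = (\<lambda>N. partial_synthesis v N \<oplus>\<^bsub>IY\<^esub> partial_synthesis w N)"
      by (auto simp: fun_eq_iff partial_synthesis_def distrib_right sum.distrib)
    then show "synthesis_op (v \<oplus>\<^bsub>ell2\<^esub> w) = synthesis_op v \<oplus>\<^bsub>completion IY\<^esub> synthesis_op w"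
      unfolding synthesis_op_def
        IY.add_completion[OF partial_synthesis_cauchy[OF v] partial_synthesis_cauchy[OF w]]
      by (simp only:)
  next
    fix d v assume v: "v \<in> carrier ell2"
    have "partial_synthesis (d \<odot>\<^bsub>ell2\<^esub> v) = (\<lambda>N. d \<odot>\<^bsub>IY\<^esub> partial_synthesis v N)"
      by (auto simp: fun_eq_iff partial_synthesis_def sum_distrib_left mult.assoc)
    then show "synthesis_op (d \<odot>\<^bsub>ell2\<^esub> v) = d \<odot>\<^bsub>completion IY\<^esub> synthesis_op v"
      unfolding synthesis_op_def IY.smult_completion[OF partial_synthesis_cauchy[OF v]]
      by (simp only:)
  qed
  fix v assume v: "v \<in> carrier ell2"
  have "nrm IY (partial_synthesis v N) \<le> G * nrm ell2 v" for N
    unfolding Y.tensor_product_simps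
  proof (rule Y.injective_norm_least)
    fix \<phi> assume \<phi>: "\<phi> \<in> Y.dual_families"
    have "cmod (partial_synthesis v N (Y.product_form \<phi>)) \<le> L2_set (\<lambda>n. cmod (v n)) {0..<N} * G"
      using synthesis_tail_le[OF \<phi>, of 0 N v] Y.dual_families_form[OF \<phi>] by (simp add: partial_synthesis_def)
    also have "L2_set (\<lambda>n. cmod (v n)) {0..<N} \<le> nrm ell2 v"
      unfolding L2_set_def atLeast0LessThan
      using ell2_partial_sum_le[OF v] ell2_nrm_nonneg[OF v] by (intro real_le_lsqrt) (auto intro: sum_nonneg)
    finally show "cmod (partial_synthesis v N (Y.product_form \<phi>)) \<le> G * nrm ell2 v"
      using G_pos by (simp add: mult.commute mult_right_mono)
  qed
  then show "nrm (completion IY) (synthesis_op v) \<le> G * nrm ell2 v"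
    unfolding synthesis_op_def by (intro LIMSEQ_le_const2[OF IY.nrm_completion[OF partial_synthesis_cauchy[OF v]]]) blast
qed

text \<open>Each functional sees a product of convergent scalar series, reordered along
  \<open>\<pi>\<close>. Its remainder is at most \<open>c N\<close> times a constant independent of
  the functional, which upgrades weak convergence to convergence in the injective norm.\<close>

lemma partial_synthesis_tendsto:
  assumes x: "x \<in> tuples m X"
  defines "v \<equiv> \<lambda>n. complex_of_real (c n) * coeff n (elementary_tensor m X x)"
  defines "Q \<equiv> G * (\<Prod>i=1..m. nrm (X i) (x i)) * G"
  shows "nrm IY (partial_synthesis v N \<ominus>\<^bsub>IY\<^esub> elementary_tensor m Y (\<lambda>i\<in>{1..m}. T i (x i))) \<le> c N * Q"
  unfolding Y.tensor_product_simps
proof (rule Y.injective_diff_le)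
  have Tx: "(\<lambda>i\<in>{1..m}. T i (x i)) \<in> tuples m Y"
    using T X.tuples_component[OF x] by auto
  show "partial_synthesis v N \<in> Y.tensors" by (rule partial_synthesis_in_tensors)
  show "elementary_tensor m Y (\<lambda>i\<in>{1..m}. T i (x i)) \<in> Y.tensors"
    by (rule Y.elementary_in_tensors[OF Tx])
  fix \<phi> assume \<phi>: "\<phi> \<in> Y.dual_families"
  then have \<phi>_dual: "\<phi> i \<in> dual_ball (Y i)" if "i \<in> {1..m}" for i using that by (simp add: Y.dual_families_def)
  let ?F = "Y.product_form \<phi>"
  define g where "g i k = complex_of_real (\<sigma> i k) * a i k (x i) * \<phi> i (y i k)" for i k
  have g_sums: "g i sums \<phi> i (T i (x i))" if i: "i \<in> {1..m}" for i
    unfolding g_def using expansionD(8)[OF i \<phi>_dual[OF i] X.tuples_component[OF x i]] .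
  \<comment> \<open>Bounded coefficients times a product of two square-summable sequences are
    absolutely summable; the reordering requires this.\<close>
  have g_summable: "summable (\<lambda>k. cmod (g i k))" if i: "i \<in> {1..m}" for i
  proof (rule summable_comparison_test')
    have "summable (\<lambda>k. (cmod (a i k (x i)))\<^sup>2)"
      using expansionD(6)[OF i X.tuples_component[OF x i]] by (intro summableI_nonneg_bounded) auto
    moreover have "summable (\<lambda>k. (cmod (\<phi> i (y i k)))\<^sup>2)"
      using expansionD(7)[OF i \<phi>_dual[OF i]] by (intro summableI_nonneg_bounded) auto
    ultimately show "summable (\<lambda>k. \<sigma> i 0 * ((cmod (a i k (x i)))\<^sup>2 + (cmod (\<phi> i (y i k)))\<^sup>2))"
      by (intro summable_mult summable_add)
    fix k
    have "\<bar>\<sigma> i k\<bar> \<le> \<sigma> i 0"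
      using expansionD(1,2)[OF i] by (auto simp: decseq_def)
    moreover have "cmod (a i k (x i)) * cmod (\<phi> i (y i k)) \<le> (cmod (a i k (x i)))\<^sup>2 + (cmod (\<phi> i (y i k)))\<^sup>2"
      using sum_squares_bound[of "cmod (a i k (x i))" "cmod (\<phi> i (y i k))"]
        mult_nonneg_nonneg[of "cmod (a i k (x i))" "cmod (\<phi> i (y i k))"] by (simp del: mult_nonneg_nonneg)
    ultimately show "norm (cmod (g i k)) \<le> \<sigma> i 0 * ((cmod (a i k (x i)))\<^sup>2 + (cmod (\<phi> i (y i k)))\<^sup>2)"
      unfolding g_def norm_mult using expansionD(2)[OF i] by (simp add: mult.assoc mult_mono)
  qed
  have "(\<lambda>n. if n \<in> {n. 0 < c n} then \<Prod>i\<in>{1..m}. g i (\<pi> n i) else 0) sums (\<Prod>i\<in>{1..m}. \<Sum>k. g i k)"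
  proof (rule sums_product_rearrangement[OF _ g_summable \<pi>_bij])
    fix j assume j: "j \<in> (\<Pi>\<^sub>E i\<in>{1..m}. UNIV) - {j \<in> (\<Pi>\<^sub>E i\<in>{1..m}. UNIV). 0 < (\<Prod>i\<in>{1..m}. \<sigma> i (j i))}"
    \<comment> \<open>A product of nonnegative numbers that is not positive has a zero factor, and g
      contains that factor.\<close>
    have "\<not> (\<forall>i\<in>{1..m}. 0 < \<sigma> i (j i))"
    proof
      assume "\<forall>i\<in>{1..m}. 0 < \<sigma> i (j i)"
      then have "0 < (\<Prod>i\<in>{1..m}. \<sigma> i (j i))" by (intro prod_pos) blast
      then show False using j by blast
    qed
    then obtain i where "i \<in> {1..m}" "\<sigma> i (j i) = 0"
      using expansionD(2) by (metis order_le_less)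
    then show "(\<Prod>i\<in>{1..m}. g i (j i)) = 0"
      by (intro prod_zero) (auto simp: g_def)
  qed auto
  also have "(\<Prod>i\<in>{1..m}. \<Sum>k. g i k) = (\<Prod>i\<in>{1..m}. \<phi> i (T i (x i)))"
    using g_sums by (intro prod.cong) (auto simp: sums_iff)
  also have "\<dots> = elementary_tensor m Y (\<lambda>i\<in>{1..m}. T i (x i)) ?F"
    using Tx Y.dual_families_form[OF \<phi>]
    by (simp add: elementary_tensor_def Y.product_form_def del: One_nat_def)
  also have "(\<lambda>n. if n \<in> {n. 0 < c n} then \<Prod>i\<in>{1..m}. g i (\<pi> n i) else 0) = (\<lambda>n. v n * basis_value n ?F)"
    by (auto simp: fun_eq_iff v_def coeff_elementary[OF x] basis_value_product_form c_eq g_def prod.distrib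
        simp del: One_nat_def)
  finally have sums: "(\<lambda>n. v n * basis_value n ?F) sums elementary_tensor m Y (\<lambda>i\<in>{1..m}. T i (x i)) ?F" .
  have lim: "(\<lambda>M. partial_synthesis v M ?F) \<longlonglongrightarrow> elementary_tensor m Y (\<lambda>i\<in>{1..m}. T i (x i)) ?F"
    using sums Y.dual_families_form[OF \<phi>] by (simp add: sums_def partial_synthesis_def)
  \<comment> \<open>As c decreases, \<open>c N\<close> can be taken out of the block starting at N;
    letting M grow replaces the longer partial sum by the limit.\<close>
  have "cmod (partial_synthesis v N ?F - partial_synthesis v M ?F) \<le> c N * Q" if "N \<le> M" for M
  proof -
    have "L2_set (\<lambda>n. cmod (v n)) {N..<M} \<le> L2_set (\<lambda>n. c N * cmod (coeff n (elementary_tensor m X x))) {N..<M}"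
      using c_dec c_nonneg by (intro L2_set_mono) (auto simp: v_def norm_mult decseq_def intro!: mult_right_mono)
    also have "\<dots> = c N * L2_set (\<lambda>n. cmod (coeff n (elementary_tensor m X x))) {N..<M}"
      using c_nonneg by (simp add: L2_set_right_distrib)
    also have "\<dots> \<le> c N * (G * (\<Prod>i=1..m. nrm (X i) (x i)))"
      using order_trans[OF L2_set_interval_mono coeff_elementary_le[OF x]] c_nonneg by (intro mult_left_mono)
    finally have "L2_set (\<lambda>n. cmod (v n)) {N..<M} * G \<le> c N * (G * (\<Prod>i=1..m. nrm (X i) (x i))) * G"
      using G_pos by (intro mult_right_mono) auto
    then show ?thesis
      using synthesis_tail_le[OF \<phi> that, of v] by (simp add: Q_def norm_minus_commute mult.assoc del: One_nat_def)
  qed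
  then show "cmod (partial_synthesis v N ?F - elementary_tensor m Y (\<lambda>i\<in>{1..m}. T i (x i)) ?F) \<le> c N * Q"
    by (intro LIMSEQ_le_const2[OF tendsto_norm[OF tendsto_diff[OF tendsto_const lim]]]) blast
qed

lemma synthesis_elementary:
  assumes x: "x \<in> tuples m X"
  shows "synthesis_op (diagonal_op c (analysis_op (projective_elem m X x)))
    = injective_elem m Y (\<lambda>i\<in>{1..m}. T i (x i))"
proof -
  let ?e = "elementary_tensor m X x" and ?f = "elementary_tensor m Y (\<lambda>i\<in>{1..m}. T i (x i))"
  have eC: "?e \<in> carrier PX" using X.elementary_in_tensors[OF x] by simp
  have "(\<lambda>i\<in>{1..m}. T i (x i)) \<in> tuples m Y"
    using T X.tuples_component[OF x] by auto
  then have fC: "?f \<in> carrier IY" using Y.elementary_in_tensors by simp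
  have "analysis_op (projective_elem m X x) n = coeff n ?e" for n
    using LIMSEQ_unique[OF analysis_lim[OF PX.ncauchy_const[OF eC], of n] tendsto_const]
    by (simp add: projective_elem_def PX.completion_embed_eq)
  then have v: "diagonal_op c (analysis_op (projective_elem m X x)) = (\<lambda>n. complex_of_real (c n) * coeff n ?e)"
    by (simp add: diagonal_op_def fun_eq_iff)
  have "projective_elem m X x \<in> carrier (projective_tensor m X)"
    using PX.cls_in_completion[OF PX.ncauchy_const[OF eC]]
    by (simp add: projective_elem_def projective_tensor_def PX.completion_embed_eq)
  then have "analysis_op (projective_elem m X x) \<in> carrier ell2"
    using analysis_op_bounded unfolding bounded_op_def by (blast intro: clinear_mapD(1))
  moreover have "\<bar>c n\<bar> \<le> c 0" for n
    using c_dec c_nonneg by (auto simp: decseq_def)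
  ultimately have vC: "(\<lambda>n. complex_of_real (c n) * coeff n ?e) \<in> carrier ell2"
    unfolding v[symmetric] by (intro diagonal_op_bound(1))
  have "(\<lambda>N. c N * (G * (\<Prod>i=1..m. nrm (X i) (x i)) * G)) \<longlonglongrightarrow> 0"
    by (rule tendsto_mult_left_zero[OF c_null])
  from tendsto_zero_majorant[OF this _ partial_synthesis_tendsto[OF x]]
  have "(\<lambda>N. nrm IY (partial_synthesis (\<lambda>n. complex_of_real (c n) * coeff n ?e) N \<ominus>\<^bsub>IY\<^esub> ?f)) \<longlonglongrightarrow> 0"
    using IY.nrm_nonneg[OF IY.M.minus_closed[OF _ fC]] by (simp add: partial_synthesis_in_tensors)
  then show ?thesis
    unfolding v synthesis_op_def injective_elem_def IY.completion_embed_eq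
    using IY.cls_eq_iff[OF partial_synthesis_cauchy[OF vC] IY.ncauchy_const[OF fC]] by simp
qed

text \<open>The composite through the diagonal operator has the prescribed values on elementary
  tensors, and bounded operators with these values agree on the dense image of the algebraic tensor
  product.\<close>

lemma tensor_operator_factors:
  assumes summ: "summable (\<lambda>n. real (Suc n) powr (s / r - 1) * c n powr s)"
  shows "factors_lorentz_schatten TYPE(nat \<Rightarrow> complex) r s
    (projective_tensor m X) (injective_tensor m Y) (tensor_operator m X Y T)"
proof -
  let ?Z = "projective_tensor m X" and ?W = "injective_tensor m Y"
  have Z: "complex_normed_space ?Z" and W: "complex_normed_space ?W"
    unfolding projective_tensor_def injective_tensor_def
    by (rule PX.completion_normed_space IY.completion_normed_space)+
  \<comment> \<open>The definite description asks for an extensional function, hence the restriction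
    to the carrier.\<close>
  define S where "S = (\<lambda>P\<in>carrier ?Z. synthesis_op (diagonal_op c (analysis_op P)))"
  have c0: "\<bar>c n\<bar> \<le> c 0" for n
    using c_dec c_nonneg by (auto simp: decseq_def)
  obtain KA where KA: "0 \<le> KA" "clinear_map ?Z ell2 analysis_op"
    "\<And>P. P \<in> carrier ?Z \<Longrightarrow> nrm ell2 (analysis_op P) \<le> KA * nrm ?Z P"
    using Z analysis_op_bounded by (rule bounded_opE) (rule that; assumption)
  obtain KB where KB: "0 \<le> KB" "clinear_map ell2 ?W synthesis_op"
    "\<And>v. v \<in> carrier ell2 \<Longrightarrow> nrm ?W (synthesis_op v) \<le> KB * nrm ell2 v"
    using ell2_normed_space synthesis_op_bounded by (rule bounded_opE) (rule that; assumption)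
  have lin: "clinear_map ?Z ?W (\<lambda>P. synthesis_op (diagonal_op c (analysis_op P)))"
    by (rule clinear_map_compose[OF clinear_map_compose[OF KA(2) diagonal_op_clinear[of c "c 0", OF c0]] KB(2)])
  interpret Z: complex_normed_space ?Z by (rule Z)
  have "clinear_map ?Z ?W S"
    using clinear_mapD[OF lin] by (intro clinear_mapI) (simp_all add: S_def)
  moreover have "nrm ?W (S P) \<le> (KB * c 0 * KA) * nrm ?Z P" if P: "P \<in> carrier ?Z" for P
  proof -
    have aC: "analysis_op P \<in> carrier ell2" using KA(2) P by (rule clinear_mapD(1))
    note d = diagonal_op_bound[of c "c 0", OF c0 aC]
    have "nrm ?W (S P) \<le> KB * nrm ell2 (diagonal_op c (analysis_op P))"
      using KB(3)[OF d(1)] P by (simp add: S_def)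
    also have "\<dots> \<le> KB * (c 0 * (KA * nrm ?Z P))"
      using order_trans[OF d(2) mult_left_mono[OF KA(3)[OF P] c_nonneg]] KB(1) by (rule mult_left_mono)
    finally show ?thesis by (simp only: mult.assoc)
  qed
  ultimately have S_bounded: "bounded_op ?Z ?W S"
    unfolding bounded_op_def by blast
  have S_elem: "S (projective_elem m X x) = injective_elem m Y (\<lambda>i\<in>{1..m}. T i (x i))"
    if x: "x \<in> tuples m X" for x
  proof -
    have "projective_elem m X x \<in> carrier ?Z"
      using PX.cls_in_completion[OF PX.ncauchy_const[of "elementary_tensor m X x"]] X.elementary_in_tensors[OF x]
      by (simp add: projective_elem_def projective_tensor_def PX.completion_embed_eq)
    then show ?thesis using synthesis_elementary[OF x] by (simp add: S_def)
  qed
  have "tensor_operator m X Y T = S"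
    unfolding tensor_operator_def
  proof (rule the_equality)
    show "S \<in> extensional (carrier ?Z) \<and> bounded_op ?Z ?W S \<and>
      (\<forall>x\<in>tuples m X. S (projective_elem m X x) = injective_elem m Y (\<lambda>i\<in>{1..m}. T i (x i)))"
      using S_bounded S_elem by (simp add: S_def)
    fix R assume R: "R \<in> extensional (carrier ?Z) \<and> bounded_op ?Z ?W R \<and>
      (\<forall>x\<in>tuples m X. R (projective_elem m X x) = injective_elem m Y (\<lambda>i\<in>{1..m}. T i (x i)))"
    have embed_add: "completion_embed PX (u \<oplus>\<^bsub>PX\<^esub> v) = completion_embed PX u \<oplus>\<^bsub>?Z\<^esub> completion_embed PX v"
      if "u \<in> carrier PX" "v \<in> carrier PX" for u v
      unfolding projective_tensor_def PX.completion_embed_eq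
      using PX.add_completion[OF PX.ncauchy_const[OF that(1)] PX.ncauchy_const[OF that(2)]] by (rule sym)
    have embed_in: "completion_embed PX u \<in> carrier ?Z" if "u \<in> carrier PX" for u
      unfolding projective_tensor_def PX.completion_embed_eq
      by (rule PX.cls_in_completion[OF PX.ncauchy_const[OF that]])
    have linR: "clinear_map ?Z ?W R" and linS: "clinear_map ?Z ?W S"
      using R S_bounded by (simp_all add: bounded_op_def)
    \<comment> \<open>Values on elementary tensors spread to all tensor sums by additivity, one
      summand at a time.\<close>
    have agree: "R (completion_embed PX (tensor_sum m X n xs)) = S (completion_embed PX (tensor_sum m X n xs))"
      if "xs \<in> {..<n} \<rightarrow> tuples m X" for n xs
      using that
    proof (induction n)
      case 0
      have "tensor_sum m X 0 xs = \<zero>\<^bsub>PX\<^esub>" by (simp add: tensor_sum_def)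
      then have "completion_embed PX (tensor_sum m X 0 xs) = \<zero>\<^bsub>?Z\<^esub>"
        by (simp only: projective_tensor_def PX.completion_embed_eq PX.zero_completion)
      then show ?case
        using clinear_map_zero[OF Z W linR] clinear_map_zero[OF Z W linS] by simp
    next
      case (Suc n)
      have xn: "xs n \<in> tuples m X" using Suc.prems by auto
      have xs: "xs \<in> {..<n} \<rightarrow> tuples m X" using Suc.prems by auto
      have C: "tensor_sum m X n xs \<in> carrier PX" "elementary_tensor m X (xs n) \<in> carrier PX"
        using X.tensor_sum_in_tensors[OF xs] X.elementary_in_tensors[OF xn] by simp_all
      have "tensor_sum m X (Suc n) xs = tensor_sum m X n xs \<oplus>\<^bsub>PX\<^esub> elementary_tensor m X (xs n)"
        by (auto simp: tensor_sum_def elementary_tensor_def fun_eq_iff)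
      moreover have "R (completion_embed PX (elementary_tensor m X (xs n))) = S (completion_embed PX (elementary_tensor m X (xs n)))"
        using R xn S_elem[OF xn] unfolding projective_elem_def by simp
      ultimately show ?case
        using clinear_mapD(2)[OF linR embed_in[OF C(1)] embed_in[OF C(2)]]
          clinear_mapD(2)[OF linS embed_in[OF C(1)] embed_in[OF C(2)]] Suc.IH[OF xs]
        by (simp only: embed_add[OF C])
    qed
    have "R P = S P" if "P \<in> carrier ?Z" for P
    proof (rule PX.bounded_op_completion_unique[OF W])
      show "bounded_op (completion PX) ?W R" "bounded_op (completion PX) ?W S"
        using R S_bounded by (simp_all add: projective_tensor_def)
      show "P \<in> carrier (completion PX)" using that by (simp add: projective_tensor_def)
      fix u assume "u \<in> carrier PX"
      then have "u \<in> X.tensors" by simp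
      then show "R (completion_embed PX u) = S (completion_embed PX u)"
        by (rule X.tensorsE) (use agree in blast)
    qed
    then show "R = S"
      using R by (intro extensionalityI[of R "carrier ?Z" S]) (auto simp: S_def)
  qed
  moreover have "diagonal_op c \<in> lorentz_schatten r s ell2"
    using c_dec c_nonneg c_null summ by (rule diagonal_op_lorentz_schatten)
  moreover have "\<forall>P\<in>carrier ?Z. S P = synthesis_op (diagonal_op c (analysis_op P))"
    by (simp add: S_def)
  ultimately show ?thesis
    unfolding factors_lorentz_schatten_def
    using S_bounded ell2_hilbert_space analysis_op_bounded synthesis_op_bounded by blast
qed

end

section \<open>Combining the expansions of all factors\<close>

theorem theorem5p6:
  fixes m :: nat and r s :: real
    and X :: "nat \<Rightarrow> 'a normed" and Y :: "nat \<Rightarrow> 'b normed"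
    and T :: "nat \<Rightarrow> 'a \<Rightarrow> 'b"
  assumes "1 \<le> m" and "0 < s" and "s \<le> r"
    and "\<And>i. i \<in> {1..m} \<Longrightarrow> complex_banach_space (X i)"
    and "\<And>i. i \<in> {1..m} \<Longrightarrow> complex_banach_space (Y i)"
    and "\<And>i. i \<in> {1..m} \<Longrightarrow> bounded_op (X i) (Y i) (T i)"
    and "\<And>i. i \<in> {1..m} \<Longrightarrow> \<exists>x\<in>carrier (X i). T i x \<noteq> \<zero>\<^bsub>Y i\<^esub>"
    and "\<And>i. i \<in> {1..m} \<Longrightarrow> factors_lorentz_schatten TYPE('h) r s (X i) (Y i) (T i)"
  shows "factors_lorentz_schatten TYPE(nat \<Rightarrow> complex) r s
           (projective_tensor m X) (injective_tensor m Y) (tensor_operator m X Y T)"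
proof -
  have r: "0 < r" using assms(2,3) by simp
  have X: "complex_normed_space (X i)" and Y: "complex_normed_space (Y i)" if "i \<in> {1..m}" for i
    using assms(4,5)[OF that] by (simp_all add: complex_banach_space_def)
  \<comment> \<open>The condition on i stands under the quantifiers so that repeated choice yields
    families defined for all i.\<close>
  have ex: "\<forall>i. \<exists>\<sigma> a y C. i \<in> {1..m} \<longrightarrow> lorentz_expansion r s (X i) (Y i) (T i) \<sigma> a y C"
    using factors_lorentz_schatten_expansion[OF X Y r assms(2) assms(8)] by blast
  obtain \<sigma> a y C where expansion:
    "\<And>i. i \<in> {1..m} \<Longrightarrow> lorentz_expansion r s (X i) (Y i) (T i) (\<sigma> i) (a i) (y i) (C i)"
  proof -
    from choice[OF ex] obtain \<sigma> where "\<forall>i. \<exists>a y C. i \<in> {1..m} \<longrightarrow> lorentz_expansion r s (X i) (Y i) (T i) (\<sigma> i) a y C" ..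
    from choice[OF this] obtain a where "\<forall>i. \<exists>y C. i \<in> {1..m} \<longrightarrow> lorentz_expansion r s (X i) (Y i) (T i) (\<sigma> i) (a i) y C" ..
    from choice[OF this] obtain y where "\<forall>i. \<exists>C. i \<in> {1..m} \<longrightarrow> lorentz_expansion r s (X i) (Y i) (T i) (\<sigma> i) (a i) (y i) C" ..
    from choice[OF this] obtain C where "\<forall>i. i \<in> {1..m} \<longrightarrow> lorentz_expansion r s (X i) (Y i) (T i) (\<sigma> i) (a i) (y i) (C i)" ..
    then show thesis using that by blast
  qed
  have \<sigma>: "decseq (\<sigma> i)" "0 \<le> \<sigma> i n" "\<sigma> i \<longlonglongrightarrow> 0"
    "summable (\<lambda>n. real (Suc n) powr (s / r - 1) * \<sigma> i n powr s)" if "i \<in> {1..m}" for i n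
    using expansion[OF that] by (simp_all add: lorentz_expansion_def)
  obtain c \<pi> where c: "decseq c" "\<And>n. 0 \<le> c n" "c \<longlonglongrightarrow> 0"
    "bij_betw \<pi> {n. 0 < c n} {j \<in> (\<Pi>\<^sub>E i\<in>{1..m}. UNIV). 0 < (\<Prod>i\<in>{1..m}. \<sigma> i (j i))}"
    "\<And>n. 0 < c n \<Longrightarrow> c n = (\<Prod>i\<in>{1..m}. \<sigma> i (\<pi> n i))"
    and rank: "\<And>n. 0 < c n \<Longrightarrow> (\<Prod>i\<in>{1..m}. Suc (\<pi> n i)) \<le> Suc n"
  proof (rule product_rearrangement[of "{1..m}" \<sigma>])
    show "finite {1..m}" by simp
  qed (erule \<sigma> | rule that; assumption)+
  have "s / r - 1 \<le> 0" using assms(3) r by simp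
  then have summ: "summable (\<lambda>n. real (Suc n) powr (s / r - 1) * c n powr s)"
    using assms(2) \<sigma> c bij_betw_imp_inj_on[OF c(4)] bij_betw_apply[OF c(4)] rank
    by (intro summable_product_rearrangement[of "{1..m}" s _ \<sigma> c \<pi>]) auto
  have T: "T i x \<in> carrier (Y i)" if "i \<in> {1..m}" "x \<in> carrier (X i)" for i x
    using assms(6)[OF that(1)] that(2) by (auto simp: bounded_op_def intro: clinear_mapD(1))
  interpret expanded_factors m X Y T r s \<sigma> a y C c \<pi>
    by (rule expanded_factors.intro[OF tensor_factors.intro[OF assms(1) X] tensor_factors.intro[OF assms(1) Y]
          expanded_factors_axioms.intro[OF T expansion c]])
  show ?thesis using summ by (rule tensor_operator_factors)
qed

end
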